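(* Let $f\colon\mathbb{R}^d\to\mathbb{R}\cup\{+\infty\}$ be closed, $G\colon\mathbb{R}_{++}\times\mathrm{dom} f\times\mathbb{R}^d\to\mathbb{R}^d$, and let $\{x_k\}$ be generated by $x_{k+1}=x_k-\alpha_kG_{\alpha_k}(x_k,\nu_k)$ under the standing assumptions (E1)–(E4) in the context. Suppose Assumption A (see the context) holds at $\bar x$ with manifold $\mathcal{M}$ and constant $\mu$. For $k_0\ge1$ and $\delta>0$ let $\tau_{k_0,\delta}:=\inf\{j\ge k_0: x_j\notin B_\delta(\bar x)\}$. Then for all $k_0\ge1$ and all sufficiently small $\delta>0$, there exist a constant $C$ and a sequence of $\mathcal{F}_{k+1}$-measurable random vectors $E_k\in\mathbb{R}^d$ such that: 1. The shadow sequence $y_k:=P_{\mathcal{M}}(x_k)$ if $x_k\in B_{2\delta}(\bar x)$ and $y_k:=\bar x$ otherwise satisfies $y_k\in B_{4\delta}(\bar x)\cap\mathcal{M}$ for all $k$, and $$y_{k+1}=y_k-\alpha_k\nabla_{\mathcal{M}}f(y_k)-\alpha_kP_{T_{\mathcal{M}}(y_k)}(\nu_k)+\alpha_kE_k\qquad\text{for all }k\ge1.$$ Moreover, for such $k$, $\mathbb{E}_k[P_{T_{\mathcal{M}}(y_k)}(\nu_k)]=0$. 2. Let $\gamma\in(1/2,1]$ and assume $c_1\ge32/\mu$ if $\gamma=1$. Then: (a) For all $k\ge k_0$: (i) $\|E_k\|1_{\tau_{k_0,\delta}>k}\le C(1+\|\nu_k\|)^2(\mathrm{dist}(x_k,\mathcal{M})+\alpha_k)1_{\tau_{k_0,\delta}>k}$;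 (ii) $\max\{\mathbb{E}_k[\|E_k\|]1_{\tau_{k_0,\delta}>k},\ \mathbb{E}_k[\|E_k\|^2]1_{\tau_{k_0,\delta}>k}\}\le C$; (iii) $\mathbb{E}[\|E_k\|^21_{\tau_{k_0,\delta}>k}]\le C\alpha_k$. (b) The following sums are finite (almost surely): (i) $\sum_{k=1}^\infty\frac{k^{\gamma-1}}{\log(k+1)^2}\max\{\|E_k\|1_{\tau_{k_0,\delta}>k},\ \mathbb{E}_k[\|E_k\|]1_{\tau_{k_0,\delta}>k}\}<+\infty$; (ii) $\sum_{k=1}^\infty\frac{k^{\gamma-1}}{\log(k+1)^2}\max\{\|E_k\|^21_{\tau_{k_0,\delta}>k},\ \mathbb{E}_k[\|E_k\|^2]1_{\tau_{k_0,\delta}>k}\}<+\infty$. (c) The tail sum is bounded: $\mathbb{E}\left[1_{\tau_{k_0,\delta}=\infty}\sum_{i=k}^\infty\alpha_i\|E_i\|\right]\le C\sum_{i=k}^\infty\alpha_i^2$ for all $k\ge1$.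
   Context: $P_{\mathcal{M}}$ is the nearest-point projection, $\mathrm{dist}$ the Euclidean distance, $T_{\mathcal{M}}(y)$ the tangent space, $B_r(x)$ the closed ball. For $f$ that is $C^2$ on $\mathcal{M}$ (i.e. locally agreeing on $\mathcal M$ with a $C^2$ function $\hat f$), the covariant gradient is $\nabla_{\mathcal{M}}f(y)=P_{T_{\mathcal{M}}(y)}(\nabla\hat f(y))$. Assumption A at $\bar x\in\mathrm{dom} f$: there exist constants $C,\mu>0$, a neighborhood $\mathcal{U}$ of $\bar x$, and a $C^3$ manifold $\mathcal{M}\subseteq\mathrm{dom} f$ containing $\bar x$ such that for all $\nu\in\mathbb{R}^d$ and $\alpha>0$, with $\mathcal{U}_f:=\mathcal{U}\cap\mathrm{dom} f$: (A1) $\sup_{x\in\mathcal{U}_f}\|G_\alpha(x,\nu)\|\le C(1+\|\nu\|)$. (A2) $f$ is $C^2$ on $\mathcal{M}$ and for all $x\in\mathcal{U}_f$, $\|P_{T_{\mathcal{M}}(P_{\mathcal{M}}(x))}(G_\alpha(x,\nu)-\nabla_{\mathcal{M}}f(P_{\mathcal{M}}(x))-\nu)\|\le C(1+\|\nu\|)^2(\mathrm{dist}(x,\mathcal{M})+\alpha)$. (A3) For $x\in\mathcal{U}_f$ tending to $\bar x$, $\langle G_\alpha(x,\nu)-\nu,x-P_{\mathcal{M}}(x)\rangle\ge\mu\,\mathrm{dist}(x,\mathcal{M})-(1+\|\nu\|)^2(o(\mathrm{dist}(x,\mathcal{M}))+C\alpha)$, where $o(\cdot)$ is a univariate function with $o(h)/h\to0$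 as $h\searrow0$. Standing assumptions. (E1) $G$ is measurable. (E2) There are $c_1,c_2>0$ and $\gamma\in(1/2,1]$ with $c_1k^{-\gamma}\le\alpha_k\le c_2k^{-\gamma}$. (E3) $\{\nu_k\}$ is a martingale difference sequence with respect to the increasing sequence of $\sigma$-fields $\mathcal{F}_k=\sigma(x_j:j\le k,\ \nu_j:j<k)$, and there is $q\colon\mathbb{R}^d\to\mathbb{R}_+$ bounded on bounded sets with $\mathbb{E}[\nu_k\mid\mathcal{F}_k]=0$ and $\mathbb{E}[\|\nu_k\|^4\mid\mathcal{F}_k]<q(x_k)$; write $\mathbb{E}_k[\cdot]=\mathbb{E}[\cdot\mid\mathcal{F}_k]$. (E4) $x_k\in\mathrm{dom} f$ for all $k\ge1$. *)

theory Defs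
  imports "HOL-Probability.Probability"
begin

section \<open>Smooth maps and embedded manifolds\<close>

text \<open>\<open>Ck_on k U g\<close>: the map \<open>g\<close> is of class \<open>C\<close>-\<open>k\<close> on the open set \<open>U\<close>. The recursion is on
  directional derivatives, which in finite dimension is the usual notion; \<open>U\<close> is always open where
  the predicate is used.\<close>

primrec Ck_on :: "nat \<Rightarrow> 'a::euclidean_space set \<Rightarrow> ('a \<Rightarrow> 'b::real_normed_vector) \<Rightarrow> bool" where
  "Ck_on 0 U g \<longleftrightarrow> continuous_on U g"
| "Ck_on (Suc k) U g \<longleftrightarrow>
     (\<forall>z\<in>U. g differentiable (at z)) \<and> (\<forall>v. Ck_on k U (\<lambda>z. frechet_derivative g (at z) v))"

text \<open>A local defining map of \<open>M\<close> around \<open>y\<close> is a \<open>C\<close>-\<open>p\<close> map on an open neighbourhood \<open>U\<close> of \<open>y\<close>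
  with surjective derivative at \<open>y\<close> whose zero set is \<open>M \<inter> U\<close>. Its codomain, a Euclidean space of
  dimension equal to the codimension of \<open>M\<close>, is represented by a linear subspace \<open>W\<close> of the ambient
  space, since a type cannot depend on the codimension.\<close>

definition local_defining_map ::
  "nat \<Rightarrow> 'a::euclidean_space set \<Rightarrow> 'a \<Rightarrow> 'a set \<Rightarrow> 'a set \<Rightarrow> ('a \<Rightarrow> 'a) \<Rightarrow> bool" where
  "local_defining_map p M y U W F \<longleftrightarrow>
     open U \<and> y \<in> U \<and> subspace W \<and> F ` U \<subseteq> W \<and> Ck_on p U F \<and>
     range (frechet_derivative F (at y)) = W \<and> M \<inter> U = {z \<in> U. F z = 0}"

definition Ck_manifold :: "nat \<Rightarrow> 'a::euclidean_space set \<Rightarrow> bool" where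
  "Ck_manifold p M \<longleftrightarrow>
     (\<exists>r. \<forall>y\<in>M. \<exists>U W F. local_defining_map p M y U W F \<and> dim W + r = DIM('a))"

text \<open>The kernel of the derivative does not depend on the local defining map.\<close>

definition tangent_space :: "'a::euclidean_space set \<Rightarrow> 'a \<Rightarrow> 'a set" where
  "tangent_space M y =
     {v. \<exists>U W F. local_defining_map 1 M y U W F \<and> frechet_derivative F (at y) v = 0}"

text \<open>Nearest-point projections, both onto a manifold and onto a tangent space, are
  \<^const>\<open>closest_point\<close>. For a manifold this is determined only near the manifold.\<close>

abbreviation tangent_proj :: "'a::euclidean_space set \<Rightarrow> 'a \<Rightarrow> 'a \<Rightarrow> 'a" where
  "tangent_proj M y v \<equiv> closest_point (tangent_space M y) v"

section \<open>Extended-real functions\<close>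

definition edom :: "('a \<Rightarrow> ereal) \<Rightarrow> 'a set" where
  "edom f = {x. f x < \<infinity>}"

definition closed_fun :: "('a::euclidean_space \<Rightarrow> ereal) \<Rightarrow> bool" where
  "closed_fun f \<longleftrightarrow> closed {(x, r::real). f x \<le> ereal r}"

definition C2_extension ::
  "('a::euclidean_space \<Rightarrow> ereal) \<Rightarrow> 'a set \<Rightarrow> 'a \<Rightarrow> 'a set \<Rightarrow> ('a \<Rightarrow> real) \<Rightarrow> bool" where
  "C2_extension f M y V fh \<longleftrightarrow>
     open V \<and> y \<in> V \<and> Ck_on 2 V fh \<and> (\<forall>z\<in>M \<inter> V. f z = ereal (fh z))"

definition C2_on_manifold :: "('a::euclidean_space \<Rightarrow> ereal) \<Rightarrow> 'a set \<Rightarrow> bool" where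
  "C2_on_manifold f M \<longleftrightarrow> (\<forall>y\<in>M. \<exists>V fh. C2_extension f M y V fh)"

text \<open>The value does not depend on the chosen extension.\<close>

definition cov_grad :: "('a::euclidean_space \<Rightarrow> ereal) \<Rightarrow> 'a set \<Rightarrow> 'a \<Rightarrow> 'a" where
  "cov_grad f M y =
     (THE g. \<exists>V fh D. C2_extension f M y V fh \<and> (GDERIV fh y :> D) \<and> g = tangent_proj M y D)"

section \<open>The local assumption at a point\<close>

text \<open>In the last clause the remainder function \<open>h\<close> and the neighbourhood in which the bound holds
  are uniform in \<open>\<nu>\<close> and \<open>\<alpha>\<close>.\<close>

definition assumption_A ::
  "('a::euclidean_space \<Rightarrow> ereal) \<Rightarrow> (real \<Rightarrow> 'a \<Rightarrow> 'a \<Rightarrow> 'a) \<Rightarrow> 'a \<Rightarrow> 'a set \<Rightarrow> real \<Rightarrow> bool" where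
  "assumption_A f G xbar M \<mu> \<longleftrightarrow>
     \<mu> > 0 \<and> Ck_manifold 3 M \<and> M \<subseteq> edom f \<and> xbar \<in> M \<and> C2_on_manifold f M \<and>
     (\<exists>C>0. \<exists>U. xbar \<in> interior U \<and>
        (\<forall>\<nu>. \<forall>\<alpha>>0. \<forall>x\<in>U \<inter> edom f. norm (G \<alpha> x \<nu>) \<le> C * (1 + norm \<nu>)) \<and>
        (\<forall>\<nu>. \<forall>\<alpha>>0. \<forall>x\<in>U \<inter> edom f.
           norm (tangent_proj M (closest_point M x)
                   (G \<alpha> x \<nu> - cov_grad f M (closest_point M x) - \<nu>))
             \<le> C * (1 + norm \<nu>)\<^sup>2 * (infdist x M + \<alpha>)) \<and>
        (\<exists>h :: real \<Rightarrow> real. ((\<lambda>t. h t / t) \<longlongrightarrow> 0) (at_right 0) \<and>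
           (\<forall>\<^sub>F x in nhds xbar. x \<in> U \<inter> edom f \<longrightarrow>
              (\<forall>\<nu>. \<forall>\<alpha>>0.
                 (G \<alpha> x \<nu> - \<nu>) \<bullet> (x - closest_point M x)
                   \<ge> \<mu> * infdist x M - (1 + norm \<nu>)\<^sup>2 * (h (infdist x M) + C * \<alpha>)))))"

section \<open>The stochastic process\<close>

text \<open>All sequences are indexed from 1; their values at index 0 play no role.\<close>

definition history ::
  "'w measure \<Rightarrow> (nat \<Rightarrow> 'w \<Rightarrow> 'a::euclidean_space) \<Rightarrow> (nat \<Rightarrow> 'w \<Rightarrow> 'a) \<Rightarrow> nat \<Rightarrow> 'w measure" where
  "history P x \<nu> k = sigma (space P)
     ({x j -` A \<inter> space P | j A. 1 \<le> j \<and> j \<le> k \<and> A \<in> sets borel} \<union>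
      {\<nu> j -` A \<inter> space P | j A. 1 \<le> j \<and> j < k \<and> A \<in> sets borel})"

text \<open>Conditional expectation of an integrable random vector, coordinate by coordinate.\<close>

definition vec_cond_exp :: "'w measure \<Rightarrow> 'w measure \<Rightarrow> ('w \<Rightarrow> 'a::euclidean_space) \<Rightarrow> 'w \<Rightarrow> 'a" where
  "vec_cond_exp P F X \<omega> = (\<Sum>b\<in>Basis. real_cond_exp P F (\<lambda>\<omega>. X \<omega> \<bullet> b) \<omega> *\<^sub>R b)"

text \<open>Each \<open>\<nu> k\<close> is measurable with respect to \<open>history P x \<nu> (k + 1)\<close> by construction.\<close>

definition martingale_difference ::
  "'w measure \<Rightarrow> (nat \<Rightarrow> 'w measure) \<Rightarrow> (nat \<Rightarrow> 'w \<Rightarrow> 'a::euclidean_space) \<Rightarrow> bool" where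
  "martingale_difference P F \<nu> \<longleftrightarrow>
     (\<forall>k\<ge>1. \<nu> k \<in> borel_measurable (F (k + 1)) \<and> integrable P (\<nu> k) \<and>
       (AE \<omega> in P. vec_cond_exp P (F k) (\<nu> k) \<omega> = 0))"

definition exit_time ::
  "(nat \<Rightarrow> 'w \<Rightarrow> 'a::euclidean_space) \<Rightarrow> 'a \<Rightarrow> nat \<Rightarrow> real \<Rightarrow> 'w \<Rightarrow> enat" where
  "exit_time x xbar k0 \<delta> \<omega> = Inf (enat ` {j. k0 \<le> j \<and> x j \<omega> \<notin> cball xbar \<delta>})"

definition shadow ::
  "(nat \<Rightarrow> 'w \<Rightarrow> 'a::euclidean_space) \<Rightarrow> 'a \<Rightarrow> 'a set \<Rightarrow> real \<Rightarrow> nat \<Rightarrow> 'w \<Rightarrow> 'a" where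
  "shadow x xbar M \<delta> k \<omega> =
     (if x k \<omega> \<in> cball xbar (2 * \<delta>) then closest_point M (x k \<omega>) else xbar)"

end

theory Submission
  imports Defs
begin

text \<open>Write \<open>p, p'\<close> for the nearest points on \<open>M\<close> of two points \<open>x, x'\<close> near \<open>xbar\<close>. Since \<open>x - p\<close> and
  \<open>x' - p'\<close> are normal to \<open>M\<close>, and tangent projections are Lipschitz along \<open>M\<close>, the difference of
  \<open>p' - p\<close> and the tangent projection of \<open>x' - x\<close> is of order
  \<open>\<bar>x' - x\<bar>\<^sup>2 + dist (x, M) \<bar>x' - x\<bar>\<close>; the nearest-point map need not be differentiated. With (A1) and (A2)
  this bounds the error \<open>E k\<close> before the exit time by \<open>(1 + \<bar>\<nu> k\<bar>)\<^sup>2 (dist (x k, M) + \<alpha> k)\<close>; a jump out of the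
  ball of radius \<open>2 \<delta>\<close> is possible only if \<open>\<alpha> k (1 + \<bar>\<nu> k\<bar>)\<close> is bounded below.

  By (A3) the stopped moments \<open>a k = E[dist\<^sup>2]\<close> and \<open>d k = E[dist]\<close> satisfy
  \<open>a (k + 1) \<le> a k - \<mu> \<alpha> k d k + B (\<alpha> k)\<^sup>2\<close>. As \<open>dist \<le> \<delta>\<close> before the exit time, \<open>d k \<ge> a k / \<delta>\<close>, and for small
  \<open>\<delta>\<close> the contraction is strong enough to give \<open>a k = O(\<alpha> k)\<close>. Summing the recursion, with weights where
  necessary, gives the estimates for \<open>d k\<close> and hence for \<open>E k\<close>.\<close>

section \<open>Maps of class C-k and tangent spaces of zero sets\<close>

text \<open>In (A3) the remainder is multiplied by the unbounded factor (1 + |\<nu>|)^2, so the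
  drift \<mu> dist does not dominate it pathwise. Only its conditional mean can be controlled, and
  the moment bound on the noise depends on the current state. This dictates the order of choices: a
  bound \<open>Q\<close> for \<open>q\<close> on the unit ball about \<open>xbar\<close>, then a
  slope \<epsilon> for the o-term so small that, even multiplied by the moment bound 8 (1 + Q), it
  costs at most half of the drift, then a radius \<rho> on which this slope is valid, and \<delta>
  last. It also explains why every moment estimate carries the indicator of the stopping event:
  there q (x k) is at most \<open>Q\<close>.

  The manifold is given only by local equations and need not be closed. Its geometry is therefore
  condensed into uniform estimates on one compact patch: chords are tangent up to second order, and
  tangent projections are Lipschitz in the base point. Both come from a single C^2 defining map at
  \<open>xbar\<close>, which remains a defining map at all nearby points of
  \<open>M\<close>.\<close>

lemma Ck_on_Suc_imp_Ck_on: "Ck_on (Suc k) U g \<Longrightarrow> Ck_on k U g"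
proof (induction k arbitrary: g)
  case 0
  then show ?case
    by (auto intro!: continuous_at_imp_continuous_on differentiable_imp_continuous_within)
next
  case (Suc k)
  then show ?case by (metis Ck_on.simps(2))
qed

lemma Ck_on_mono: "j \<le> k \<Longrightarrow> Ck_on k U g \<Longrightarrow> Ck_on j U g"
  by (induction k rule: dec_induct) (auto dest: Ck_on_Suc_imp_Ck_on simp del: Ck_on.simps)

lemma Ck_on_has_derivative:
  "Ck_on (Suc k) U g \<Longrightarrow> z \<in> U \<Longrightarrow> (g has_derivative frechet_derivative g (at z)) (at z)"
  using frechet_derivative_works by auto

section \<open>Lipschitz and second-order bounds on balls\<close>

lemma linear_norm_le_sum_Basis:
  fixes f :: "'a::euclidean_space \<Rightarrow> 'b::real_normed_vector"
  assumes "linear f"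
  shows "norm (f v) \<le> (\<Sum>b\<in>Basis. norm (f b)) * norm v"
proof -
  have "f v = (\<Sum>b\<in>Basis. (v \<bullet> b) *\<^sub>R f b)"
    by (subst euclidean_representation[symmetric, of v])
       (simp only: linear_sum[OF assms] linear_scale[OF assms])
  also have "norm \<dots> \<le> (\<Sum>b\<in>Basis. \<bar>v \<bullet> b\<bar> * norm (f b))"
    by (metis (mono_tags, lifting) norm_scaleR norm_sum sum.cong)
  also have "\<dots> \<le> (\<Sum>b\<in>Basis. norm v * norm (f b))"
    by (intro sum_mono mult_right_mono) (auto simp: Basis_le_norm)
  finally show ?thesis by (simp add: sum_distrib_left mult.commute)
qed

text \<open>\<open>Ck_on\<close> yields continuity of each directional derivative separately, not of
  an operator norm. The sum of their norms over \<open>Basis\<close> is continuous, hence bounded on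
  the compact ball, and dominates the operator norm; the mean value inequality on the convex ball
  does the rest.\<close>

lemma Ck_on_Lipschitz:
  fixes g :: "'a::euclidean_space \<Rightarrow> 'b::real_normed_vector"
  assumes g: "Ck_on (Suc k) U g" and sub: "cball z r \<subseteq> U"
  obtains L where "L \<ge> 0"
    "\<And>y y'. y \<in> cball z r \<Longrightarrow> y' \<in> cball z r \<Longrightarrow> norm (g y - g y') \<le> L * norm (y - y')"
proof -
  have c: "continuous_on (cball z r) (\<lambda>y. frechet_derivative g (at y) v)" for v
  proof -
    have "Ck_on 0 U (\<lambda>y. frechet_derivative g (at y) v)"
      using g by (intro Ck_on_mono[of 0 k]) auto
    with sub show ?thesis by (auto intro: continuous_on_subset)
  qed
  have "continuous_on (cball z r) (\<lambda>y. \<Sum>b\<in>Basis. norm (frechet_derivative g (at y) b))"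
    by (intro continuous_on_sum continuous_on_norm c)
  then have "bounded ((\<lambda>y. \<Sum>b\<in>Basis. norm (frechet_derivative g (at y) b)) ` cball z r)"
    by (intro compact_imp_bounded compact_continuous_image) auto
  then obtain B where B: "B > 0"
    "\<And>y. y \<in> cball z r \<Longrightarrow> norm (\<Sum>b\<in>Basis. norm (frechet_derivative g (at y) b)) \<le> B"
    unfolding bounded_pos by auto
  show thesis
  proof
    show "norm (g y - g y') \<le> B * norm (y - y')" if "y \<in> cball z r" "y' \<in> cball z r" for y y'
    proof (rule differentiable_bound[OF convex_cball _ _ that])
      fix w assume w: "w \<in> cball z r"
      then have d: "g differentiable (at w)" using g sub by auto
      then show "(g has_derivative frechet_derivative g (at w)) (at w within cball z r)"
        using frechet_derivative_works has_derivative_at_withinI by blast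
      have "norm (frechet_derivative g (at w) v) \<le> B * norm v" for v
      proof -
        have "(\<Sum>b\<in>Basis. norm (frechet_derivative g (at w) b)) \<le> B" using B(2)[OF w] by auto
        then show ?thesis
          using linear_norm_le_sum_Basis[OF linear_frechet_derivative[OF d], of v]
          by (meson dual_order.trans mult_right_mono norm_ge_zero)
      qed
      then show "onorm (frechet_derivative g (at w)) \<le> B" by (intro onorm_le)
    qed
  qed (use B in auto)
qed

text \<open>The Lipschitz bound is applied to the directional derivative along each basis vector;
  linearity in the direction assembles the finitely many constants into one for all
  \<open>v\<close>.\<close>

lemma Ck_on_derivative_Lipschitz:
  fixes g :: "'a::euclidean_space \<Rightarrow> 'b::real_normed_vector"
  assumes g: "Ck_on 2 U g" and sub: "cball z r \<subseteq> U"
  obtains L where "L \<ge> 0"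
    "\<And>y y' v. y \<in> cball z r \<Longrightarrow> y' \<in> cball z r \<Longrightarrow>
       norm (frechet_derivative g (at y) v - frechet_derivative g (at y') v) \<le> L * norm (y - y') * norm v"
proof -
  have "\<exists>L\<ge>0. \<forall>y\<in>cball z r. \<forall>y'\<in>cball z r.
          norm (frechet_derivative g (at y) b - frechet_derivative g (at y') b) \<le> L * norm (y - y')" for b
  proof -
    have "Ck_on (Suc 0) U (\<lambda>y. frechet_derivative g (at y) b)"
      using g unfolding numeral_2_eq_2 Ck_on.simps(2)[of "Suc 0"] by blast
    from Ck_on_Lipschitz[OF this sub] show ?thesis by metis
  qed
  then obtain L where L: "\<And>b. L b \<ge> 0" "\<And>b y y'. y \<in> cball z r \<Longrightarrow> y' \<in> cball z r \<Longrightarrow>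
          norm (frechet_derivative g (at y) b - frechet_derivative g (at y') b) \<le> L b * norm (y - y')"
    by metis
  show thesis
  proof
    show "sum L Basis \<ge> 0" by (simp add: L sum_nonneg)
    fix y y' v assume y: "y \<in> cball z r" "y' \<in> cball z r"
    have d: "g differentiable (at w)" if "w \<in> cball z r" for w
      using g sub that by (auto simp: numeral_2_eq_2)
    have "linear (\<lambda>v. frechet_derivative g (at y) v - frechet_derivative g (at y') v)"
      by (intro linear_compose_sub linear_frechet_derivative d y)
    from linear_norm_le_sum_Basis[OF this, of v]
    have "norm (frechet_derivative g (at y) v - frechet_derivative g (at y') v) \<le>
       (\<Sum>b\<in>Basis. norm (frechet_derivative g (at y) b - frechet_derivative g (at y') b)) * norm v" .
    also have "\<dots> \<le> (\<Sum>b\<in>Basis. L b * norm (y - y')) * norm v"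
      by (intro mult_right_mono sum_mono L y) auto
    finally show "norm (frechet_derivative g (at y) v - frechet_derivative g (at y') v) \<le>
        sum L Basis * norm (y - y') * norm v"
      by (simp add: sum_distrib_right)
  qed
qed

lemma Ck_on_second_order:
  fixes g :: "'a::euclidean_space \<Rightarrow> 'b::real_normed_vector"
  assumes g: "Ck_on 2 U g" and sub: "cball z r \<subseteq> U"
    and L: "L \<ge> 0" "\<And>y y' v. y \<in> cball z r \<Longrightarrow> y' \<in> cball z r \<Longrightarrow>
       norm (frechet_derivative g (at y) v - frechet_derivative g (at y') v) \<le> L * norm (y - y') * norm v"
    and y: "y \<in> cball z r" "y' \<in> cball z r"
  shows "norm (g y' - g y - frechet_derivative g (at y) (y' - y)) \<le> L * (norm (y' - y))\<^sup>2"
proof -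
  have seg: "closed_segment y y' \<subseteq> cball z r"
    by (rule closed_segment_subset[OF y convex_cball])
  have "norm (g y' - g y - frechet_derivative g (at y) (y' - y)) \<le> norm (y' - y) * (L * norm (y' - y))"
  proof (rule differentiable_bound_linearization[where S = "closed_segment y y'"])
    show "y + t *\<^sub>R (y' - y) \<in> closed_segment y y'" if "t \<in> {0..1}" for t
      using that by (auto simp: closed_segment_def algebra_simps intro!: exI[of _ t])
    show "y \<in> closed_segment y y'" by simp
    fix w assume w: "w \<in> closed_segment y y'"
    then have wc: "w \<in> cball z r" using seg by auto
    then show "(g has_derivative frechet_derivative g (at w)) (at w within closed_segment y y')"
      using Ck_on_has_derivative[of 1 U g w] g sub has_derivative_at_withinI
      by (metis Suc_1 subsetD)
    have wy: "norm (w - y) \<le> norm (y' - y)"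
      using segment_bound(1)[OF w] by (simp add: norm_minus_commute)
    show "onorm (frechet_derivative g (at w) - frechet_derivative g (at y)) \<le> L * norm (y' - y)"
      unfolding fun_diff_def
    proof (rule onorm_le)
      fix v
      show "norm (frechet_derivative g (at w) v - frechet_derivative g (at y) v) \<le> L * norm (y' - y) * norm v"
        using L(2)[OF wc y(1), of v] wy L(1)
        by (smt (verit, best) mult_left_mono mult_right_mono norm_ge_zero)
    qed
  qed
  then show ?thesis by (simp add: power2_eq_square mult_ac)
qed

text \<open>Every kernel direction of the derivative is the velocity of points of the zero set.
  \<open>\<Phi>\<close> corrects \<open>z - y\<close> by a right inverse \<open>B\<close> of
  \<open>A\<close> applied to the remainder of \<open>F\<close>; it has identity derivative at
  \<open>y\<close> and satisfies \<open>A (\<Phi> z) = F z\<close>. An open mapping theorem solves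
  \<open>\<Phi> z = t *\<^sub>R v\<close> for small \<open>t\<close>, and then \<open>F z\<close> is
  t times \<open>A v\<close>, hence 0.\<close>

lemma zero_set_tangent:
  fixes F :: "'a::euclidean_space \<Rightarrow> 'b::euclidean_space"
  assumes U: "open U" "y \<in> U" and F: "continuous_on U F" "(F has_derivative A) (at y)"
    and FU: "F ` U \<subseteq> range A" and Fy: "F y = 0" and v: "A v = 0" and e: "e > 0"
  shows "\<exists>s>0. \<forall>t. 0 < t \<and> t < s \<longrightarrow> (\<exists>z\<in>U. F z = 0 \<and> norm (z - y - t *\<^sub>R v) \<le> e * t)"
proof -
  have linA: "linear A" using F(2) has_derivative_linear by blast
  obtain B where B: "linear B" "\<And>w. w \<in> range A \<Longrightarrow> A (B w) = w"
    using linear_exists_right_inverse_on[OF linA subspace_UNIV] by blast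
  obtain K where K: "K > 0" "\<And>w. norm (B w) \<le> K * norm w"
    using linear_bounded_pos[OF B(1)] by blast
  \<comment> \<open>The bound 1/2 lets |z - y| be absorbed, giving |z - y| \<le> 2 t |v|; the other
    entry makes the resulting error \<kappa> 2 t |v| at most e t.\<close>
  define \<kappa> where "\<kappa> = min (1/2) (e / (2 * norm v + 1))"
  have \<kappa>: "\<kappa> > 0" "\<kappa> \<le> 1/2" "\<kappa> * (2 * norm v) \<le> e"
  proof -
    show "\<kappa> \<le> 1/2" unfolding \<kappa>_def by (rule min.cobounded1)
    show "\<kappa> > 0" using e by (auto simp: \<kappa>_def intro!: divide_pos_pos add_nonneg_pos)
    have "\<kappa> * (2 * norm v + 1) \<le> e"
      using mult_right_mono[of \<kappa> "e / (2 * norm v + 1)" "2 * norm v + 1"]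
      by (simp add: \<kappa>_def add_nonneg_pos add_nonneg_eq_0_iff)
    with \<open>\<kappa> > 0\<close> show "\<kappa> * (2 * norm v) \<le> e" by (simp add: algebra_simps)
  qed
  obtain d1 where d1: "d1 > 0"
    "\<And>z. norm (z - y) < d1 \<Longrightarrow> norm (F z - F y - A (z - y)) \<le> \<kappa> / K * norm (z - y)"
    using F(2) \<kappa>(1) K(1) unfolding has_derivative_at_alt
    by (meson divide_pos_pos)
  obtain d2 where d2: "d2 > 0" "ball y d2 \<subseteq> U" using U openE by blast
  define d where "d = min d1 d2"
  define \<Phi> where "\<Phi> = (\<lambda>z. z - y + B (F z - A (z - y)))"
  have bB: "bounded_linear B" and bA: "bounded_linear A"
    using B(1) linA linear_conv_bounded_linear by auto
  have "(\<Phi> has_derivative (\<lambda>h. h - 0 + B (A h - A (h - 0)))) (at y)"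
    unfolding \<Phi>_def by (intro derivative_intros bounded_linear.has_derivative[OF bB]
        bounded_linear.has_derivative[OF bA] F(2))
  then have der: "(\<Phi> has_derivative id) (at y)"
    by (simp add: linear_0[OF B(1)] id_def)
  have cont: "continuous_on U \<Phi>" unfolding \<Phi>_def
    by (intro continuous_intros bounded_linear.continuous_on[OF bB] bounded_linear.continuous_on[OF bA] F(1))
  have "\<Phi> y \<in> interior (\<Phi> ` ball y d)"
    by (rule sussmann_open_mapping[OF U(1) cont U(2) der, of id])
       (use d1(1) d2 in \<open>auto simp: d_def bounded_linear_ident id_def\<close>)
  moreover have "\<Phi> y = 0" by (simp add: \<Phi>_def Fy linear_0[OF linA] linear_0[OF B(1)])
  ultimately obtain s where s: "s > 0" "ball 0 s \<subseteq> \<Phi> ` ball y d"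
    unfolding mem_interior by auto
  show ?thesis
  proof (intro exI[of _ "s / (norm v + 1)"] conjI allI impI)
    show "s / (norm v + 1) > 0" using s(1) by (simp add: add_nonneg_pos)
    fix t assume t: "0 < t \<and> t < s / (norm v + 1)"
    have pos: "norm v + 1 > 0" by (simp add: add_nonneg_pos)
    have "t * (norm v + 1) < s" using t pos by (simp add: field_simps)
    then have "t * norm v < s" using t by (simp add: algebra_simps)
    then have "t *\<^sub>R v \<in> ball 0 s" using t by simp
    then obtain z where z: "z \<in> ball y d" "\<Phi> z = t *\<^sub>R v" using s(2) by fastforce
    have zU: "z \<in> U" using z d2(2) by (auto simp: d_def)
    have "A (\<Phi> z) = A (z - y) + A (B (F z)) - A (B (A (z - y)))"
      unfolding \<Phi>_def by (simp add: linear_add[OF linA] linear_diff[OF linA] linear_diff[OF B(1)])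
    also have "\<dots> = F z" using B(2) FU zU by auto
    finally have Fz: "F z = 0" using z(2) v by (simp add: linear_scale[OF linA])
    have "norm (B (F z - A (z - y))) \<le> K * (\<kappa> / K * norm (z - y))"
      using K(2)[of "F z - A (z - y)"] d1(2)[of z] z(1) K(1) Fy
      by (smt (verit, best) d_def diff_zero dist_norm mem_ball mult_left_mono norm_minus_commute)
    then have r: "norm (B (F z - A (z - y))) \<le> \<kappa> * norm (z - y)" using K(1) by simp
    have eq: "z - y - t *\<^sub>R v = - B (F z - A (z - y))"
      using z(2) unfolding \<Phi>_def by (simp add: algebra_simps)
    have "norm (z - y) \<le> norm (t *\<^sub>R v) + norm (z - y - t *\<^sub>R v)"
      by (metis add.commute diff_add_cancel norm_triangle_ineq)
    also have "\<dots> \<le> t * norm v + 1/2 * norm (z - y)"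
      using r \<kappa>(2) t unfolding eq norm_minus_cancel
      by (smt (verit) mult_right_mono norm_ge_zero norm_scaleR)
    finally have "norm (z - y) \<le> 2 * (t * norm v)" by simp
    then have "norm (z - y - t *\<^sub>R v) \<le> \<kappa> * (2 * (t * norm v))"
      using r \<kappa>(1) unfolding eq norm_minus_cancel by (smt (verit, best) mult_left_mono)
    also have "\<dots> \<le> e * t" using mult_right_mono[OF \<kappa>(3), of t] t by (simp add: mult_ac)
    finally show "\<exists>z\<in>U. F z = 0 \<and> norm (z - y - t *\<^sub>R v) \<le> e * t" using zU Fz by auto
  qed
qed

section \<open>Orthogonal projection onto linear subspaces\<close>

lemma closest_point_subspace_in: "subspace S \<Longrightarrow> closest_point S v \<in> (S :: 'a::euclidean_space set)"
  by (intro closest_point_in_set closed_subspace) (auto dest: subspace_0)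

lemma closest_point_subspace_orth:
  fixes S :: "'a::euclidean_space set"
  assumes S: "subspace S" and u: "u \<in> S"
  shows "(v - closest_point S v) \<bullet> u = 0"
proof -
  note p = closest_point_subspace_in[OF S, of v]
  have "(v - closest_point S v) \<bullet> (w - closest_point S v) \<le> 0" if "w \<in> S" for w
    by (rule closest_point_dot[OF subspace_imp_convex[OF S] closed_subspace[OF S] that])
  from this[OF subspace_add[OF S p u]] this[OF subspace_diff[OF S p u]]
  show ?thesis by simp
qed

lemma closest_point_subspace_eqI:
  fixes S :: "'a::euclidean_space set"
  assumes S: "subspace S" and p: "p \<in> S" and o: "\<And>u. u \<in> S \<Longrightarrow> (v - p) \<bullet> u = 0"
  shows "closest_point S v = p"
proof -
  let ?q = "closest_point S v"
  have d: "p - ?q \<in> S" by (intro subspace_diff S p closest_point_subspace_in)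
  have "(p - ?q) \<bullet> (p - ?q) = (v - ?q) \<bullet> (p - ?q) - (v - p) \<bullet> (p - ?q)"
    by (simp add: algebra_simps)
  also have "\<dots> = 0" using o[OF d] closest_point_subspace_orth[OF S d] by simp
  finally show ?thesis by simp
qed

lemma linear_closest_point_subspace:
  fixes S :: "'a::euclidean_space set"
  assumes S: "subspace S"
  shows "linear (closest_point S)"
proof (rule linearI)
  note [simp] = closest_point_subspace_orth[OF S]
  note [intro] = closest_point_subspace_in[OF S]
  show "closest_point S (v + w) = closest_point S v + closest_point S w" for v w
  proof (rule closest_point_subspace_eqI[OF S])
    show "closest_point S v + closest_point S w \<in> S" by (intro subspace_add S) auto
    fix u assume u: "u \<in> S"
    have "(v + w - (closest_point S v + closest_point S w)) \<bullet> u
        = (v - closest_point S v) \<bullet> u + (w - closest_point S w) \<bullet> u"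
      by (simp add: inner_diff_left inner_add_left)
    then show "(v + w - (closest_point S v + closest_point S w)) \<bullet> u = 0" using u by simp
  qed
  show "closest_point S (c *\<^sub>R v) = c *\<^sub>R closest_point S v" for c v
  proof (rule closest_point_subspace_eqI[OF S])
    show "c *\<^sub>R closest_point S v \<in> S" by (intro subspace_scale S) auto
    show "(c *\<^sub>R v - c *\<^sub>R closest_point S v) \<bullet> u = 0" if "u \<in> S" for u
      using that by (simp flip: scaleR_diff_right)
  qed
qed

lemma norm_closest_point_subspace:
  fixes S :: "'a::euclidean_space set"
  assumes S: "subspace S"
  shows "norm (closest_point S v) \<le> norm v" "norm (v - closest_point S v) \<le> norm v"
proof -
  let ?p = "closest_point S v"
  have "?p \<bullet> (v - ?p) = 0"
    using closest_point_subspace_orth[OF S closest_point_subspace_in[OF S, of v], of v]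
    by (simp add: inner_commute)
  then have "(norm v)\<^sup>2 = (norm ?p)\<^sup>2 + (norm (v - ?p))\<^sup>2"
    using norm_add_Pythagorean[of ?p "v - ?p"] by (simp add: orthogonal_def)
  then have "(norm ?p)\<^sup>2 \<le> (norm v)\<^sup>2" "(norm (v - ?p))\<^sup>2 \<le> (norm v)\<^sup>2" by auto
  then show "norm ?p \<le> norm v" "norm (v - ?p) \<le> norm v"
    using power2_le_imp_le norm_ge_zero by blast+
qed

section \<open>First-order conditions along tangent directions\<close>

lemma tangent_space_approximable:
  assumes y: "y \<in> M" and v: "v \<in> tangent_space M y" and V: "open V" "y \<in> V" and e: "e > 0"
  shows "\<exists>s>0. \<forall>t. 0 < t \<and> t < s \<longrightarrow> (\<exists>z\<in>M \<inter> V. norm (z - y - t *\<^sub>R v) \<le> e * t)"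
proof -
  obtain U W F where F: "local_defining_map 1 M y U W F" "frechet_derivative F (at y) v = 0"
    using v by (auto simp: tangent_space_def)
  have U: "open (U \<inter> V)" "y \<in> U \<inter> V" and MU: "M \<inter> U = {z \<in> U. F z = 0}"
    using F V by (auto simp: local_defining_map_def)
  have "Ck_on 0 U F"
    using F(1) Ck_on_mono[of 0 1 U F] by (simp add: local_defining_map_def del: Ck_on.simps)
  then have c: "continuous_on (U \<inter> V) F" by (auto intro: continuous_on_subset)
  have d: "(F has_derivative frechet_derivative F (at y)) (at y)"
    using F(1) Ck_on_has_derivative[of 0 U F y] by (simp add: local_defining_map_def del: Ck_on.simps)
  have "F ` (U \<inter> V) \<subseteq> range (frechet_derivative F (at y))" using F(1) by (auto simp: local_defining_map_def)
  moreover have "F y = 0" using MU y U by auto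
  ultimately obtain s where "s > 0"
    "\<And>t. 0 < t \<Longrightarrow> t < s \<Longrightarrow> \<exists>z\<in>U \<inter> V. F z = 0 \<and> norm (z - y - t *\<^sub>R v) \<le> e * t"
    using zero_set_tangent[OF U c d _ _ F(2) e] by metis
  moreover have "z \<in> M" if "z \<in> U \<inter> V" "F z = 0" for z using that MU by auto
  ultimately show ?thesis by (metis IntD2 IntI)
qed

text \<open>Tangent vectors are realised by points of \<open>M\<close> only up to an error
  \<open>e * t\<close>. If \<open>A v\<close> were negative, the linear decrease along such points
  would beat the errors of approximation and of linearisation.\<close>

lemma derivative_nonneg_on_tangent_space:
  fixes g :: "'a::euclidean_space \<Rightarrow> real"
  assumes y: "y \<in> M" and v: "v \<in> tangent_space M y" and V: "open V" "y \<in> V"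
    and g: "(g has_derivative A) (at y)" and min: "\<And>z. z \<in> M \<inter> V \<Longrightarrow> g y \<le> g z"
  shows "0 \<le> A v"
proof (rule ccontr)
  assume neg: "\<not> 0 \<le> A v"
  have linA: "linear A" using g has_derivative_linear by blast
  obtain K where K: "K > 0" "\<And>w. norm (A w) \<le> K * norm w"
    using linear_bounded_pos[OF linA] by blast
  \<comment> \<open>The entry 1 gives |z - y| \<le> t (|v| + 1), so linearisation costs at most e t
    (|v| + 1); the approximation error costs K e t. The second entry keeps the sum e t (|v| + 1 + K)
    below -t A v.\<close>
  define e where "e = min 1 (- A v / (2 * (norm v + 1 + K)))"
  have pos: "norm v + 1 + K > 0" using K(1) by (smt (verit) norm_ge_zero)
  have e: "e > 0" "e \<le> 1" "e * (norm v + 1 + K) < - A v"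
  proof -
    have "- A v / (2 * (norm v + 1 + K)) > 0" using neg pos by (intro divide_pos_pos) auto
    then show "e > 0" by (simp add: e_def)
    show "e \<le> 1" by (simp add: e_def)
    have "e * (norm v + 1 + K) \<le> (- A v / (2 * (norm v + 1 + K))) * (norm v + 1 + K)"
      using pos by (intro mult_right_mono) (auto simp: e_def)
    also have "\<dots> = - A v / 2" using pos by (simp add: field_simps)
    finally show "e * (norm v + 1 + K) < - A v" using neg by simp
  qed
  obtain d where d: "d > 0" "\<And>z. norm (z - y) < d \<Longrightarrow> norm (g z - g y - A (z - y)) \<le> e * norm (z - y)"
    using g e(1) unfolding has_derivative_at_alt by meson
  obtain s where s: "s > 0"
    "\<And>t. 0 < t \<Longrightarrow> t < s \<Longrightarrow> \<exists>z\<in>M \<inter> (V \<inter> ball y d). norm (z - y - t *\<^sub>R v) \<le> e * t"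
    using tangent_space_approximable[OF y v _ _ e(1), of "V \<inter> ball y d"] V d(1) by (auto simp: open_Int)
  define t where "t = s / 2"
  have t: "t > 0" "t < s" using s by (auto simp: t_def)
  obtain z where z: "z \<in> M" "z \<in> V" "norm (z - y) < d" "norm (z - y - t *\<^sub>R v) \<le> e * t"
    using s(2)[OF t] by (auto simp: dist_norm norm_minus_commute)
  have "norm (z - y) \<le> norm (t *\<^sub>R v) + norm (z - y - t *\<^sub>R v)"
    by (metis add.commute diff_add_cancel norm_triangle_ineq)
  also have "\<dots> \<le> t * norm v + t" using z(4) t(1) e(2) by (simp add: mult_right_mono[of e 1 t, simplified] order_trans)
  finally have "e * norm (z - y) \<le> e * (t * norm v + t)" using e(1) by simp
  moreover have "norm (A (z - y - t *\<^sub>R v)) \<le> K * (e * t)"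
    using K z(4) by (meson dual_order.trans mult_left_mono less_imp_le)
  moreover have "A (z - y - t *\<^sub>R v) = A (z - y) - t * A v"
    by (simp add: linear_diff[OF linA] linear_scale[OF linA])
  moreover have "g z - g y - A (z - y) \<le> e * norm (z - y)" using d(2)[OF z(3)] by (simp add: abs_le_iff)
  moreover have "g y \<le> g z" using min z by auto
  ultimately have "- (t * A v) \<le> e * (t * norm v + t) + K * (e * t)" by (simp add: abs_le_iff)
  also have "\<dots> = t * (e * (norm v + 1 + K))" by (simp add: algebra_simps)
  also have "\<dots> < t * (- A v)" using e(3) t(1) by (intro mult_strict_left_mono) auto
  finally show False by simp
qed

text \<open>The scalar function \<open>g z \<bullet> (- A v)\<close> is constant on \<open>M\<close>
  near \<open>y\<close>, so its derivative -|A v|^2 along \<open>v\<close> must be nonnegative. This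
  makes tangent spaces independent of the defining map and covariant gradients independent of the
  extension.\<close>

lemma derivative_zero_on_tangent_space:
  fixes g :: "'a::euclidean_space \<Rightarrow> 'b::real_inner"
  assumes y: "y \<in> M" and v: "v \<in> tangent_space M y" and V: "open V" "y \<in> V"
    and g: "(g has_derivative A) (at y)" and const: "\<And>z. z \<in> M \<inter> V \<Longrightarrow> g z = g y"
  shows "A v = 0"
proof -
  have "((\<lambda>z. g z \<bullet> (- A v)) has_derivative (\<lambda>h. A h \<bullet> (- A v))) (at y)"
    by (intro derivative_intros g)
  then have "0 \<le> A v \<bullet> (- A v)"
    by (rule derivative_nonneg_on_tangent_space[OF y v V]) (simp add: const)
  then have "A v \<bullet> A v \<le> 0" by simp
  then show ?thesis using inner_gt_zero_iff[of "A v"] by linarith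
qed

text \<open>\<open>tangent_space\<close> collects the kernels of all defining maps at once. The
  given \<open>F\<close> vanishes on \<open>M\<close> near \<open>y\<close>, so its derivative kills
  every tangent vector, whichever map produced it.\<close>

lemma tangent_space_eq_kernel:
  assumes F: "local_defining_map 1 M y U W F" and y: "y \<in> M"
  shows "tangent_space M y = {v. frechet_derivative F (at y) v = 0}"
proof
  have d: "(F has_derivative frechet_derivative F (at y)) (at y)" and U: "open U" "y \<in> U"
    and z: "M \<inter> U = {z \<in> U. F z = 0}"
    using F Ck_on_has_derivative[of 0 U F y] by (auto simp: local_defining_map_def simp del: Ck_on.simps)
  show "tangent_space M y \<subseteq> {v. frechet_derivative F (at y) v = 0}"
  proof
    fix v assume "v \<in> tangent_space M y"
    then have "frechet_derivative F (at y) v = 0"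
      by (rule derivative_zero_on_tangent_space[OF y _ U d]) (use z y U in auto)
    then show "v \<in> {v. frechet_derivative F (at y) v = 0}" by simp
  qed
qed (use F in \<open>auto simp: tangent_space_def\<close>)

text \<open>With \<open>B\<close> a right inverse of \<open>A0\<close>, the map
  \<open>A \<circ> B\<close> differs from the identity of \<open>range A0\<close> by at most 1/2, so
  it is injective there and, by dimension, onto. The lower bound off the kernel has a constant
  independent of \<open>A\<close>, which later makes the constants of a patch uniform.\<close>

lemma surjective_perturbation:
  fixes A0 :: "'a::euclidean_space \<Rightarrow> 'b::euclidean_space"
  assumes A0: "linear A0"
  obtains \<epsilon> K where "\<epsilon> > 0" "K > 0"
    "\<And>A. linear A \<Longrightarrow> range A \<subseteq> range A0 \<Longrightarrow> (\<And>v. norm (A v - A0 v) \<le> \<epsilon> * norm v) \<Longrightarrow>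
       range A = range A0 \<and> (\<forall>v. (\<forall>u. A u = 0 \<longrightarrow> v \<bullet> u = 0) \<longrightarrow> norm v \<le> K * norm (A v))"
proof -
  let ?W = "range A0"
  have W: "subspace ?W" using A0 by (simp add: linear_subspace_image)
  obtain B where B: "linear B" "\<And>w. w \<in> ?W \<Longrightarrow> A0 (B w) = w"
    using linear_exists_right_inverse_on[OF A0 subspace_UNIV] by blast
  obtain K where K: "K > 0" "\<And>w. norm (B w) \<le> K * norm w"
    using linear_bounded_pos[OF B(1)] by blast
  show thesis
  proof
    show "1 / (2 * K) > 0" "2 * K > 0" using K by auto
    fix A assume A: "linear A" "range A \<subseteq> ?W" "\<And>v. norm (A v - A0 v) \<le> 1 / (2 * K) * norm v"
    have low: "norm w \<le> 2 * norm (A (B w))" if "w \<in> ?W" for w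
    proof -
      have "norm (A (B w) - w) \<le> 1 / (2 * K) * (K * norm w)"
        using A(3)[of "B w"] K B(2)[OF that]
        by (smt (verit, best) divide_nonneg_pos mult_left_mono)
      then have "norm (A (B w) - w) \<le> norm w / 2" using K(1) by simp
      then show ?thesis using norm_triangle_ineq2[of w "A (B w)"] by (simp add: norm_minus_commute)
    qed
    have lAB: "linear (A \<circ> B)" using A(1) B(1) linear_compose by blast
    have inj: "inj_on (A \<circ> B) ?W"
    proof (rule inj_onI)
      fix a b assume ab: "a \<in> ?W" "b \<in> ?W" "(A \<circ> B) a = (A \<circ> B) b"
      then have "a - b \<in> ?W" "(A \<circ> B) (a - b) = 0"
        using W lAB by (auto simp only: subspace_diff linear_diff cancel_comm_monoid_add_class.diff_cancel)
      then show "a = b" using low[of "a - b"] by simp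
    qed
    have im: "(A \<circ> B) ` ?W = ?W"
    proof (rule subspace_dim_equal[OF linear_subspace_image[OF lAB W] W])
      show "(A \<circ> B) ` ?W \<subseteq> ?W" using A(2) by auto
      have "inj_on (A \<circ> B) (span ?W)" using W inj by (metis span_eq_iff)
      from dim_image_eq[OF lAB this] show "dim ?W \<le> dim ((A \<circ> B) ` ?W)" by simp
    qed
    show "range A = range A0 \<and> (\<forall>v. (\<forall>u. A u = 0 \<longrightarrow> v \<bullet> u = 0) \<longrightarrow> norm v \<le> 2 * K * norm (A v))"
    proof (intro conjI allI impI)
      have "?W \<subseteq> range A" by (subst im[symmetric]) (simp only: image_comp[symmetric] image_mono subset_UNIV)
      with A(2) show "range A = ?W" by (rule subset_antisym)
      fix v assume v: "\<forall>u. A u = 0 \<longrightarrow> v \<bullet> u = 0"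
      obtain w where w: "w \<in> ?W" "A (B w) = A v" 
      proof -
        have "A v \<in> (A \<circ> B) ` ?W" using im A(2) by blast
        then show thesis using that by fastforce
      qed
      \<comment> \<open>\<open>B w\<close> solves the same equation as \<open>v\<close>; being
        orthogonal to the kernel, \<open>v\<close> is the shortest solution.\<close>
      have "A (v - B w) = 0" using w by (simp add: linear_diff[OF A(1)])
      then have "v \<bullet> (v - B w) = 0" using v by auto
      then have "v \<bullet> v = v \<bullet> B w" by (simp add: inner_diff_right)
      then have "norm v * norm v = v \<bullet> B w" by (metis power2_eq_square power2_norm_eq_inner)
      also have "\<dots> \<le> norm v * norm (B w)" by (rule norm_cauchy_schwarz)
      finally have "norm v \<le> norm (B w)"
        by (metis mult_le_cancel_left_pos norm_ge_zero norm_zero order_le_less zero_less_norm_iff)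
      also have "\<dots> \<le> K * norm w" by (rule K)
      also have "\<dots> \<le> K * (2 * norm (A v))" using low[OF w(1)] w(2) K(1) by simp
      finally show "norm v \<le> 2 * K * norm (A v)" by simp
    qed
  qed
qed

text \<open>A local defining map prescribes the range of its derivative only at its base point; this
  gives one inclusion at the other points. If \<open>w\<close> is the part of \<open>A v\<close>
  orthogonal to \<open>W\<close>, then \<open>F z \<bullet> w\<close> vanishes on the open set
  \<open>U\<close>, so its derivative \<open>A v \<bullet> w\<close>, which is |w|^2, vanishes as
  well.\<close>

lemma range_derivative_subset_subspace:
  fixes F :: "'a::euclidean_space \<Rightarrow> 'b::euclidean_space"
  assumes W: "subspace W" and U: "open U" "y \<in> U" and FU: "F ` U \<subseteq> W"
    and F: "(F has_derivative A) (at y)"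
  shows "range A \<subseteq> W"
proof
  fix a assume "a \<in> range A"
  then obtain v where v: "a = A v" by auto
  define w where "w = A v - closest_point W (A v)"
  have w: "u \<bullet> w = 0" if "u \<in> W" for u
    using closest_point_subspace_orth[OF W that] by (simp add: w_def inner_commute)
  have "((\<lambda>z. F z \<bullet> w) has_derivative (\<lambda>h. A h \<bullet> w)) (at y)"
    by (intro derivative_intros F)
  moreover have "((\<lambda>z. F z \<bullet> w) has_derivative (\<lambda>h. 0)) (at y)"
    by (rule has_derivative_transform_within_open[OF has_derivative_const[of 0] U])
       (use FU w in \<open>simp add: image_subset_iff\<close>)
  ultimately have "(\<lambda>h. A h \<bullet> w) = (\<lambda>h. 0)" by (rule has_derivative_unique)
  then have "A v \<bullet> w = 0" by (rule fun_cong)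
  moreover have "closest_point W (A v) \<bullet> w = 0" by (intro w closest_point_subspace_in W)
  ultimately have "w \<bullet> w = 0" by (simp add: w_def inner_diff_left)
  then have "A v = closest_point W (A v)" by (simp add: w_def)
  then show "a \<in> W" using closest_point_subspace_in[OF W, of "A v"] v by simp
qed

section \<open>The nearest-point projection and the covariant gradient\<close>

text \<open>The quantitative geometry of \<open>M\<close> enters later only through this locale.
  Compactness is asked of a piece of \<open>M\<close>, as \<open>M\<close> need not be closed, and
  provides nearest points.\<close>

locale manifold_patch =
  fixes M :: "'a::euclidean_space set" and xbar :: 'a and r L :: real
  assumes xbar: "xbar \<in> M" and r_pos: "r > 0" and L_nonneg: "L \<ge> 0"
    and compact_patch: "compact (M \<inter> cball xbar r)"
    and subspace_tangent: "y \<in> M \<inter> cball xbar r \<Longrightarrow> subspace (tangent_space M y)"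
    and normal_bound: "y \<in> M \<inter> cball xbar r \<Longrightarrow> y' \<in> M \<inter> cball xbar r \<Longrightarrow>
          norm ((y' - y) - tangent_proj M y (y' - y)) \<le> L * (norm (y' - y))\<^sup>2"
    and proj_Lipschitz: "y \<in> M \<inter> cball xbar r \<Longrightarrow> y' \<in> M \<inter> cball xbar r \<Longrightarrow>
          norm (tangent_proj M y v - tangent_proj M y' v) \<le> L * norm (y - y') * norm v"

text \<open>Split \<open>v\<close> into its part \<open>p\<close> in \<open>S\<close> and its normal
  part \<open>n\<close>. The first gap hypothesis bounds the change of \<open>p\<close> under
  projection to \<open>T\<close>. For \<open>w\<close>, the projection of \<open>n\<close> to
  \<open>T\<close>, one has |w|^2 = n \<bullet> w, and only the part of \<open>w\<close> normal to
  \<open>S\<close> contributes, which the second gap hypothesis bounds. Hence the factor 2.\<close>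

lemma projection_gap:
  fixes S T :: "'a::euclidean_space set"
  assumes S: "subspace S" and T: "subspace T"
    and ST: "\<And>u. u \<in> S \<Longrightarrow> norm (u - closest_point T u) \<le> \<eta> * norm u"
    and TS: "\<And>u. u \<in> T \<Longrightarrow> norm (u - closest_point S u) \<le> \<eta> * norm u" and \<eta>: "\<eta> \<ge> 0"
  shows "norm (closest_point S v - closest_point T v) \<le> 2 * \<eta> * norm v"
proof -
  let ?p = "closest_point S v"
  define n where "n = v - ?p"
  define w where "w = closest_point T n"
  note inS = closest_point_subspace_in[OF S] and inT = closest_point_subspace_in[OF T]
  have eq: "?p - closest_point T v = (?p - closest_point T ?p) - w"
    unfolding w_def n_def by (simp add: linear_diff[OF linear_closest_point_subspace[OF T]])
  have p1: "norm (?p - closest_point T ?p) \<le> \<eta> * norm v"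
    using ST[OF inS, of v] norm_closest_point_subspace(1)[OF S, of v] \<eta>
    by (meson mult_left_mono order_trans)
  have wT: "w \<in> T" by (simp add: w_def inT)
  have "w \<bullet> w = n \<bullet> w" using closest_point_subspace_orth[OF T wT, of n] by (simp add: w_def inner_diff_left)
  also have "\<dots> = n \<bullet> (w - closest_point S w)"
    using closest_point_subspace_orth[OF S inS, of v w] by (simp add: n_def inner_diff_right)
  also have "\<dots> \<le> norm n * norm (w - closest_point S w)" by (rule norm_cauchy_schwarz)
  also have "\<dots> \<le> norm v * (\<eta> * norm w)"
    using norm_closest_point_subspace(2)[OF S, of v] TS[OF wT] by (intro mult_mono) (auto simp: n_def)
  finally have "norm w * norm w \<le> (\<eta> * norm v) * norm w"
    by (simp add: mult_ac power2_eq_square flip: power2_norm_eq_inner)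
  then have "norm w \<le> \<eta> * norm v"
    using \<eta> by (metis mult_le_cancel_right_pos mult_nonneg_nonneg norm_ge_zero order_le_less)
  then show ?thesis using p1 norm_triangle_ineq4[of "?p - closest_point T ?p" w] unfolding eq by simp
qed

text \<open>On a small ball the derivative of \<open>F\<close> is a small perturbation of the one at
  \<open>xbar\<close>, so the same \<open>F\<close> is a defining map at every point of
  \<open>M\<close> in the ball and tangent spaces are kernels. A chord has \<open>F\<close> zero at
  both ends, so its image under the derivative is a second-order remainder; a kernel vector at one
  point is mapped at another by the difference of the derivatives only.\<close>

lemma manifold_patch_exists:
  fixes M :: "'a::euclidean_space set"
  assumes F: "local_defining_map 2 M xbar U W F" and xbar: "xbar \<in> M"
  obtains r L where "manifold_patch M xbar r L"
proof -
  let ?A = "\<lambda>y. frechet_derivative F (at y)"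
  have U: "open U" "xbar \<in> U" and W: "subspace W" and FU: "F ` U \<subseteq> W" and C2: "Ck_on 2 U F"
    and rngx: "range (?A xbar) = W" and MU: "M \<inter> U = {z \<in> U. F z = 0}"
    using F by (auto simp: local_defining_map_def)
  have C1: "Ck_on 1 U F" using Ck_on_mono[of 1 2] C2 by simp
  have der: "(F has_derivative ?A y) (at y)" if "y \<in> U" for y
    using Ck_on_has_derivative[of 0 U F y] C1 that by (simp del: Ck_on.simps)
  then have lin: "linear (?A y)" if "y \<in> U" for y using that has_derivative_linear by blast
  obtain r1 where r1: "r1 > 0" "cball xbar r1 \<subseteq> U" using U open_contains_cball by blast
  obtain L where L: "L \<ge> 0" "\<And>y y' v. y \<in> cball xbar r1 \<Longrightarrow> y' \<in> cball xbar r1 \<Longrightarrow>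
       norm (?A y v - ?A y' v) \<le> L * norm (y - y') * norm v"
    using Ck_on_derivative_Lipschitz[OF C2 r1(2)] by blast
  obtain \<epsilon> K where \<epsilon>: "\<epsilon> > 0" "K > 0"
    "\<And>A. linear A \<Longrightarrow> range A \<subseteq> W \<Longrightarrow> (\<And>v. norm (A v - ?A xbar v) \<le> \<epsilon> * norm v) \<Longrightarrow>
       range A = W \<and> (\<forall>v. (\<forall>u. A u = 0 \<longrightarrow> v \<bullet> u = 0) \<longrightarrow> norm v \<le> K * norm (A v))"
    using surjective_perturbation[OF lin[OF U(2)]] unfolding rngx by metis
  \<comment> \<open>Within \<epsilon> / (L + 1) the derivative moves by at most L r \<le>
    \<epsilon>, the tolerance of the perturbation lemma.\<close>
  define r where "r = min r1 (\<epsilon> / (L + 1))"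
  have r: "r > 0" "r \<le> r1" "L * r \<le> \<epsilon>"
  proof -
    show "r > 0" using r1 \<epsilon> L by (simp add: r_def)
    have "(L + 1) * r \<le> (L + 1) * (\<epsilon> / (L + 1))" using L by (intro mult_left_mono) (auto simp: r_def)
    also have "\<dots> = \<epsilon>" using L by simp
    finally show "L * r \<le> \<epsilon>" using \<open>r > 0\<close> by (simp add: algebra_simps)
  qed (simp add: r_def)
  have inU: "y \<in> cball xbar r1" "y \<in> U" if "y \<in> cball xbar r" for y using that r r1 by auto
  have reg: "range (?A y) = W \<and> (\<forall>v. (\<forall>u. ?A y u = 0 \<longrightarrow> v \<bullet> u = 0) \<longrightarrow> norm v \<le> K * norm (?A y v))"
    if y: "y \<in> cball xbar r" for y
  proof (rule \<epsilon>(3)[OF lin[OF inU(2)[OF y]]])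
    show "range (?A y) \<subseteq> W" by (rule range_derivative_subset_subspace[OF W U(1) inU(2)[OF y] FU der[OF inU(2)[OF y]]])
    fix v
    have "norm (?A y v - ?A xbar v) \<le> L * norm (y - xbar) * norm v"
      using L(2)[OF inU(1)[OF y]] r1(1) by simp
    also have "\<dots> \<le> (L * r) * norm v"
      using y L(1) by (intro mult_right_mono mult_left_mono) (auto simp: dist_norm norm_minus_commute)
    also have "\<dots> \<le> \<epsilon> * norm v" using r(3) by (simp add: mult_right_mono)
    finally show "norm (?A y v - ?A xbar v) \<le> \<epsilon> * norm v" .
  qed
  have ker: "tangent_space M y = {v. ?A y v = 0}" if y: "y \<in> M \<inter> cball xbar r" for y
  proof (rule tangent_space_eq_kernel)
    show "local_defining_map 1 M y U W F"
      unfolding local_defining_map_def using U(1) inU(2) W FU C1 reg MU y by auto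
  qed (use y in auto)
  have sub: "subspace (tangent_space M y)" if y: "y \<in> M \<inter> cball xbar r" for y
    unfolding ker[OF y] using lin[OF inU(2)] y by (intro linear_subspace_kernel) auto
  \<comment> \<open>The normal part of \<open>v\<close> is orthogonal to the kernel and has the same
    image as \<open>v\<close>. Normal components are thus controlled by images under the derivative,
    and both estimates below reduce to bounding such an image.\<close>
  have nb: "norm (v - tangent_proj M y v) \<le> K * norm (?A y v)" if y: "y \<in> M \<inter> cball xbar r" for y v
  proof -
    have "norm (v - tangent_proj M y v) \<le> K * norm (?A y (v - tangent_proj M y v))"
      using reg[of y] y closest_point_subspace_orth[OF sub[OF y], of _ v] unfolding ker[OF y] by simp
    also have "?A y (v - tangent_proj M y v) = ?A y v"
      using closest_point_subspace_in[OF sub[OF y], of v] ker[OF y] lin[OF inU(2)] y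
      by (auto simp: linear_diff)
    finally show ?thesis .
  qed
  have KL: "K * L \<ge> 0" using \<epsilon> L by simp
  show thesis
  \<comment> \<open>The gap lemma doubles the one-sided constant K L; the chord estimate holds with
    K L and is weakened to match.\<close>
  proof (rule that[of r "2 * (K * L)"], unfold_locales)
    have "continuous_on (cball xbar r) F"
      using C1 inU(2) Ck_on_mono[of 0 1 U F] by (auto intro: continuous_on_subset simp del: Ck_on.simps(2))
    then have "closed {z \<in> cball xbar r. F z = 0}" by (rule continuous_closed_preimage_constant) auto
    moreover have "M \<inter> cball xbar r = cball xbar r \<inter> {z \<in> cball xbar r. F z = 0}" using MU inU(2) by blast
    ultimately show "compact (M \<inter> cball xbar r)" by (metis compact_Int_closed compact_cball)
    fix y y' v assume y: "y \<in> M \<inter> cball xbar r" and y': "y' \<in> M \<inter> cball xbar r"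
    have F0: "F y = 0" "F y' = 0" using y y' MU inU(2) by auto
    have "norm (F y' - F y - ?A y (y' - y)) \<le> L * (norm (y' - y))\<^sup>2"
      by (rule Ck_on_second_order[OF C2 r1(2) L]) (use y y' inU in auto)
    then have "norm (?A y (y' - y)) \<le> L * (norm (y' - y))\<^sup>2" using F0 by simp
    then have "norm ((y' - y) - tangent_proj M y (y' - y)) \<le> K * (L * (norm (y' - y))\<^sup>2)"
      using nb[OF y, of "y' - y"] \<epsilon>(2) by (meson mult_left_mono less_imp_le order_trans)
    also have "\<dots> \<le> 2 * (K * L) * (norm (y' - y))\<^sup>2" using mult_nonneg_nonneg[OF KL zero_le_power2[of "norm (y' - y)"]] by (simp add: mult_ac)
    finally show "norm ((y' - y) - tangent_proj M y (y' - y)) \<le> 2 * (K * L) * (norm (y' - y))\<^sup>2" .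
    have gap: "norm (u - tangent_proj M b u) \<le> K * L * norm (y - y') * norm u"
      if "u \<in> tangent_space M a" and ab: "a \<in> M \<inter> cball xbar r" "b \<in> M \<inter> cball xbar r" "norm (b - a) = norm (y - y')"
      for a b u
    proof -
      have "?A a u = 0" using that ker by auto
      then have "norm (?A b u) \<le> L * norm (b - a) * norm u" using L(2)[of b a u] ab inU by simp
      then have "norm (u - tangent_proj M b u) \<le> K * (L * norm (b - a) * norm u)"
        using nb[OF ab(2), of u] \<epsilon>(2) by (meson mult_left_mono less_imp_le order_trans)
      then show ?thesis using ab(3) by (simp add: mult_ac)
    qed
    have "norm (tangent_proj M y v - tangent_proj M y' v) \<le> 2 * (K * L * norm (y - y')) * norm v"
    proof (rule projection_gap[OF sub[OF y] sub[OF y']])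
      show "norm (u - tangent_proj M y' u) \<le> K * L * norm (y - y') * norm u" if "u \<in> tangent_space M y" for u
        using gap[OF that y y'] by (simp add: norm_minus_commute)
      show "norm (u - tangent_proj M y u) \<le> K * L * norm (y - y') * norm u" if "u \<in> tangent_space M y'" for u
        using gap[OF that y' y] by simp
      show "0 \<le> K * L * norm (y - y')" using KL by simp
    qed
    then show "norm (tangent_proj M y v - tangent_proj M y' v) \<le> 2 * (K * L) * norm (y - y') * norm v"
      by (simp add: mult_ac)
  qed (use xbar r KL sub in auto)
qed

section \<open>Nearest points close to \<open>xbar\<close>\<close>

context manifold_patch
begin

lemma continuous_on_tangent_proj: "continuous_on (M \<inter> cball xbar r) (\<lambda>y. tangent_proj M y v)"
proof (rule lipschitz_on_continuous_on)
  show "(L * norm v)-lipschitz_on (M \<inter> cball xbar r) (\<lambda>y. tangent_proj M y v)"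
    using proj_Lipschitz[of _ _ v] L_nonneg
    by (intro lipschitz_onI) (auto simp: dist_norm mult_ac)
qed

lemma smaller: "0 < r' \<Longrightarrow> r' \<le> r \<Longrightarrow> manifold_patch M xbar r' L"
proof
  assume r': "0 < r'" "r' \<le> r"
  have "M \<inter> cball xbar r' = (M \<inter> cball xbar r) \<inter> cball xbar r'" using r' by auto
  then show "compact (M \<inter> cball xbar r')" using compact_patch by (metis closed_cball compact_Int_closed)
qed (use xbar L_nonneg subspace_tangent normal_bound proj_Lipschitz in auto)

text \<open>\<open>closest_point\<close> is a choice, so a minimiser has to be produced first. A
  minimiser over the compact patch is a global one: a point of \<open>M\<close> outside the patch is
  farther from \<open>x\<close> than r - \<rho> \<ge> \<rho>, hence farther than
  \<open>xbar\<close>.\<close>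

lemma closest_point_M:
  assumes x: "x \<in> cball xbar \<rho>" and \<rho>: "2 * \<rho> \<le> r"
  shows "closest_point M x \<in> M" "infdist x M = dist x (closest_point M x)"
    "dist xbar (closest_point M x) \<le> 2 * dist xbar x"
proof -
  have "xbar \<in> M \<inter> cball xbar r" using xbar r_pos by auto
  then obtain p where p: "p \<in> M \<inter> cball xbar r" "\<And>z. z \<in> M \<inter> cball xbar r \<Longrightarrow> dist x p \<le> dist x z"
    using distance_attains_inf[OF compact_imp_closed[OF compact_patch], of x] by blast
  have "dist x p \<le> dist x z" if z: "z \<in> M" for z
  proof (cases "z \<in> cball xbar r")
    case False
    have "dist x p \<le> dist x xbar" using p(2) \<open>xbar \<in> M \<inter> cball xbar r\<close> by auto
    moreover have "dist xbar z \<le> dist x xbar + dist x z" by (metis dist_commute dist_triangle2)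
    ultimately show ?thesis using False x \<rho> by (auto simp: dist_commute)
  qed (use p(2) z in auto)
  then have ex: "\<exists>p. p \<in> M \<and> (\<forall>z\<in>M. dist x p \<le> dist x z)" using p(1) by blast
  have cp: "closest_point M x \<in> M \<and> (\<forall>z\<in>M. dist x (closest_point M x) \<le> dist x z)"
    unfolding closest_point_def by (rule someI_ex[OF ex])
  then show "closest_point M x \<in> M" ..
  have "dist x (closest_point M x) \<le> infdist x M"
    using cp xbar by (auto simp: infdist_def intro!: cINF_greatest)
  with cp show "infdist x M = dist x (closest_point M x)" by (auto intro: antisym infdist_le)
  have "dist x (closest_point M x) \<le> dist x xbar" using cp xbar by auto
  then show "dist xbar (closest_point M x) \<le> 2 * dist xbar x"
    using dist_triangle[of xbar "closest_point M x" x] by (simp add: dist_commute)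
qed

text \<open>First-order optimality of the squared distance along \<open>M\<close>, used for both
  \<open>u\<close> and \<open>- u\<close>.\<close>

lemma closest_point_orthogonal:
  assumes x: "x \<in> cball xbar \<rho>" and \<rho>: "2 * \<rho> \<le> r" and u: "u \<in> tangent_space M (closest_point M x)"
  shows "(x - closest_point M x) \<bullet> u = 0"
proof -
  let ?p = "closest_point M x"
  note cp = closest_point_M[OF x \<rho>]
  have sub: "subspace (tangent_space M ?p)" using cp x \<rho> by (intro subspace_tangent) auto
  have "0 \<le> 2 * ((?p - x) \<bullet> v)" if v: "v \<in> tangent_space M ?p" for v
  proof (rule derivative_nonneg_on_tangent_space[OF cp(1) v open_UNIV UNIV_I])
    show "((\<lambda>z. (z - x) \<bullet> (z - x)) has_derivative (\<lambda>h. 2 * ((?p - x) \<bullet> h))) (at ?p)"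
      by (auto intro!: derivative_eq_intros simp: inner_commute)
    fix z assume "z \<in> M \<inter> UNIV"
    then have "dist x ?p \<le> dist x z" using cp(2) infdist_le[of z M x] by simp
    then show "(?p - x) \<bullet> (?p - x) \<le> (z - x) \<bullet> (z - x)"
      by (simp only: dist_norm norm_minus_commute[of x] norm_le)
  qed
  from this[OF u] this[OF subspace_neg[OF sub u]] show ?thesis by (simp add: inner_diff_left)
qed

text \<open>Writing \<open>p, p'\<close> for the nearest points of \<open>x, x'\<close>, the residuals \<open>x - p\<close> and \<open>x' - p'\<close> are
  normal to \<open>M\<close>, so \<open>p' - p - \<Pi>\<^sub>p (x' - x) = (p' - p - \<Pi>\<^sub>p (p' - p)) - (\<Pi>\<^sub>p - \<Pi>\<^sub>p\<^sub>') (x' - p')\<close>; both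
  terms are of second order.\<close>

lemma closest_point_expansion:
  assumes x: "x \<in> cball xbar \<rho>" and x': "x' \<in> cball xbar \<rho>"
    and \<rho>: "4 * \<rho> \<le> r" "10 * L * \<rho> \<le> 1"
  shows "norm (closest_point M x' - closest_point M x) \<le> 2 * norm (x' - x)"
    and "norm (closest_point M x' - closest_point M x - tangent_proj M (closest_point M x) (x' - x))
      \<le> 6 * L * ((norm (x' - x))\<^sup>2 + infdist x M * norm (x' - x))"
proof -
  let ?p = "closest_point M x" and ?p' = "closest_point M x'"
  let ?\<Pi> = "tangent_proj M ?p" and ?\<Pi>' = "tangent_proj M ?p'"
  have \<rho>0: "\<rho> \<ge> 0" using x by (metis mem_cball order_trans zero_le_dist)
  have \<rho>2: "2 * \<rho> \<le> r" using \<rho> \<rho>0 by simp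
  note cp = closest_point_M[OF x \<rho>2] and cp' = closest_point_M[OF x' \<rho>2]
  have p: "?p \<in> M \<inter> cball xbar r" and p': "?p' \<in> M \<inter> cball xbar r" using cp cp' x x' \<rho> \<rho>0 by auto
  note lin = linear_closest_point_subspace[OF subspace_tangent[OF p]]
  have "?\<Pi> (x - ?p) = 0"
    by (rule closest_point_subspace_eqI[OF subspace_tangent[OF p]])
       (use closest_point_orthogonal[OF x \<rho>2] subspace_0[OF subspace_tangent[OF p]] in auto)
  moreover have "?\<Pi>' (x' - ?p') = 0"
    by (rule closest_point_subspace_eqI[OF subspace_tangent[OF p']])
       (use closest_point_orthogonal[OF x' \<rho>2] subspace_0[OF subspace_tangent[OF p']] in auto)
  moreover have "x' - x = (x' - ?p') + (?p' - ?p) - (x - ?p)" by simp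
  ultimately have eq: "?p' - ?p - ?\<Pi> (x' - x) =
      (?p' - ?p - ?\<Pi> (?p' - ?p)) - (?\<Pi> (x' - ?p') - ?\<Pi>' (x' - ?p'))"
    by (metis (no_types, opaque_lifting) add.commute diff_diff_add diff_zero lin linear_add linear_diff)
  have "norm (?p' - ?p - ?\<Pi> (x' - x)) \<le> L * (norm (?p' - ?p))\<^sup>2 + L * norm (?p - ?p') * norm (x' - ?p')"
    unfolding eq using normal_bound[OF p p'] proj_Lipschitz[OF p p', of "x' - ?p'"] norm_triangle_ineq4
    by (smt (verit))
  also have "\<dots> = L * norm (?p' - ?p) * (norm (?p' - ?p) + infdist x' M)"
    by (simp add: cp'(2) dist_norm norm_minus_commute power2_eq_square algebra_simps)
  finally have main: "norm (?p' - ?p - ?\<Pi> (x' - x)) \<le> L * norm (?p' - ?p) * (norm (?p' - ?p) + infdist x' M)" .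
  have "norm (?p' - ?p) \<le> dist xbar ?p' + dist xbar ?p"
    by (metis dist_commute dist_norm dist_triangle)
  then have "norm (?p' - ?p) \<le> 4 * \<rho>" using cp(3) cp'(3) x x' by auto
  moreover have "infdist x' M \<le> \<rho>" using infdist_le[OF xbar, of x'] x' by (simp add: dist_commute)
  \<comment> \<open>The condition 10 L \<rho> \<le> 1 makes the factor of |p' - p| at most 1/2. The
    second-order term is then absorbed, which yields the Lipschitz constant 2; this constant is
    inserted once more to express the second-order term through |x' - x|.\<close>
  ultimately have "L * (norm (?p' - ?p) + infdist x' M) \<le> L * (5 * \<rho>)"
    using L_nonneg by (intro mult_left_mono) auto
  also have "\<dots> \<le> 1 / 2" using \<rho>(2) by simp
  finally have "L * norm (?p' - ?p) * (norm (?p' - ?p) + infdist x' M) \<le> 1 / 2 * norm (?p' - ?p)"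
    using mult_right_mono[of "L * (norm (?p' - ?p) + infdist x' M)" "1 / 2" "norm (?p' - ?p)"]
    by (simp add: mult_ac)
  moreover have "norm (?p' - ?p) \<le> norm (?\<Pi> (x' - x)) + norm (?p' - ?p - ?\<Pi> (x' - x))"
    by (metis add.commute diff_add_cancel norm_triangle_ineq)
  ultimately show lip: "norm (?p' - ?p) \<le> 2 * norm (x' - x)"
    using main norm_closest_point_subspace(1)[OF subspace_tangent[OF p], of "x' - x"] by linarith
  have "infdist x' M \<le> infdist x M + norm (x' - x)"
    using infdist_triangle[of x' M x] by (simp add: dist_norm)
  with lip have "L * norm (?p' - ?p) * (norm (?p' - ?p) + infdist x' M)
      \<le> L * (2 * norm (x' - x)) * (2 * norm (x' - x) + (infdist x M + norm (x' - x)))"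
    using L_nonneg by (intro mult_mono[OF mult_left_mono[OF lip L_nonneg]] add_mono)
      (auto simp: infdist_nonneg)
  also have "\<dots> \<le> 6 * L * ((norm (x' - x))\<^sup>2 + infdist x M * norm (x' - x))"
  proof -
    have "0 \<le> 4 * (L * (infdist x M * norm (x' - x)))" using L_nonneg by (simp add: infdist_nonneg)
    then show ?thesis by (simp add: power2_eq_square algebra_simps)
  qed
  finally show "norm (?p' - ?p - ?\<Pi> (x' - x)) \<le> 6 * L * ((norm (x' - x))\<^sup>2 + infdist x M * norm (x' - x))"
    using main by linarith
qed

end

text \<open>Two extensions agree on \<open>M\<close> near \<open>y\<close>, so the derivative of
  their difference vanishes on tangent vectors and their gradients have the same tangent projection.
  Hence the description by \<open>THE\<close> has exactly one solution.\<close>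

lemma cov_grad_eq:
  assumes ext: "C2_extension f M y V fh" and y: "y \<in> M" and D: "GDERIV fh y :> D"
    and sub: "subspace (tangent_space M y)"
  shows "cov_grad f M y = tangent_proj M y D"
  unfolding cov_grad_def
proof (rule the_equality)
  show "\<exists>V fh D'. C2_extension f M y V fh \<and> (GDERIV fh y :> D') \<and> tangent_proj M y D = tangent_proj M y D'"
    using ext D by blast
  fix g assume "\<exists>V fh D. C2_extension f M y V fh \<and> (GDERIV fh y :> D) \<and> g = tangent_proj M y D"
  then obtain V' fh' D' where ext': "C2_extension f M y V' fh'" and D': "GDERIV fh' y :> D'"
    and g: "g = tangent_proj M y D'" by blast
  have V: "open (V \<inter> V')" "y \<in> V \<inter> V'" using ext ext' by (auto simp: C2_extension_def)
  have "(\<lambda>h. h \<bullet> D - h \<bullet> D') u = 0" if u: "u \<in> tangent_space M y" for u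
  proof (rule derivative_zero_on_tangent_space[OF y u V])
    show "((\<lambda>z. fh z - fh' z) has_derivative (\<lambda>h. h \<bullet> D - h \<bullet> D')) (at y)"
      using D D' unfolding gderiv_def by (intro derivative_intros)
    have "fh z = fh' z" if "z \<in> M \<inter> (V \<inter> V')" for z
      using that ext ext' unfolding C2_extension_def by (metis IntE IntI ereal.inject)
    then show "fh z - fh' z = fh y - fh' y" if "z \<in> M \<inter> (V \<inter> V')" for z using that y V by auto
  qed
  then have o: "(D - D') \<bullet> u = 0" if "u \<in> tangent_space M y" for u
    using that by (metis eq_iff_diff_eq_0 inner_commute inner_diff_left)
  have "tangent_proj M y D' = tangent_proj M y D"
  proof (rule closest_point_subspace_eqI[OF sub closest_point_subspace_in[OF sub]])
    fix u assume u: "u \<in> tangent_space M y"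
    show "(D' - tangent_proj M y D) \<bullet> u = 0"
      using o[OF u] closest_point_subspace_orth[OF sub u, of D] by (simp add: inner_diff_left)
  qed
  then show "g = tangent_proj M y D" by (simp add: g)
qed


section \<open>Regularity of the covariant gradient\<close>

context manifold_patch
begin

context
  fixes f V fh
  assumes ext: "C2_extension f M xbar V fh" and V: "cball xbar r \<subseteq> V"
begin

lemma extension_has_derivative:
  "y \<in> cball xbar r \<Longrightarrow> (fh has_derivative frechet_derivative fh (at y)) (at y)"
  using ext V by (intro Ck_on_has_derivative[of 1 V]) (auto simp: C2_extension_def numeral_2_eq_2)

text \<open>In this form every factor is known to be continuous in \<open>y\<close>: the directional
  derivatives by \<open>Ck_on\<close>, the projections because they act on fixed vectors. Continuity
  of \<open>cov_grad\<close> follows termwise.\<close>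

lemma cov_grad_eq_sum:
  assumes y: "y \<in> M \<inter> cball xbar r"
  shows "cov_grad f M y = (\<Sum>b\<in>Basis. frechet_derivative fh (at y) b *\<^sub>R tangent_proj M y b)"
proof -
  let ?D = "frechet_derivative fh (at y)"
  have yV: "y \<in> V" using y V by auto
  have der: "(fh has_derivative ?D) (at y)" using extension_has_derivative y by auto
  have "?D = (\<lambda>h. h \<bullet> (\<Sum>b\<in>Basis. ?D b *\<^sub>R b))"
  proof
    fix h
    have "?D h = ?D (\<Sum>b\<in>Basis. (h \<bullet> b) *\<^sub>R b)" by (simp add: euclidean_representation)
    also have "\<dots> = (\<Sum>b\<in>Basis. (h \<bullet> b) * ?D b)"
      using has_derivative_linear[OF der] by (simp add: linear_sum linear_scale)
    finally show "?D h = h \<bullet> (\<Sum>b\<in>Basis. ?D b *\<^sub>R b)" by (simp add: inner_sum_right mult.commute)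
  qed
  with der have grad: "GDERIV fh y :> (\<Sum>b\<in>Basis. ?D b *\<^sub>R b)" unfolding gderiv_def by metis
  have "C2_extension f M y V fh" using ext yV by (simp add: C2_extension_def)
  from cov_grad_eq[OF this _ grad subspace_tangent[OF y]]
  have "cov_grad f M y = tangent_proj M y (\<Sum>b\<in>Basis. ?D b *\<^sub>R b)" using y by simp
  also have "\<dots> = (\<Sum>b\<in>Basis. ?D b *\<^sub>R tangent_proj M y b)"
    using linear_closest_point_subspace[OF subspace_tangent[OF y]] by (simp add: linear_sum linear_scale)
  finally show ?thesis .
qed

lemma cov_grad_in_tangent_space: "y \<in> M \<inter> cball xbar r \<Longrightarrow> cov_grad f M y \<in> tangent_space M y"
  unfolding cov_grad_eq_sum
  by (intro subspace_sum subspace_scale subspace_tangent closest_point_subspace_in)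

lemma continuous_on_cov_grad: "continuous_on (M \<inter> cball xbar r) (cov_grad f M)"
proof -
  let ?D = "\<lambda>y. frechet_derivative fh (at y)"
  have C2: "Ck_on (Suc (Suc 0)) V fh" using ext by (simp only: C2_extension_def numeral_2_eq_2)
  have "continuous_on V (\<lambda>y. ?D y b)" for b
  proof -
    have "Ck_on (Suc 0) V (\<lambda>y. ?D y b)" using C2 unfolding Ck_on.simps(2)[of "Suc 0"] by blast
    then have "Ck_on 0 V (\<lambda>y. ?D y b)" by (rule Ck_on_Suc_imp_Ck_on)
    then show ?thesis by simp
  qed
  then have "continuous_on (M \<inter> cball xbar r) (\<lambda>y. ?D y b)" for b
    using V by (meson continuous_on_subset inf.coboundedI2)
  then have "continuous_on (M \<inter> cball xbar r) (\<lambda>y. \<Sum>b\<in>Basis. ?D y b *\<^sub>R tangent_proj M y b)"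
    by (intro continuous_intros continuous_on_tangent_proj)
  then show ?thesis by (rule continuous_on_eq) (simp add: cov_grad_eq_sum)
qed

end
end

section \<open>Deterministic descent sequences\<close>

text \<open>The terms are dominated by twice the telescoping differences of 1 / ln k. The comparison
  starts at 2 because ln 1 = 0.\<close>

lemma summable_inverse_ln_squared: "summable (\<lambda>k. 1 / (real k * (ln (real k + 1))\<^sup>2))"
proof -
  let ?f = "\<lambda>k. 1 / ln (real k)"
  have "?f \<longlonglongrightarrow> 0"
    by (intro tendsto_divide_0[OF tendsto_const] filterlim_at_top_imp_at_infinity
        filterlim_compose[OF ln_at_top filterlim_real_sequentially])
  then have "summable (\<lambda>k. ?f k - ?f (Suc k))" by (rule telescope_summable')
  then have "summable (\<lambda>k. 2 * (?f k - ?f (Suc k)))" by (rule summable_mult)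
  then show ?thesis
  proof (rule summable_comparison_test'[where N = 2])
    fix k :: nat assume k: "k \<ge> 2"
    define a b where "a = ln (real k)" and "b = ln (real k + 1)"
    have a: "a > 0" "a \<le> b" using k by (auto simp: a_def b_def)
    have "ln (real k / (real k + 1)) \<le> real k / (real k + 1) - 1"
      using k by (intro ln_le_minus_one) auto
    then have "a - b \<le> real k / (real k + 1) - 1"
      using k by (simp add: a_def b_def ln_div)
    also have "\<dots> = - 1 / (real k + 1)" by (simp add: field_simps)
    finally have ba: "1 / (real k + 1) \<le> b - a" by simp
    have "1 / (real k * b\<^sup>2) \<le> 2 * (1 / (real k + 1)) * (1 / b\<^sup>2)"
    proof -
      have "1 / real k \<le> 2 * (1 / (real k + 1))" using k by (simp add: field_simps)
      from mult_right_mono[OF this, of "1 / b\<^sup>2"] show ?thesis by simp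
    qed
    also have "\<dots> \<le> 2 * (b - a) * (1 / (a * b))"
      using ba a by (intro mult_mono) (auto simp: power2_eq_square divide_left_mono mult_right_mono)
    also have "\<dots> = 2 * (1 / a - 1 / b)" using a by (simp add: field_simps)
    finally show "norm (1 / (real k * (ln (real k + 1))\<^sup>2)) \<le> 2 * (?f k - ?f (Suc k))"
      by (simp add: a_def b_def add.commute)
  qed
qed

text \<open>The base k / (k + 1) is below 1, so its power with exponent s \<le> 1 is at least the
  base itself. Used with s = 2 \<gamma> - 1 for the increments of a summation weight.\<close>

lemma powr_add1_diff_le:
  assumes k: "k \<ge> (1::nat)" and s: "0 \<le> s" "s \<le> 1"
  shows "real (k + 1) powr s - real k powr s \<le> real (k + 1) powr (s - 1)"
proof -
  let ?x = "real (k + 1)"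
  have "real k powr s = ?x powr s * (real k / ?x) powr s"
    using k by (simp add: powr_divide)
  moreover have "(real k / ?x) powr s \<ge> (real k / ?x) powr 1"
    using k s by (intro powr_mono') auto
  ultimately have "real k powr s \<ge> ?x powr s * (real k / ?x)"
    using k mult_left_mono[of "real k / ?x" "(real k / ?x) powr s" "?x powr s"] by simp
  moreover have "?x powr s * (real k / ?x) = ?x powr s - ?x powr (s - 1)"
    by (simp add: powr_diff field_simps)
  ultimately show ?thesis by simp
qed

text \<open>The decrement of k^(-s) has the order of a squared step, which allows a bound K
  k^(-\<gamma>) to be carried through the recursion. It comes from (1 + 1/k)^s \<le> 1 + 1/k and
  from -s - 1 \<le> -2 s.\<close>

lemma powr_minus_diff_le:
  assumes k: "k \<ge> (1::nat)" and s: "0 \<le> s" "s \<le> 1"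
  shows "real k powr (-s) - real (k + 1) powr (-s) \<le> real k powr (- 2 * s)"
proof -
  let ?x = "real k"
  have x: "?x > 0" using k by simp
  have "((?x + 1) / ?x) powr s \<le> ((?x + 1) / ?x) powr 1" using k s by (intro powr_mono) auto
  then have "(?x + 1) powr s / ?x powr s \<le> (?x + 1) / ?x" using x by (simp add: powr_divide)
  then have "?x powr s / (?x + 1) powr s \<ge> ?x / (?x + 1)"
    using x by (simp add: field_simps)
  moreover have "?x / (?x + 1) \<ge> 1 - 1 / ?x" using x by (simp add: field_simps)
  ultimately have "1 - ?x powr s / (?x + 1) powr s \<le> 1 / ?x" by linarith
  then have "?x powr (-s) * (1 - ?x powr s / (?x + 1) powr s) \<le> ?x powr (-s) * (1 / ?x)"
    by (intro mult_left_mono) auto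
  moreover have "?x powr (-s) * (1 - ?x powr s / (?x + 1) powr s) = ?x powr (-s) - (?x + 1) powr (-s)"
    using x by (simp add: powr_minus field_simps)
  moreover have "?x powr (-s) * (1 / ?x) = ?x powr (-s - 1)" using x by (simp add: powr_diff)
  moreover have "?x powr (-s - 1) \<le> ?x powr (- 2 * s)" using k s by (intro powr_mono) auto
  ultimately show ?thesis by (simp add: add.commute)
qed

lemma step_size_pos:
  "0 < c \<Longrightarrow> 1 \<le> k \<Longrightarrow> c * real k powr s \<le> a \<Longrightarrow> 0 < (a :: real)"
  by (rule less_le_trans) auto

text \<open>\<open>a\<close> and \<open>d\<close> stand for the second and first stopped moments of
  the distance. By \<open>a_le\<close> the linear term of \<open>descent\<close> contracts
  \<open>a\<close> by at least (m \<open>c\<^sub>1\<close> / \<delta>) k^(-\<gamma>), and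
  \<open>large\<close> says that the bracket is at least 2.\<close>

locale descent_sequence =
  fixes \<alpha> a d :: "nat \<Rightarrow> real" and c\<^sub>1 c\<^sub>2 \<gamma> m B \<delta> :: real and k0 :: nat
  assumes const: "c\<^sub>1 > 0" "c\<^sub>2 > 0" "1/2 < \<gamma>" "\<gamma> \<le> 1" "m > 0" "B \<ge> 0" "\<delta> > 0"
    and step: "k \<ge> 1 \<Longrightarrow> c\<^sub>1 * real k powr (-\<gamma>) \<le> \<alpha> k \<and> \<alpha> k \<le> c\<^sub>2 * real k powr (-\<gamma>)"
    and k0: "k0 \<ge> 1"
    and nonneg: "a k \<ge> 0" "d k \<ge> 0"
    and a_le: "k \<ge> k0 \<Longrightarrow> a k \<le> \<delta> * d k"
    and a_bounded: "k \<ge> k0 \<Longrightarrow> a k \<le> \<delta>\<^sup>2"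
    and large: "2 * \<delta> \<le> m * c\<^sub>1"
    and descent: "k \<ge> k0 \<Longrightarrow> a (k + 1) \<le> a k - m * \<alpha> k * d k + B * (\<alpha> k)\<^sup>2"
begin

lemma \<alpha>_pos: "k \<ge> 1 \<Longrightarrow> \<alpha> k > 0"
  using step[of k] step_size_pos[OF const(1)] by blast

lemma \<alpha>_sq_bounds:
  assumes k: "k \<ge> 1"
  shows "c\<^sub>1\<^sup>2 * real k powr (- 2 * \<gamma>) \<le> (\<alpha> k)\<^sup>2" "(\<alpha> k)\<^sup>2 \<le> c\<^sub>2\<^sup>2 * real k powr (- 2 * \<gamma>)"
proof -
  have eq: "(c * real k powr (-\<gamma>))\<^sup>2 = c\<^sup>2 * real k powr (- 2 * \<gamma>)" for c
    using k by (simp add: power_mult_distrib powr_power)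
  show "c\<^sub>1\<^sup>2 * real k powr (- 2 * \<gamma>) \<le> (\<alpha> k)\<^sup>2"
    unfolding eq[symmetric] using step[OF k] const by (intro power_mono) auto
  show "(\<alpha> k)\<^sup>2 \<le> c\<^sub>2\<^sup>2 * real k powr (- 2 * \<gamma>)"
    unfolding eq[symmetric] using step[OF k] \<alpha>_pos[OF k] by (intro power_mono) auto
qed

text \<open>With u = k^(-\<gamma>) the recursion reads a (k + 1) \<le> (1 - A
  \<open>c\<^sub>1\<close> u) a k + B \<open>c\<^sub>2\<^sup>2\<close> u^2. The bound K u reproduces
  itself: of A \<open>c\<^sub>1\<close> \<ge> 2, one unit pays for the noise, as K \<ge> B
  \<open>c\<^sub>2\<^sup>2\<close>, and one for the decrease u - (k + 1)^(-\<gamma>) \<le>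
  u^2.\<close>

lemma second_moment_decay: "\<exists>K>0. \<forall>k\<ge>k0. a k \<le> K * real k powr (-\<gamma>)"
proof -
  define A where "A = m / \<delta>"
  have A: "A > 0" "A * c\<^sub>1 \<ge> 2" using const large by (auto simp: A_def field_simps)
  have "(\<lambda>k. A * c\<^sub>1 * real k powr (-\<gamma>)) \<longlonglongrightarrow> A * c\<^sub>1 * 0"
    using const by (intro tendsto_mult_left tendsto_neg_powr filterlim_real_sequentially) auto
  then have "eventually (\<lambda>k. A * c\<^sub>1 * real k powr (-\<gamma>) < 1) sequentially"
    by (rule order_tendstoD(2)) simp
  then obtain N where N: "\<And>k. k \<ge> N \<Longrightarrow> A * c\<^sub>1 * real k powr (-\<gamma>) < 1"
    unfolding eventually_sequentially by auto
  \<comment> \<open>From \<open>N\<close> on the factor 1 - A \<open>c\<^sub>1\<close> u is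
    nonnegative, so the induction hypothesis may be multiplied by it. For indices up to
    \<open>N'\<close> the trivial bound \<delta>^2 is paid by the second entry of
    \<open>K\<close>.\<close>
  define N' where "N' = max N k0"
  have N': "N' \<ge> 1" "N' \<ge> N" "N' \<ge> k0" using k0 by (auto simp: N'_def)
  define K where "K = max (B * c\<^sub>2\<^sup>2) (\<delta>\<^sup>2 * real N' powr \<gamma>)"
  have early: "a k \<le> K * real k powr (-\<gamma>)" if k: "k0 \<le> k" "k \<le> N'" for k
  proof -
    have "real k powr \<gamma> \<le> real N' powr \<gamma>" using k const by (intro powr_mono2) auto
    then have "\<delta>\<^sup>2 * real k powr \<gamma> \<le> K"
      unfolding K_def by (meson max.cobounded2 mult_left_mono order_trans zero_le_power2)
    then have "\<delta>\<^sup>2 * real k powr \<gamma> * real k powr (-\<gamma>) \<le> K * real k powr (-\<gamma>)"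
      by (intro mult_right_mono) auto
    then have "\<delta>\<^sup>2 \<le> K * real k powr (-\<gamma>)" using k k0 by (simp add: mult.assoc powr_add[symmetric])
    then show ?thesis using a_bounded[OF k(1)] by linarith
  qed
  have "a k \<le> K * real k powr (-\<gamma>)" if "k \<ge> N'" for k
    using that
  proof (induction k rule: dec_induct)
    case base
    show ?case using early N' by auto
  next
    case (step k)
    let ?u = "real k powr (-\<gamma>)"
    have k: "k \<ge> 1" "k \<ge> k0" "k \<ge> N" using step N' by auto
    have u2: "real k powr (- 2 * \<gamma>) = ?u * ?u" using k by (simp add: powr_add[symmetric])
    have "a (k + 1) \<le> a k - m * \<alpha> k * d k + B * (\<alpha> k)\<^sup>2" by (rule descent[OF k(2)])
    also have "\<dots> \<le> a k - A * c\<^sub>1 * ?u * a k + B * (c\<^sub>2\<^sup>2 * (?u * ?u))"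
    proof -
      have "c\<^sub>1 * ?u * a k \<le> \<alpha> k * (\<delta> * d k)"
        using descent_sequence.step[OF descent_sequence_axioms k(1)] a_le[OF k(2)] nonneg[of k] const \<alpha>_pos[OF k(1)] by (intro mult_mono) auto
      then have "A * (c\<^sub>1 * ?u * a k) \<le> A * (\<alpha> k * (\<delta> * d k))" using A by simp
      also have "\<dots> = m * \<alpha> k * d k" using const by (simp add: A_def)
      finally have "A * c\<^sub>1 * ?u * a k \<le> m * \<alpha> k * d k" by (simp add: mult_ac)
      moreover have "B * (\<alpha> k)\<^sup>2 \<le> B * (c\<^sub>2\<^sup>2 * (?u * ?u))"
        using \<alpha>_sq_bounds(2)[OF k(1)] const unfolding u2 by (intro mult_left_mono) auto
      ultimately show ?thesis by linarith
    qed
    also have "\<dots> = (1 - A * c\<^sub>1 * ?u) * a k + (B * c\<^sub>2\<^sup>2) * (?u * ?u)" by (simp add: algebra_simps)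
    also have "\<dots> \<le> (1 - A * c\<^sub>1 * ?u) * (K * ?u) + K * (?u * ?u)"
      using N[OF k(3)] step.IH by (intro add_mono mult_left_mono mult_right_mono) (auto simp: K_def)
    also have "\<dots> = K * (?u - (A * c\<^sub>1 - 1) * (?u * ?u))" by (simp add: algebra_simps)
    also have "\<dots> \<le> K * (?u - 1 * (?u * ?u))"
      using A const by (intro mult_left_mono diff_mono mult_right_mono) (auto simp: K_def le_max_iff_disj)
    also have "\<dots> \<le> K * real (k + 1) powr (-\<gamma>)"
      using powr_minus_diff_le[OF k(1), of \<gamma>] const u2
      by (intro mult_left_mono) (auto simp: K_def le_max_iff_disj)
    finally show ?case by simp
  qed
  with early have all: "a k \<le> K * real k powr (-\<gamma>)" if "k \<ge> k0" for k
    using that by (meson nle_le)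
  show ?thesis
  proof (intro exI[of _ "K + 1"] conjI allI impI)
    show "K + 1 > 0" using const by (simp add: K_def add_nonneg_pos le_max_iff_disj)
    fix k assume "k \<ge> k0"
    from all[OF this] show "a k \<le> (K + 1) * real k powr (-\<gamma>)"
      using powr_ge_zero[of "real k" "- \<gamma>"] by (simp only: distrib_right)
  qed
qed

lemma descent_sum:
  assumes "k \<ge> k0"
  shows "m * (\<Sum>i<n. \<alpha> (k + i) * d (k + i)) \<le> a k - a (k + n) + B * (\<Sum>i<n. (\<alpha> (k + i))\<^sup>2)"
proof (induction n)
  case (Suc n)
  then show ?case using descent[of "k + n"] assms by (simp add: algebra_simps)
qed simp

text \<open>Converts the boundary term of a tail sum into squared steps. Each of the k terms is at
  least \<open>c\<^sub>1\<^sup>2\<close> (2k)^(-2\<gamma>) with 2^(-2\<gamma>) \<ge> 1/4, and k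
  k^(-2\<gamma>) \<ge> k^(-\<gamma>) because \<gamma> \<le> 1.\<close>

lemma sum_squares_lower:
  assumes k: "k \<ge> 1"
  shows "real k powr (-\<gamma>) \<le> 4 / c\<^sub>1\<^sup>2 * (\<Sum>i<k. (\<alpha> (k + i))\<^sup>2)"
proof -
  have "c\<^sub>1\<^sup>2 / 4 * real k powr (- 2 * \<gamma>) \<le> (\<alpha> (k + i))\<^sup>2" if i: "i < k" for i
  proof -
    have "2 powr (-2) * real k powr (- 2 * \<gamma>) \<le> 2 powr (- 2 * \<gamma>) * real k powr (- 2 * \<gamma>)"
      using const by (intro mult_right_mono powr_mono) auto
    also have "\<dots> = (2 * real k) powr (- 2 * \<gamma>)" by (simp add: powr_mult)
    also have "\<dots> \<le> real (k + i) powr (- 2 * \<gamma>)" using i k const by (intro powr_mono2') auto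
    finally have "1 / 4 * real k powr (- 2 * \<gamma>) \<le> real (k + i) powr (- 2 * \<gamma>)"
      by (simp add: powr_minus)
    then have "c\<^sub>1\<^sup>2 * (1 / 4 * real k powr (- 2 * \<gamma>)) \<le> c\<^sub>1\<^sup>2 * real (k + i) powr (- 2 * \<gamma>)"
      by (intro mult_left_mono) auto
    also have "\<dots> \<le> (\<alpha> (k + i))\<^sup>2" using k by (intro \<alpha>_sq_bounds) auto
    finally show ?thesis by simp
  qed
  then have "(\<Sum>i<k. c\<^sub>1\<^sup>2 / 4 * real k powr (- 2 * \<gamma>)) \<le> (\<Sum>i<k. (\<alpha> (k + i))\<^sup>2)"
    by (intro sum_mono) auto
  then have "c\<^sub>1\<^sup>2 / 4 * (real k * real k powr (- 2 * \<gamma>)) \<le> (\<Sum>i<k. (\<alpha> (k + i))\<^sup>2)" by (simp add: mult_ac)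
  moreover have "real k powr (-\<gamma>) \<le> real k powr (1 + (- 2 * \<gamma>))" using k const by (intro powr_mono) auto
  moreover have "real k powr (1 + (- 2 * \<gamma>)) = real k * real k powr (- 2 * \<gamma>)"
    using k by (simp only: powr_add) simp
  ultimately have "c\<^sub>1\<^sup>2 / 4 * real k powr (-\<gamma>) \<le> (\<Sum>i<k. (\<alpha> (k + i))\<^sup>2)"
    by (smt (verit) mult_left_mono divide_nonneg_pos zero_le_power2)
  then show ?thesis using const by (simp add: field_simps)
qed

text \<open>Summing the recursion from k leaves the boundary term a k, which is O(k^(-\<gamma>)) and
  is therefore paid by the squared steps from k to 2k - 1.\<close>

lemma first_moment_tail:
  "\<exists>K>0. \<forall>k\<ge>k0. (\<Sum>i. ennreal (\<alpha> (k + i) * d (k + i))) \<le> ennreal K * (\<Sum>i. ennreal ((\<alpha> (k + i))\<^sup>2))"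
  (is "\<exists>K>0. \<forall>k\<ge>k0. ?lhs k \<le> ennreal K * ?rhs k")
proof -
  obtain K where K: "K > 0" "\<And>k. k \<ge> k0 \<Longrightarrow> a k \<le> K * real k powr (-\<gamma>)"
    using second_moment_decay by blast
  define K' where "K' = (K * (4 / c\<^sub>1\<^sup>2) + B) / m"
  have K': "K' > 0" using K const by (auto simp: K'_def intro!: divide_pos_pos add_pos_nonneg mult_pos_pos)
  show ?thesis
  proof (intro exI[of _ K'] conjI allI impI K')
    fix k assume k: "k \<ge> k0"
    have k1: "k \<ge> 1" using k k0 by simp
    note \<alpha>n = less_imp_le[OF \<alpha>_pos]
    show "?lhs k \<le> ennreal K' * ?rhs k"
    proof (rule suminf_le_const)
      show "summable (\<lambda>i. ennreal (\<alpha> (k + i) * d (k + i)))" by simp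
      fix n
      \<comment> \<open>At least k terms are taken, so that the partial sum of squares contains the
        block that pays for a k.\<close>
      define N where "N = max n k"
      have "m * (\<Sum>i<n. \<alpha> (k + i) * d (k + i)) \<le> m * (\<Sum>i<N. \<alpha> (k + i) * d (k + i))"
        using const k1 nonneg \<alpha>n by (intro mult_left_mono sum_mono2) (auto simp: N_def)
      also have "\<dots> \<le> a k + B * (\<Sum>i<N. (\<alpha> (k + i))\<^sup>2)"
        using descent_sum[OF k, of N] nonneg(1)[of "k + N"] by linarith
      also have "a k \<le> K * (4 / c\<^sub>1\<^sup>2 * (\<Sum>i<k. (\<alpha> (k + i))\<^sup>2))"
        using K(2)[OF k] sum_squares_lower[OF k1] K(1) by (meson mult_left_mono less_imp_le order_trans)
      also have "\<dots> \<le> K * (4 / c\<^sub>1\<^sup>2 * (\<Sum>i<N. (\<alpha> (k + i))\<^sup>2))"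
        using K(1) by (intro mult_left_mono sum_mono2) (auto simp: N_def)
      finally have "m * (\<Sum>i<n. \<alpha> (k + i) * d (k + i)) \<le> (K * (4 / c\<^sub>1\<^sup>2) + B) * (\<Sum>i<N. (\<alpha> (k + i))\<^sup>2)"
        by (simp only: distrib_right mult.assoc)
      also have "K * (4 / c\<^sub>1\<^sup>2) + B = m * K'" using const by (simp add: K'_def)
      finally have "m * (\<Sum>i<n. \<alpha> (k + i) * d (k + i)) \<le> m * (K' * (\<Sum>i<N. (\<alpha> (k + i))\<^sup>2))"
        by (simp only: mult.assoc)
      then have le: "(\<Sum>i<n. \<alpha> (k + i) * d (k + i)) \<le> K' * (\<Sum>i<N. (\<alpha> (k + i))\<^sup>2)" using const by simp
      have "(\<Sum>i<n. ennreal (\<alpha> (k + i) * d (k + i))) = ennreal (\<Sum>i<n. \<alpha> (k + i) * d (k + i))"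
        using k1 nonneg \<alpha>n by (intro sum_ennreal) auto
      also have "\<dots> \<le> ennreal (K' * (\<Sum>i<N. (\<alpha> (k + i))\<^sup>2))" by (rule ennreal_leI[OF le])
      also have "\<dots> = ennreal K' * (\<Sum>i<N. ennreal ((\<alpha> (k + i))\<^sup>2))"
        using K' by (simp add: ennreal_mult' sum_ennreal)
      also have "\<dots> \<le> ennreal K' * ?rhs k"
        by (intro mult_left_mono sum_le_suminf) auto
      finally show "(\<Sum>i<n. ennreal (\<alpha> (k + i) * d (k + i))) \<le> ennreal K' * ?rhs k" .
    qed
  qed
qed

text \<open>Summation by parts with w k = k^(2\<gamma> - 1) / ln(k + 1)^2, chosen so that w k
  \<alpha> k has the order of the weight in the claim. The increments of \<open>w\<close> times
  \<open>a\<close> and the terms w k times the squared step are then both O(1 / (k ln(k + 1)^2)),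
  which is summable.\<close>

lemma weighted_first_moment_summable:
  "summable (\<lambda>i. real (k0 + i) powr (\<gamma> - 1) / (ln (real (k0 + i) + 1))\<^sup>2 * d (k0 + i))"
proof -
  obtain K where K: "K > 0" "\<And>k. k \<ge> k0 \<Longrightarrow> a k \<le> K * real k powr (-\<gamma>)"
    using second_moment_decay by blast
  define u where "u = (\<lambda>k::nat. 1 / (real k * (ln (real k + 1))\<^sup>2))"
  define w where "w = (\<lambda>k::nat. real k powr (2 * \<gamma> - 1) / (ln (real k + 1))\<^sup>2)"
  have u: "summable (\<lambda>i. u (k0 + i))"
    unfolding u_def add.commute[of k0] summable_iff_shift[of "\<lambda>k. 1 / (real k * (ln (real k + 1))\<^sup>2)"]
    by (rule summable_inverse_ln_squared)
  have u0: "u k \<ge> 0" and w0: "w k \<ge> 0" for k by (simp_all add: u_def w_def)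
  have w_step: "(w (k + 1) - w k) * a (k + 1) \<le> K * u (k + 1)" if k: "k \<ge> k0" for k
  proof -
    let ?x = "real (k + 1)" and ?l = "(ln (real (k + 1) + 1))\<^sup>2"
    have k1: "k \<ge> 1" using k k0 by simp
    have l: "?l > 0" by simp
    have ll: "(ln (real k + 1))\<^sup>2 \<le> ?l" by (intro power_mono) auto
    \<comment> \<open>Giving both terms the larger logarithm only lowers the subtracted one, and
      leaves just the power to be differenced.\<close>
    have "w (k + 1) - w k \<le> ?x powr (2 * \<gamma> - 1) / ?l - real k powr (2 * \<gamma> - 1) / ?l"
      unfolding w_def using k1 ll by (intro diff_mono divide_left_mono order_refl) (auto intro!: mult_pos_pos)
    also have "\<dots> = (?x powr (2 * \<gamma> - 1) - real k powr (2 * \<gamma> - 1)) / ?l" by (simp add: diff_divide_distrib)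
    also have "\<dots> \<le> ?x powr (2 * \<gamma> - 1 - 1) / ?l"
      using powr_add1_diff_le[OF k1, of "2 * \<gamma> - 1"] const by (intro divide_right_mono) auto
    finally have "(w (k + 1) - w k) * a (k + 1) \<le> ?x powr (2 * \<gamma> - 2) / ?l * (K * ?x powr (-\<gamma>))"
      using K(2)[of "k + 1"] nonneg(1)[of "k + 1"] k
      by (intro mult_mono) auto
    also have "\<dots> = K * (?x powr (\<gamma> - 2) / ?l)" by (simp add: powr_add[symmetric])
    also have "\<dots> \<le> K * (?x powr (-1) / ?l)"
      using K(1) const by (intro mult_left_mono divide_right_mono powr_mono) auto
    also have "?x powr (-1) / ?l = u (k + 1)" by (simp add: u_def powr_minus field_simps)
    finally show ?thesis .
  qed
  have w_sq: "w k * (\<alpha> k)\<^sup>2 \<le> c\<^sub>2\<^sup>2 * u k" if k: "k \<ge> 1" for k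
  proof -
    have "w k * (\<alpha> k)\<^sup>2 \<le> w k * (c\<^sub>2\<^sup>2 * real k powr (- 2 * \<gamma>))" by (intro mult_left_mono \<alpha>_sq_bounds k w0)
    also have "\<dots> = c\<^sub>2\<^sup>2 * ((real k powr (2 * \<gamma> - 1) * real k powr (- 2 * \<gamma>)) / (ln (real k + 1))\<^sup>2)"
      by (simp add: w_def)
    also have "real k powr (2 * \<gamma> - 1) * real k powr (- 2 * \<gamma>) = 1 / real k"
      using k by (simp only: powr_add[symmetric]) (simp add: powr_minus divide_inverse)
    finally show ?thesis by (simp add: u_def)
  qed
  have w_d: "c\<^sub>1 * (real k powr (\<gamma> - 1) / (ln (real k + 1))\<^sup>2 * d k) \<le> w k * (\<alpha> k * d k)" if k: "k \<ge> 1" for k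
  proof -
    have "real k powr (\<gamma> - 1) = real k powr (2 * \<gamma> - 1) * real k powr (-\<gamma>)" by (simp add: powr_add[symmetric])
    then have "c\<^sub>1 * (real k powr (\<gamma> - 1) / (ln (real k + 1))\<^sup>2 * d k) = w k * ((c\<^sub>1 * real k powr (-\<gamma>)) * d k)"
      by (simp add: w_def)
    also have "\<dots> \<le> w k * (\<alpha> k * d k)" using step[OF k] by (intro mult_left_mono mult_right_mono nonneg w0) auto
    finally show ?thesis .
  qed
  have partial: "(\<Sum>i<n. m * (w (k0 + i) * (\<alpha> (k0 + i) * d (k0 + i)))) \<le>
      w k0 * a k0 - w (k0 + n) * a (k0 + n) + K * (\<Sum>i<n. u (k0 + Suc i)) + B * c\<^sub>2\<^sup>2 * (\<Sum>i<n. u (k0 + i))" for n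
  proof (induction n)
    case (Suc n)
    let ?k = "k0 + n"
    have "w ?k * (m * \<alpha> ?k * d ?k) \<le> w ?k * (a ?k - a (?k + 1) + B * (\<alpha> ?k)\<^sup>2)"
      using descent[of ?k] by (intro mult_left_mono w0) auto
    also have "\<dots> = w ?k * a ?k - w (?k + 1) * a (?k + 1) + (w (?k + 1) - w ?k) * a (?k + 1) + B * (w ?k * (\<alpha> ?k)\<^sup>2)"
      by (simp add: algebra_simps)
    also have "\<dots> \<le> w ?k * a ?k - w (?k + 1) * a (?k + 1) + K * u (?k + 1) + B * (c\<^sub>2\<^sup>2 * u ?k)"
      using k0 const by (intro add_mono mult_left_mono w_sq w_step order_refl) auto
    finally show ?case using Suc.IH by (simp add: algebra_simps)
  qed simp
  have u': "summable (\<lambda>i. u (k0 + Suc i))" using u by (subst (asm) summable_Suc_iff[symmetric])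
  have "summable (\<lambda>i. m * (w (k0 + i) * (\<alpha> (k0 + i) * d (k0 + i))))"
  proof (rule summableI_nonneg_bounded)
    fix n
    show "0 \<le> m * (w (k0 + n) * (\<alpha> (k0 + n) * d (k0 + n)))"
      using const w0 nonneg \<alpha>_pos[of "k0 + n"] k0 by simp
    have "(\<Sum>i<n. u (k0 + i)) \<le> (\<Sum>i. u (k0 + i))" "(\<Sum>i<n. u (k0 + Suc i)) \<le> (\<Sum>i. u (k0 + Suc i))"
      using u u' u0 by (auto intro!: sum_le_suminf)
    then have "K * (\<Sum>i<n. u (k0 + Suc i)) \<le> K * (\<Sum>i. u (k0 + Suc i))"
      "B * c\<^sub>2\<^sup>2 * (\<Sum>i<n. u (k0 + i)) \<le> B * c\<^sub>2\<^sup>2 * (\<Sum>i. u (k0 + i))"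
      using K(1) const by (auto intro!: mult_left_mono)
    moreover have "0 \<le> w (k0 + n) * a (k0 + n)" using w0 nonneg by simp
    ultimately show "(\<Sum>i<n. m * (w (k0 + i) * (\<alpha> (k0 + i) * d (k0 + i)))) \<le>
        w k0 * a k0 + K * (\<Sum>i. u (k0 + Suc i)) + B * c\<^sub>2\<^sup>2 * (\<Sum>i. u (k0 + i))"
      using partial[of n] by linarith
  qed
  then have "summable (\<lambda>i. 1 / (m * c\<^sub>1) * (m * (w (k0 + i) * (\<alpha> (k0 + i) * d (k0 + i)))))"
    by (rule summable_mult)
  then show ?thesis
  proof (rule summable_comparison_test'[where N = 0])
    fix i :: nat
    have "c\<^sub>1 * (real (k0 + i) powr (\<gamma> - 1) / (ln (real (k0 + i) + 1))\<^sup>2 * d (k0 + i))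
        \<le> w (k0 + i) * (\<alpha> (k0 + i) * d (k0 + i))" using k0 by (intro w_d) auto
    then show "norm (real (k0 + i) powr (\<gamma> - 1) / (ln (real (k0 + i) + 1))\<^sup>2 * d (k0 + i))
        \<le> 1 / (m * c\<^sub>1) * (m * (w (k0 + i) * (\<alpha> (k0 + i) * d (k0 + i))))"
      using const nonneg(2)[of "k0 + i"] by (simp add: abs_mult field_simps)
  qed
qed

end

section \<open>Stopped processes with martingale difference noise\<close>

text \<open>(1 + t)^2 \<le> 2 (1 + t^2), used twice. The factor 8 of all later moment bounds comes
  from here.\<close>

lemma one_plus_pow4_le: "(1 + t) ^ 4 \<le> 8 * (1 + t ^ 4)" for t :: real
proof -
  have "(1 + t)\<^sup>2 \<le> 2 * (1 + t\<^sup>2)" using sum_squares_bound[of 1 t] by (simp add: power2_eq_square algebra_simps)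
  then have "((1 + t)\<^sup>2)\<^sup>2 \<le> (2 * (1 + t\<^sup>2))\<^sup>2" by (intro power_mono) auto
  also have "\<dots> \<le> 4 * (2 * (1 + (t\<^sup>2)\<^sup>2))"
    using sum_squares_bound[of 1 "t\<^sup>2"] by (simp add: power2_eq_square algebra_simps)
  finally show ?thesis by (simp flip: power_mult)
qed

text \<open>The estimates start at \<open>k0\<close> while the sums start at 1: the finitely many
  earlier terms only have to be finite almost everywhere, without a bound on their
  integrals.\<close>

lemma AE_suminf_finite:
  fixes f :: "nat \<Rightarrow> 'a \<Rightarrow> ennreal"
  assumes [measurable]: "\<And>i. f i \<in> borel_measurable M"
    and fin: "\<And>i. AE x in M. f i x < \<infinity>"
    and tail: "(\<Sum>i. \<integral>\<^sup>+x. f (i + n) x \<partial>M) < \<infinity>"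
  shows "AE x in M. (\<Sum>i. f i x) < \<infinity>"
proof -
  have "(\<integral>\<^sup>+x. (\<Sum>i. f (i + n) x) \<partial>M) < \<infinity>" using tail by (subst nn_integral_suminf) auto
  then have "AE x in M. (\<Sum>i. f (i + n) x) \<noteq> \<infinity>"
    by (intro nn_integral_noteq_infinite) auto
  moreover have "AE x in M. \<forall>i. f i x < \<infinity>" using fin by (simp add: AE_all_countable)
  ultimately show ?thesis
  proof eventually_elim
    case (elim x)
    have "(\<Sum>i. f i x) = (\<Sum>i. f (i + n) x) + (\<Sum>i<n. f i x)"
      by (rule suminf_offset) simp
    moreover have "(\<Sum>i<n. f i x) < \<infinity>" using elim(2) by (auto simp: ennreal_sum_less_top)
    ultimately show ?case using elim(1) by (auto simp: less_top)
  qed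
qed

section \<open>Conditional moments of the noise\<close>

locale adapted_noise = prob_space P for P :: "'w measure" +
  fixes F :: "nat \<Rightarrow> 'w measure" and x \<nu> :: "nat \<Rightarrow> 'w \<Rightarrow> 'a::euclidean_space" and q :: "'a \<Rightarrow> real"
  assumes subalg: "k \<ge> 1 \<Longrightarrow> subalgebra P (F k)"
    and mds: "martingale_difference P F \<nu>"
    and q_nonneg: "q z \<ge> 0"
    and moment: "k \<ge> 1 \<Longrightarrow>
          AE w in P. nn_cond_exp P (F k) (\<lambda>w. ennreal (norm (\<nu> k w) ^ 4)) w < ennreal (q (x k w))"
begin

lemma sigma_finite_F: "k \<ge> 1 \<Longrightarrow> sigma_finite_subalgebra P (F k)"
  using subalg by (intro finite_measure_subalgebra_is_sigma_finite finite_measure_subalgebra.intro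
      finite_measure_subalgebra_axioms.intro finite_measure_axioms)

lemma F_imp_P: "k \<ge> 1 \<Longrightarrow> f \<in> measurable (F k) N \<Longrightarrow> f \<in> measurable P N"
  using measurable_from_subalg subalg by blast

lemma F_sets_P: "k \<ge> 1 \<Longrightarrow> S \<in> sets (F k) \<Longrightarrow> S \<in> sets P"
  using subalg by (auto simp: subalgebra_def)

lemma space_F: "k \<ge> 1 \<Longrightarrow> space (F k) = space P"
  using subalg by (auto simp: subalgebra_def)

lemma noise_integrable: "k \<ge> 1 \<Longrightarrow> integrable P (\<nu> k)"
  using mds by (auto simp: martingale_difference_def)

lemma noise_measurable: "k \<ge> 1 \<Longrightarrow> \<nu> k \<in> borel_measurable P"
  by (rule borel_measurable_integrable[OF noise_integrable])

lemma noise_coordinate_mean_zero: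
  assumes k: "k \<ge> 1" and b: "b \<in> Basis"
  shows "AE w in P. real_cond_exp P (F k) (\<lambda>w. \<nu> k w \<bullet> b) w = 0"
proof -
  have "AE w in P. vec_cond_exp P (F k) (\<nu> k) w = 0"
    using mds k by (auto simp: martingale_difference_def)
  then show ?thesis
  proof eventually_elim
    case (elim w)
    then have "vec_cond_exp P (F k) (\<nu> k) w \<bullet> b = 0" by simp
    then show ?case using b by (simp add: vec_cond_exp_def inner_sum_left_Basis)
  qed
qed

text \<open>\<open>vec_cond_exp\<close> works by coordinates, so the inner product is expanded in
  \<open>Basis\<close>; the coordinates of \<open>h\<close> are known at time k and leave the
  conditional expectation.\<close>

lemma noise_orthogonal:
  assumes k: "k \<ge> 1" and h: "h \<in> borel_measurable (F k)" and bd: "\<And>w. w \<in> space P \<Longrightarrow> norm (h w) \<le> c"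
  shows "integrable P (\<lambda>w. \<nu> k w \<bullet> h w)"
    and "AE w in P. real_cond_exp P (F k) (\<lambda>w. \<nu> k w \<bullet> h w) w = 0"
    and "(\<integral>w. \<nu> k w \<bullet> h w \<partial>P) = 0"
proof -
  interpret S: sigma_finite_subalgebra P "F k" by (rule sigma_finite_F[OF k])
  note [measurable] = noise_measurable[OF k] h F_imp_P[OF k h]
  have hb: "(\<lambda>w. h w \<bullet> b) \<in> borel_measurable (F k)" for b by measurable
  have int: "integrable P (\<lambda>w. (h w \<bullet> b) * (\<nu> k w \<bullet> b))" if b: "b \<in> Basis" for b
  proof (rule Bochner_Integration.integrable_bound)
    show "integrable P (\<lambda>w. c * norm (\<nu> k w))" using noise_integrable[OF k] by auto
    show "AE w in P. norm ((h w \<bullet> b) * (\<nu> k w \<bullet> b)) \<le> norm (c * norm (\<nu> k w))"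
    proof (rule AE_I2)
      fix w assume w: "w \<in> space P"
      have "\<bar>h w \<bullet> b\<bar> * \<bar>\<nu> k w \<bullet> b\<bar> \<le> norm (h w) * norm (\<nu> k w)"
        using b by (intro mult_mono Basis_le_norm) auto
      also have "\<dots> \<le> c * norm (\<nu> k w)" by (intro mult_right_mono bd[OF w]) auto
      finally have "\<bar>h w \<bullet> b\<bar> * \<bar>\<nu> k w \<bullet> b\<bar> \<le> c * norm (\<nu> k w)" .
      from order_trans[OF this abs_ge_self]
      show "norm ((h w \<bullet> b) * (\<nu> k w \<bullet> b)) \<le> norm (c * norm (\<nu> k w))" by (simp add: abs_mult)
    qed
  qed measurable
  have eq: "(\<lambda>w. \<nu> k w \<bullet> h w) = (\<lambda>w. \<Sum>b\<in>Basis. (h w \<bullet> b) * (\<nu> k w \<bullet> b))"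
    by (subst euclidean_inner) (simp add: mult.commute)
  show *: "integrable P (\<lambda>w. \<nu> k w \<bullet> h w)" unfolding eq using int by auto
  have "AE w in P. real_cond_exp P (F k) (\<lambda>w. \<Sum>b\<in>Basis. (h w \<bullet> b) * (\<nu> k w \<bullet> b)) w
      = (\<Sum>b\<in>Basis. real_cond_exp P (F k) (\<lambda>w. (h w \<bullet> b) * (\<nu> k w \<bullet> b)) w)"
  proof -
    \<comment> \<open>The sum rule asks for integrability at every index of the type, so the family
      is extended by 0 outside \<open>Basis\<close>.\<close>
    define g where "g = (\<lambda>b w. if b \<in> Basis then (h w \<bullet> b) * (\<nu> k w \<bullet> b) else 0)"
    have "integrable P (g b)" for b using int by (cases "b \<in> Basis") (auto simp: g_def)
    then have "AE w in P. real_cond_exp P (F k) (\<lambda>w. \<Sum>b\<in>Basis. g b w) w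
        = (\<Sum>b\<in>Basis. real_cond_exp P (F k) (g b) w)" by (rule S.real_cond_exp_sum)
    then show ?thesis by (simp add: g_def)
  qed
  moreover have "AE w in P. \<forall>b\<in>Basis. real_cond_exp P (F k) (\<lambda>w. (h w \<bullet> b) * (\<nu> k w \<bullet> b)) w = 0"
  proof (rule AE_finite_allI)
    fix b :: 'a assume b: "b \<in> Basis"
    show "AE w in P. real_cond_exp P (F k) (\<lambda>w. (h w \<bullet> b) * (\<nu> k w \<bullet> b)) w = 0"
      using S.real_cond_exp_mult[OF hb _ int[OF b]] noise_coordinate_mean_zero[OF k b] by auto
  qed simp
  ultimately show **: "AE w in P. real_cond_exp P (F k) (\<lambda>w. \<nu> k w \<bullet> h w) w = 0"
    unfolding eq by eventually_elim simp
  have "(\<integral>w. \<nu> k w \<bullet> h w \<partial>P) = (\<integral>w. real_cond_exp P (F k) (\<lambda>w. \<nu> k w \<bullet> h w) w \<partial>P)"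
    using S.real_cond_exp_int(2)[OF *] by simp
  also have "\<dots> = (\<integral>w. 0 \<partial>P)" by (rule integral_cong_AE) (use ** in auto)
  finally show "(\<integral>w. \<nu> k w \<bullet> h w \<partial>P) = 0" by simp
qed

text \<open>One weight for all moments: the fourth power dominates (1 + |\<nu>|)^2, which multiplies
  the remainders, and is its square, as needed for |E|^2. With values in \<open>ennreal\<close> it
  has conditional expectations without integrability conditions.\<close>

definition noise_weight :: "nat \<Rightarrow> 'w \<Rightarrow> ennreal" where
  "noise_weight k w = ennreal ((1 + norm (\<nu> k w)) ^ 4)"

lemma noise_weight_measurable: "k \<ge> 1 \<Longrightarrow> noise_weight k \<in> borel_measurable P"
  using noise_measurable[of k] unfolding noise_weight_def by measurable

lemma noise_weight_cond_exp:
  assumes k: "k \<ge> 1"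
  shows "AE w in P. nn_cond_exp P (F k) (noise_weight k) w \<le> ennreal (8 * (1 + q (x k w)))"
proof -
  interpret S: sigma_finite_subalgebra P "F k" by (rule sigma_finite_F[OF k])
  note [measurable] = noise_measurable[OF k] noise_weight_measurable[OF k]
  let ?n = "\<lambda>w. ennreal (norm (\<nu> k w) ^ 4)"
  have "AE w in P. nn_cond_exp P (F k) (noise_weight k) w \<le> nn_cond_exp P (F k) (\<lambda>w. 8 + 8 * ?n w) w"
  proof (rule S.nn_cond_exp_mono)
    show "AE w in P. noise_weight k w \<le> 8 + 8 * ?n w"
    proof (rule AE_I2)
      fix w
      have "noise_weight k w \<le> ennreal (8 * (1 + norm (\<nu> k w) ^ 4))"
        unfolding noise_weight_def by (intro ennreal_leI one_plus_pow4_le)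
      also have "\<dots> = 8 + 8 * ?n w" by (simp add: ennreal_plus ennreal_mult distrib_left)
      finally show "noise_weight k w \<le> 8 + 8 * ?n w" .
    qed
  qed measurable
  moreover have "AE w in P. nn_cond_exp P (F k) (\<lambda>w. 8) w + nn_cond_exp P (F k) (\<lambda>w. 8 * ?n w) w
      = nn_cond_exp P (F k) (\<lambda>w. 8 + 8 * ?n w) w"
    by (rule S.nn_cond_exp_sum) measurable
  moreover have "AE w in P. 8 = nn_cond_exp P (F k) (\<lambda>w. 8) w" by (rule S.nn_cond_exp_F_meas) measurable
  moreover have "AE w in P. 8 * nn_cond_exp P (F k) ?n w = nn_cond_exp P (F k) (\<lambda>w. 8 * ?n w) w"
    by (rule S.nn_cond_exp_prod) measurable
  ultimately show ?thesis using moment[OF k]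
  proof eventually_elim
    case (elim w)
    have "nn_cond_exp P (F k) (noise_weight k) w \<le> 8 + 8 * nn_cond_exp P (F k) ?n w"
      using elim(1-4) by metis
    also have "\<dots> \<le> 8 + 8 * ennreal (q (x k w))"
      using elim(5) by (intro add_left_mono mult_left_mono) auto
    also have "\<dots> = ennreal (8 * (1 + q (x k w)))" using q_nonneg by (simp add: ennreal_plus ennreal_mult distrib_left)
    finally show ?case .
  qed
qed

text \<open>Meant for times before \<open>k0\<close>, where q (x k) has no uniform bound but is
  still a finite number at each outcome.\<close>

lemma noise_weight_cond_exp_finite:
  assumes k: "k \<ge> 1" and [measurable]: "g \<in> borel_measurable P"
    and g: "\<And>w. w \<in> space P \<Longrightarrow> g w \<le> ennreal c * noise_weight k w"
  shows "AE w in P. nn_cond_exp P (F k) g w < \<infinity>"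
proof -
  interpret S: sigma_finite_subalgebra P "F k" by (rule sigma_finite_F[OF k])
  note [measurable] = noise_weight_measurable[OF k]
  have "AE w in P. nn_cond_exp P (F k) g w \<le> nn_cond_exp P (F k) (\<lambda>w. ennreal c * noise_weight k w) w"
    by (rule S.nn_cond_exp_mono) (use g in auto)
  moreover have "AE w in P. ennreal c * nn_cond_exp P (F k) (noise_weight k) w
      = nn_cond_exp P (F k) (\<lambda>w. ennreal c * noise_weight k w) w"
    by (rule S.nn_cond_exp_prod) measurable
  ultimately show ?thesis using noise_weight_cond_exp[OF k]
  proof eventually_elim
    case (elim w)
    then have "nn_cond_exp P (F k) (noise_weight k) w < \<infinity>" by (metis ennreal_less_top infinity_ennreal_def le_less_trans)
    then show ?case using elim(1,2) by (metis ennreal_less_top ennreal_mult_less_top infinity_ennreal_def le_less_trans)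
  qed
qed

text \<open>The moment bound depends on the state. A factor \<open>g\<close> that is known at time k
  and vanishes wherever q (x k) exceeds \<open>Q\<close> replaces it by a constant; indicators of
  the stopping events supply such factors.\<close>

lemma noise_weight_integral:
  assumes k: "k \<ge> 1" and g: "g \<in> borel_measurable (F k)"
    and supp: "\<And>w. w \<in> space P \<Longrightarrow> g w \<noteq> 0 \<Longrightarrow> q (x k w) \<le> Q"
  shows "(\<integral>\<^sup>+w. g w * noise_weight k w \<partial>P) \<le> ennreal (8 * (1 + Q)) * (\<integral>\<^sup>+w. g w \<partial>P)"
proof -
  interpret S: sigma_finite_subalgebra P "F k" by (rule sigma_finite_F[OF k])
  note [measurable] = noise_weight_measurable[OF k] g F_imp_P[OF k g]
  have "(\<integral>\<^sup>+w. g w * noise_weight k w \<partial>P) = (\<integral>\<^sup>+w. g w * nn_cond_exp P (F k) (noise_weight k) w \<partial>P)"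
    by (rule S.nn_cond_exp_intg[symmetric]) measurable
  also have "\<dots> \<le> (\<integral>\<^sup>+w. ennreal (8 * (1 + Q)) * g w \<partial>P)"
  proof (rule nn_integral_mono_AE)
    show "AE w in P. g w * nn_cond_exp P (F k) (noise_weight k) w \<le> ennreal (8 * (1 + Q)) * g w"
      using noise_weight_cond_exp[OF k] AE_space
    proof eventually_elim
      case (elim w)
      show ?case
      proof (cases "g w = 0")
        case False
        then have "nn_cond_exp P (F k) (noise_weight k) w \<le> ennreal (8 * (1 + Q))"
          using supp[OF elim(2)] by (intro order_trans[OF elim(1)] ennreal_leI) auto
        then show ?thesis by (metis mult.commute mult_left_mono zero_le)
      qed simp
    qed
  qed
  also have "\<dots> = ennreal (8 * (1 + Q)) * (\<integral>\<^sup>+w. g w \<partial>P)" by (rule nn_integral_cmult) measurable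
  finally show ?thesis .
qed

lemma noise_weight_integral_real:
  assumes k: "k \<ge> 1" and g: "g \<in> borel_measurable (F k)" and Q: "Q \<ge> 0"
    and bd: "\<And>w. w \<in> space P \<Longrightarrow> 0 \<le> g w \<and> g w \<le> c"
    and supp: "\<And>w. w \<in> space P \<Longrightarrow> g w \<noteq> 0 \<Longrightarrow> q (x k w) \<le> Q"
  shows "integrable P (\<lambda>w. g w * (1 + norm (\<nu> k w)) ^ 4)"
    and "(\<integral>w. g w * (1 + norm (\<nu> k w)) ^ 4 \<partial>P) \<le> 8 * (1 + Q) * (\<integral>w. g w \<partial>P)"
proof -
  note [measurable] = noise_measurable[OF k] F_imp_P[OF k g]
  have intg: "integrable P g"
    by (rule integrable_const_bound[of _ c]) (use bd in auto)
  have "(\<lambda>w. ennreal (g w)) \<in> borel_measurable (F k)" using g by measurable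
  from noise_weight_integral[OF k this, of Q] supp
  have "(\<integral>\<^sup>+w. ennreal (g w) * noise_weight k w \<partial>P) \<le> ennreal (8 * (1 + Q)) * (\<integral>\<^sup>+w. ennreal (g w) \<partial>P)"
    by (metis (full_types) ennreal_0)
  also have "(\<integral>\<^sup>+w. ennreal (g w) \<partial>P) = ennreal (\<integral>w. g w \<partial>P)"
    by (rule nn_integral_eq_integral[OF intg]) (use bd in auto)
  also have "ennreal (8 * (1 + Q)) * ennreal (\<integral>w. g w \<partial>P) = ennreal (8 * (1 + Q) * (\<integral>w. g w \<partial>P))"
    using Q by (simp add: ennreal_mult')
  also have "(\<integral>\<^sup>+w. ennreal (g w) * noise_weight k w \<partial>P)
      = (\<integral>\<^sup>+w. ennreal (g w * (1 + norm (\<nu> k w)) ^ 4) \<partial>P)"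
    by (rule nn_integral_cong) (use bd in \<open>simp add: noise_weight_def ennreal_mult'\<close>)
  finally have le: "(\<integral>\<^sup>+w. ennreal (g w * (1 + norm (\<nu> k w)) ^ 4) \<partial>P)
      \<le> ennreal (8 * (1 + Q) * (\<integral>w. g w \<partial>P))" .
  have nn: "AE w in P. 0 \<le> g w * (1 + norm (\<nu> k w)) ^ 4" using bd by (intro AE_I2) simp
  show int: "integrable P (\<lambda>w. g w * (1 + norm (\<nu> k w)) ^ 4)"
    by (rule integrableI_nonneg[OF _ nn]) (use le in \<open>auto intro: le_less_trans\<close>)
  have "0 \<le> (\<integral>w. g w \<partial>P)" using bd by (intro integral_nonneg_AE AE_I2) auto
  then show "(\<integral>w. g w * (1 + norm (\<nu> k w)) ^ 4 \<partial>P) \<le> 8 * (1 + Q) * (\<integral>w. g w \<partial>P)"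
    using le unfolding nn_integral_eq_integral[OF int nn] using Q by (subst (asm) ennreal_le_iff) auto
qed

end

text \<open>\<open>A k\<close> is the event that the exit time exceeds \<open>k\<close>, \<open>D k\<close> the distance to the manifold, \<open>z k\<close> the
  residual of the nearest-point projection and \<open>E k\<close> the error of the shadow sequence.\<close>

locale stopped_process = adapted_noise P F x \<nu> q
  for P :: "'w measure" and F and x \<nu> :: "nat \<Rightarrow> 'w \<Rightarrow> 'a::euclidean_space" and q +
  fixes A :: "nat \<Rightarrow> 'w set" and D :: "nat \<Rightarrow> 'w \<Rightarrow> real" and z E :: "nat \<Rightarrow> 'w \<Rightarrow> 'a"
    and \<alpha> :: "nat \<Rightarrow> real" and c\<^sub>1 c\<^sub>2 \<gamma> \<mu> \<epsilon> \<delta> Q C C\<^sub>1 :: real and c :: "nat \<Rightarrow> real" and k0 :: nat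
  assumes const: "c\<^sub>1 > 0" "c\<^sub>2 > 0" "1/2 < \<gamma>" "\<gamma> \<le> 1" "\<mu> > 0" "\<epsilon> \<ge> 0" "\<delta> > 0" "Q \<ge> 0" "C \<ge> 0" "C\<^sub>1 \<ge> 0"
    and step: "k \<ge> 1 \<Longrightarrow> c\<^sub>1 * real k powr (-\<gamma>) \<le> \<alpha> k \<and> \<alpha> k \<le> c\<^sub>2 * real k powr (-\<gamma>)"
    and k0: "k0 \<ge> 1"
    and \<epsilon>_small: "8 * (1 + Q) * (2 * \<epsilon>) \<le> \<mu>"
    and \<delta>_small: "2 * \<delta> \<le> \<mu> * c\<^sub>1"
    and A_sets: "k \<ge> 1 \<Longrightarrow> A k \<in> sets (F k)"
    and A_dec: "k \<ge> k0 \<Longrightarrow> A (k + 1) \<subseteq> A k"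
    and q_le: "k \<ge> k0 \<Longrightarrow> w \<in> A k \<Longrightarrow> q (x k w) \<le> Q"
    and D_meas: "k \<ge> 1 \<Longrightarrow> D k \<in> borel_measurable (F k)"
    and D_nonneg: "0 \<le> D k w"
    and D_le: "k \<ge> k0 \<Longrightarrow> w \<in> A k \<Longrightarrow> D k w \<le> \<delta>"
    and z_meas: "k \<ge> 1 \<Longrightarrow> (\<lambda>w. indicat_real (A k) w *\<^sub>R z k w) \<in> borel_measurable (F k)"
    and z_le: "k \<ge> k0 \<Longrightarrow> w \<in> A k \<Longrightarrow> norm (z k w) \<le> \<delta>"
    and descent: "k \<ge> k0 \<Longrightarrow> w \<in> A k \<Longrightarrow> (D (k + 1) w)\<^sup>2 \<le> (D k w)\<^sup>2
         - 2 * \<alpha> k * (\<mu> * D k w - (1 + norm (\<nu> k w))\<^sup>2 * (\<epsilon> * D k w + C * \<alpha> k) + \<nu> k w \<bullet> z k w)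
         + (\<alpha> k)\<^sup>2 * (C * (1 + norm (\<nu> k w)))\<^sup>2"
    and E_meas: "k \<ge> 1 \<Longrightarrow> E k \<in> borel_measurable P"
    and E_bound: "k \<ge> k0 \<Longrightarrow> w \<in> A k \<Longrightarrow> norm (E k w) \<le> C\<^sub>1 * (1 + norm (\<nu> k w))\<^sup>2 * (D k w + \<alpha> k)"
    and E_growth: "k \<ge> 1 \<Longrightarrow> w \<in> space P \<Longrightarrow> norm (E k w) \<le> c k * (1 + norm (\<nu> k w))"
begin

abbreviation weight :: "nat \<Rightarrow> real" where
  "weight k \<equiv> real k powr (\<gamma> - 1) / (ln (real k + 1))\<^sup>2"

abbreviation cond :: "nat \<Rightarrow> ('w \<Rightarrow> ennreal) \<Rightarrow> 'w \<Rightarrow> ennreal" where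
  "cond k \<equiv> nn_cond_exp P (F k)"

abbreviation stopped_mean :: "nat \<Rightarrow> ('w \<Rightarrow> real) \<Rightarrow> ennreal" where
  "stopped_mean k X \<equiv> (\<integral>\<^sup>+w. ennreal (X w) * indicator (A k) w \<partial>P)"

lemma \<alpha>_bounds:
  assumes "k \<ge> 1"
  shows "\<alpha> k > 0" "\<alpha> k \<le> c\<^sub>2"
proof -
  show "\<alpha> k > 0" using step[OF assms] step_size_pos[OF const(1) assms] by blast
  have "real k powr (-\<gamma>) \<le> real k powr 0" using const assms by (intro powr_mono) auto
  then have "c\<^sub>2 * real k powr (-\<gamma>) \<le> c\<^sub>2 * 1" using const assms by (intro mult_left_mono) auto
  then show "\<alpha> k \<le> c\<^sub>2" using step[OF assms] by linarith
qed

lemma ge_k0: "k \<ge> k0 \<Longrightarrow> k \<ge> 1"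
  using k0 by simp

definition a :: "nat \<Rightarrow> real" where "a k = (\<integral>w. indicat_real (A k) w * (D k w)\<^sup>2 \<partial>P)"
definition d :: "nat \<Rightarrow> real" where "d k = (\<integral>w. indicat_real (A k) w * D k w \<partial>P)"

lemma ind_meas: "k \<ge> 1 \<Longrightarrow> indicat_real (A k) \<in> borel_measurable (F k)"
  using A_sets by measurable

lemma integrable_stopped:
  assumes k: "k \<ge> k0"
  shows "integrable P (\<lambda>w. indicat_real (A k) w * (D k w)\<^sup>2)"
    and "integrable P (\<lambda>w. indicat_real (A k) w * D k w)"
    and "integrable P (indicat_real (A k))"
proof -
  note [measurable] = F_imp_P[OF ge_k0[OF k] D_meas[OF ge_k0[OF k]]] F_imp_P[OF ge_k0[OF k] ind_meas[OF ge_k0[OF k]]]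
  show "integrable P (\<lambda>w. indicat_real (A k) w * (D k w)\<^sup>2)"
  proof (rule integrable_const_bound[of _ "\<delta>\<^sup>2"])
    show "AE w in P. norm (indicat_real (A k) w * (D k w)\<^sup>2) \<le> \<delta>\<^sup>2"
      using D_le[OF k] D_nonneg by (auto simp: indicator_def intro!: power_mono)
  qed measurable
  show "integrable P (\<lambda>w. indicat_real (A k) w * D k w)"
  proof (rule integrable_const_bound[of _ \<delta>])
    show "AE w in P. norm (indicat_real (A k) w * D k w) \<le> \<delta>"
      using D_le[OF k] D_nonneg const by (auto simp: indicator_def)
  qed measurable
  show "integrable P (indicat_real (A k))"
  proof (rule integrable_const_bound[of _ 1])
    show "AE w in P. norm (indicat_real (A k) w) \<le> 1" by (auto simp: indicator_def)
  qed measurable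
qed

lemma integral_indicator_le:
  assumes "k \<ge> k0"
  shows "(\<integral>w. indicat_real (A k) w \<partial>P) \<le> 1"
proof -
  have "(\<integral>w. indicat_real (A k) w \<partial>P) \<le> (\<integral>w. 1 \<partial>P)"
    using integrable_stopped(3)[OF assms] by (intro integral_mono) (auto intro: indicator_le_1)
  then show ?thesis by (simp add: prob_space)
qed

text \<open>Integrating the pathwise descent over \<open>A k\<close> removes the linear noise term,
  because the stopped residual is known at time k and bounded. The events decrease, so the indicator
  of \<open>A (k + 1)\<close> is at most that of \<open>A k\<close>.\<close>

lemma moment_recursion:
  assumes k: "k \<ge> k0"
  shows "a (k + 1) \<le> a k - \<mu> * \<alpha> k * d k + 8 * (1 + Q) * (2 * C + C\<^sup>2) * (\<alpha> k)\<^sup>2"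
proof -
  have k1: "k \<ge> 1" using k k0 by simp
  note \<alpha>k = \<alpha>_bounds[OF k1]
  let ?I = "indicat_real (A k)"
  define N where "N w = (1 + norm (\<nu> k w)) ^ 4" for w
  define b where "b = (2 * C + C\<^sup>2) * (\<alpha> k)\<^sup>2"
  have b: "b \<ge> 0" using const by (simp add: b_def)
  \<comment> \<open>\<open>g\<close> collects the coefficient of (1 + |\<nu>|)^2. It is known at
    time k and vanishes off \<open>A k\<close>, so the moment bound with \<open>Q\<close> applies
    once the square is enlarged to the fourth power \<open>N\<close>.\<close>
  define g where "g w = ?I w * (2 * \<alpha> k * \<epsilon> * D k w + b)" for w
  have g: "g \<in> borel_measurable (F k)"
    unfolding g_def using ind_meas[OF k1] D_meas[OF k1] by measurable
  have g_bd: "0 \<le> g w \<and> g w \<le> 2 * \<alpha> k * \<epsilon> * \<delta> + b" for w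
    unfolding g_def using b const \<alpha>k D_nonneg[of k w] D_le[OF k, of w]
    by (auto simp: indicator_def intro!: mult_left_mono)
  have g_supp: "q (x k w) \<le> Q" if "g w \<noteq> 0" for w
    using that q_le[OF k, of w] by (auto simp: g_def indicator_def split: if_splits)
  note gN = noise_weight_integral_real[OF k1 g const(8) g_bd g_supp, folded N_def]
  have h_bd: "norm (?I w *\<^sub>R z k w) \<le> \<delta>" for w
    using z_le[OF k, of w] const by (auto simp: indicator_def)
  note orth = noise_orthogonal(1,3)[OF k1 z_meas[OF k1] h_bd]
  have pointwise: "indicat_real (A (k + 1)) w * (D (k + 1) w)\<^sup>2 \<le>
      ?I w * (D k w)\<^sup>2 - 2 * \<alpha> k * \<mu> * (?I w * D k w) - 2 * \<alpha> k * (\<nu> k w \<bullet> (?I w *\<^sub>R z k w)) + g w * N w"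
    for w
  proof (cases "w \<in> A k")
    case True
    let ?n = "1 + norm (\<nu> k w)"
    have n: "?n\<^sup>2 \<le> N w" "N w \<ge> 0" unfolding N_def by (auto intro: power_increasing)
    have c0: "2 * \<alpha> k * (\<epsilon> * D k w + C * \<alpha> k) + (\<alpha> k)\<^sup>2 * C\<^sup>2 \<ge> 0"
      using const \<alpha>k D_nonneg[of k w] by simp
    have "indicat_real (A (k + 1)) w * (D (k + 1) w)\<^sup>2 \<le> (D (k + 1) w)\<^sup>2" by (simp add: indicator_def)
    also have "\<dots> \<le> (D k w)\<^sup>2 - 2 * \<alpha> k * \<mu> * D k w - 2 * \<alpha> k * (\<nu> k w \<bullet> z k w)
        + (2 * \<alpha> k * (\<epsilon> * D k w + C * \<alpha> k) + (\<alpha> k)\<^sup>2 * C\<^sup>2) * ?n\<^sup>2"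
      using descent[OF k True] unfolding power_mult_distrib by (simp add: algebra_simps)
    also have "(2 * \<alpha> k * (\<epsilon> * D k w + C * \<alpha> k) + (\<alpha> k)\<^sup>2 * C\<^sup>2) * ?n\<^sup>2
        \<le> (2 * \<alpha> k * (\<epsilon> * D k w + C * \<alpha> k) + (\<alpha> k)\<^sup>2 * C\<^sup>2) * N w"
      by (intro mult_left_mono n c0)
    also have "2 * \<alpha> k * (\<epsilon> * D k w + C * \<alpha> k) + (\<alpha> k)\<^sup>2 * C\<^sup>2 = g w"
      using True by (simp add: g_def b_def power2_eq_square algebra_simps)
    finally show ?thesis using True by simp
  next
    case False
    then have "w \<notin> A (k + 1)" using A_dec[OF k] by auto
    with False show ?thesis by (simp add: g_def)
  qed
  note ik = integrable_stopped[OF k] and ik1 = integrable_stopped[of "k + 1"]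
  have "a (k + 1) \<le> (\<integral>w. (?I w * (D k w)\<^sup>2 - 2 * \<alpha> k * \<mu> * (?I w * D k w)
      - 2 * \<alpha> k * (\<nu> k w \<bullet> (?I w *\<^sub>R z k w)) + g w * N w) \<partial>P)"
    unfolding a_def
    by (rule integral_mono[OF _ _ pointwise])
       (use ik1 k in simp, intro Bochner_Integration.integrable_add Bochner_Integration.integrable_diff
          integrable_mult_right ik orth gN)
  also have "\<dots> = a k - 2 * \<alpha> k * \<mu> * d k - 2 * \<alpha> k * 0 + (\<integral>w. g w * N w \<partial>P)"
  proof (rule has_bochner_integral_integral_eq)
    show "has_bochner_integral P (\<lambda>w. ?I w * (D k w)\<^sup>2 - 2 * \<alpha> k * \<mu> * (?I w * D k w)
        - 2 * \<alpha> k * (\<nu> k w \<bullet> (?I w *\<^sub>R z k w)) + g w * N w)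
        (a k - 2 * \<alpha> k * \<mu> * d k - 2 * \<alpha> k * 0 + (\<integral>w. g w * N w \<partial>P))"
      unfolding a_def d_def orth(2)[symmetric]
      by (intro has_bochner_integral_add has_bochner_integral_diff has_bochner_integral_mult_right
          has_bochner_integral_integrable ik orth(1) gN(1))
  qed
  also have "(\<integral>w. g w * N w \<partial>P) \<le> 8 * (1 + Q) * (\<integral>w. g w \<partial>P)" by (rule gN(2))
  also have "(\<integral>w. g w \<partial>P) = (\<integral>w. 2 * \<alpha> k * \<epsilon> * (?I w * D k w) + b * ?I w \<partial>P)"
    by (rule Bochner_Integration.integral_cong) (auto simp: g_def algebra_simps)
  also have "\<dots> = 2 * \<alpha> k * \<epsilon> * d k + b * (\<integral>w. ?I w \<partial>P)"
    unfolding d_def by (subst Bochner_Integration.integral_add) (auto intro: ik)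
  finally have main: "a (k + 1) \<le> a k - 2 * \<alpha> k * \<mu> * d k +
     8 * (1 + Q) * (2 * \<alpha> k * \<epsilon> * d k + b * (\<integral>w. ?I w \<partial>P))" by simp
  have "b * (\<integral>w. ?I w \<partial>P) \<le> b * 1" using b integral_indicator_le[OF k] by (intro mult_left_mono) auto
  then have "8 * (1 + Q) * (b * (\<integral>w. ?I w \<partial>P)) \<le> 8 * (1 + Q) * b" using const by (intro mult_left_mono) auto
  \<comment> \<open>Half of the drift 2 \<mu> \<alpha> k d k is spent on the averaged remainder; the
    other half survives.\<close>
  moreover have "8 * (1 + Q) * (2 * \<epsilon>) * (\<alpha> k * d k) \<le> \<mu> * (\<alpha> k * d k)"
    using \<alpha>k by (intro mult_right_mono \<epsilon>_small) (auto simp: d_def D_nonneg intro!: integral_nonneg_AE)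
  ultimately show ?thesis using main by (simp add: b_def algebra_simps)
qed

sublocale moments: descent_sequence \<alpha> a d c\<^sub>1 c\<^sub>2 \<gamma> \<mu> "8 * (1 + Q) * (2 * C + C\<^sup>2)" \<delta> k0
proof
  show "a k \<ge> 0" "d k \<ge> 0" for k by (auto simp: a_def d_def D_nonneg intro!: integral_nonneg_AE)
  show "a k \<le> \<delta> * d k" if k: "k \<ge> k0" for k
  proof -
    have "a k \<le> (\<integral>w. \<delta> * (indicat_real (A k) w * D k w) \<partial>P)"
      unfolding a_def using integrable_stopped[OF k] D_le[OF k] D_nonneg
      by (intro integral_mono) (auto simp: indicator_def power2_eq_square intro!: mult_right_mono)
    then show ?thesis by (simp add: d_def)
  qed
  show "a k \<le> \<delta>\<^sup>2" if k: "k \<ge> k0" for k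
  proof -
    have "a k \<le> (\<integral>w. \<delta>\<^sup>2 \<partial>P)"
      unfolding a_def using integrable_stopped[OF k] D_le[OF k] D_nonneg
      by (intro integral_mono) (auto simp: indicator_def intro!: power_mono)
    then show ?thesis by (simp add: prob_space)
  qed
qed (use const step k0 \<delta>_small moment_recursion in auto)


section \<open>Moments and sums of the error before the exit time\<close>

lemma E_le_weight:
  assumes k: "k \<ge> k0" and w: "w \<in> A k"
  shows "norm (E k w) \<le> C\<^sub>1 * (D k w + \<alpha> k) * (1 + norm (\<nu> k w)) ^ 4"
    and "(norm (E k w))\<^sup>2 \<le> C\<^sub>1\<^sup>2 * (D k w + \<alpha> k)\<^sup>2 * (1 + norm (\<nu> k w)) ^ 4"
proof -
  let ?n = "1 + norm (\<nu> k w)"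
  have n: "?n\<^sup>2 \<le> ?n ^ 4" by (intro power_increasing) auto
  have p: "0 \<le> C\<^sub>1 * (D k w + \<alpha> k)" using const \<alpha>_bounds(1)[OF ge_k0[OF k]] D_nonneg[of k w] by simp
  have e: "norm (E k w) \<le> C\<^sub>1 * (D k w + \<alpha> k) * ?n\<^sup>2" using E_bound[OF k w] by (simp add: mult_ac)
  also have "\<dots> \<le> C\<^sub>1 * (D k w + \<alpha> k) * ?n ^ 4" by (intro mult_left_mono n p)
  finally show "norm (E k w) \<le> C\<^sub>1 * (D k w + \<alpha> k) * ?n ^ 4" .
  have "(norm (E k w))\<^sup>2 \<le> (C\<^sub>1 * (D k w + \<alpha> k) * ?n\<^sup>2)\<^sup>2" by (intro power_mono e) auto
  then show "(norm (E k w))\<^sup>2 \<le> C\<^sub>1\<^sup>2 * (D k w + \<alpha> k)\<^sup>2 * ?n ^ 4"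
    by (simp add: power_mult_distrib flip: power_mult)
qed

text \<open>\<open>A k\<close> is known at time k, so its indicator enters the conditional
  expectation, where the bound on \<open>g\<close> holds, and leaves it again to meet the bound on
  \<open>q\<close>.\<close>

lemma stopped_cond_exp_le:
  assumes k: "k \<ge> k0" and [measurable]: "g \<in> borel_measurable P"
    and g: "\<And>w. w \<in> A k \<Longrightarrow> g w \<le> ennreal b * noise_weight k w" and b: "b \<ge> 0"
  shows "AE w in P. cond k g w * indicator (A k) w \<le> ennreal (b * (8 * (1 + Q)))"
proof -
  interpret S: sigma_finite_subalgebra P "F k" by (rule sigma_finite_F[OF ge_k0[OF k]])
  let ?I = "indicator (A k) :: 'w \<Rightarrow> ennreal"
  have I: "?I \<in> borel_measurable (F k)" using A_sets[OF ge_k0[OF k]] by measurable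
  have bI: "(\<lambda>w. ennreal b * ?I w) \<in> borel_measurable (F k)" using I by measurable
  note [measurable] = F_imp_P[OF ge_k0[OF k] I] noise_weight_measurable[OF ge_k0[OF k]]
  have "AE w in P. ?I w * cond k g w = cond k (\<lambda>w. ?I w * g w) w"
    by (rule S.nn_cond_exp_prod[OF I]) measurable
  moreover have "AE w in P. cond k (\<lambda>w. ?I w * g w) w
      \<le> cond k (\<lambda>w. (ennreal b * ?I w) * noise_weight k w) w"
  proof (rule S.nn_cond_exp_mono)
    show "AE w in P. ?I w * g w \<le> (ennreal b * ?I w) * noise_weight k w"
      using g by (auto simp: indicator_def)
  qed measurable
  moreover have "AE w in P. (ennreal b * ?I w) * cond k (noise_weight k) w
      = cond k (\<lambda>w. (ennreal b * ?I w) * noise_weight k w) w"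
    by (rule S.nn_cond_exp_prod[OF bI]) measurable
  ultimately show ?thesis using noise_weight_cond_exp[OF ge_k0[OF k]]
  proof eventually_elim
    case (elim w)
    have "cond k g w * ?I w \<le> (ennreal b * ?I w) * cond k (noise_weight k) w"
      using elim(1-3) by (simp add: mult.commute)
    also have "\<dots> \<le> ennreal b * ennreal (8 * (1 + Q))"
    proof (cases "w \<in> A k")
      case True
      have "cond k (noise_weight k) w \<le> ennreal (8 * (1 + Q))"
        using q_le[OF k True] by (intro order_trans[OF elim(4)] ennreal_leI) auto
      with True show ?thesis by (simp add: mult_left_mono)
    qed simp
    also have "\<dots> = ennreal (b * (8 * (1 + Q)))" using b by (simp add: ennreal_mult')
    finally show ?case .
  qed
qed

lemma E_cond_exp_bounded:
  "\<exists>K>0. \<forall>k\<ge>k0. AE w in P.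
     max (cond k (\<lambda>w. ennreal (norm (E k w))) w * indicator (A k) w)
         (cond k (\<lambda>w. ennreal ((norm (E k w))\<^sup>2)) w * indicator (A k) w) \<le> ennreal K"
proof -
  \<comment> \<open>On \<open>A k\<close> the factor D k + \<alpha> k is at most
    \<open>\<delta> + c\<^sub>2\<close>.\<close>
  define b where "b = max (C\<^sub>1 * (\<delta> + c\<^sub>2)) (C\<^sub>1\<^sup>2 * (\<delta> + c\<^sub>2)\<^sup>2)"
  have b: "b \<ge> 0" using const by (simp add: b_def le_max_iff_disj)
  define K where "K = b * (8 * (1 + Q)) + 1"
  have K: "K > 0" "b * (8 * (1 + Q)) \<le> K" using b const by (auto simp: K_def intro!: add_nonneg_pos)
  show ?thesis
  proof (intro exI[of _ K] conjI allI impI K(1))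
    fix k assume k: "k \<ge> k0"
    note [measurable] = E_meas[OF ge_k0[OF k]]
    have le: "ennreal X \<le> ennreal b * noise_weight k w"
      if "X \<le> y * (1 + norm (\<nu> k w)) ^ 4" "y \<le> b" for X y w
    proof -
      have "X \<le> b * (1 + norm (\<nu> k w)) ^ 4" using that(1) mult_right_mono[OF that(2), of "(1 + norm (\<nu> k w)) ^ 4"] by simp
      then show ?thesis using b unfolding noise_weight_def by (simp add: ennreal_mult'[symmetric] ennreal_leI)
    qed
    have Da: "0 \<le> D k w + \<alpha> k \<and> D k w + \<alpha> k \<le> \<delta> + c\<^sub>2" if "w \<in> A k" for w
      using D_le[OF k that] \<alpha>_bounds[OF ge_k0[OF k]] D_nonneg[of k w] by linarith
    have "AE w in P. cond k (\<lambda>w. ennreal (norm (E k w))) w * indicator (A k) w \<le> ennreal (b * (8 * (1 + Q)))"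
    proof (rule stopped_cond_exp_le[OF k _ le[OF E_le_weight(1)[OF k]] b])
      fix w assume "w \<in> A k"
      then have "C\<^sub>1 * (D k w + \<alpha> k) \<le> C\<^sub>1 * (\<delta> + c\<^sub>2)" using const Da by (intro mult_left_mono) auto
      then show "C\<^sub>1 * (D k w + \<alpha> k) \<le> b" by (simp add: b_def)
    qed measurable
    moreover have "AE w in P. cond k (\<lambda>w. ennreal ((norm (E k w))\<^sup>2)) w * indicator (A k) w \<le> ennreal (b * (8 * (1 + Q)))"
    proof (rule stopped_cond_exp_le[OF k _ le[OF E_le_weight(2)[OF k]] b])
      fix w assume "w \<in> A k"
      then have "C\<^sub>1\<^sup>2 * (D k w + \<alpha> k)\<^sup>2 \<le> C\<^sub>1\<^sup>2 * (\<delta> + c\<^sub>2)\<^sup>2" using Da by (intro mult_left_mono power_mono) auto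
      then show "C\<^sub>1\<^sup>2 * (D k w + \<alpha> k)\<^sup>2 \<le> b" by (simp add: b_def)
    qed measurable
    ultimately show "AE w in P.
       max (cond k (\<lambda>w. ennreal (norm (E k w))) w * indicator (A k) w)
           (cond k (\<lambda>w. ennreal ((norm (E k w))\<^sup>2)) w * indicator (A k) w) \<le> ennreal K"
      by eventually_elim (use ennreal_leI[OF K(2)] in \<open>auto intro: order_trans\<close>)
  qed
qed

lemma stopped_integral_le:
  assumes k: "k \<ge> k0" and g: "g \<in> borel_measurable (F k)" and g0: "\<And>w. 0 \<le> g w"
    and int: "integrable P (\<lambda>w. indicat_real (A k) w * g w)"
    and X: "\<And>w. w \<in> A k \<Longrightarrow> X w \<le> g w * (1 + norm (\<nu> k w)) ^ 4"
  shows "stopped_mean k X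
      \<le> ennreal (8 * (1 + Q) * (\<integral>w. indicat_real (A k) w * g w \<partial>P))"
proof -
  let ?g = "\<lambda>w. ennreal (indicat_real (A k) w * g w)"
  have g': "?g \<in> borel_measurable (F k)" using g ind_meas[OF ge_k0[OF k]] by measurable
  have "stopped_mean k X \<le> (\<integral>\<^sup>+w. ?g w * noise_weight k w \<partial>P)"
  proof (rule nn_integral_mono)
    fix w
    show "ennreal (X w) * indicator (A k) w \<le> ?g w * noise_weight k w"
      using X[of w] g0[of w] by (auto simp: indicator_def noise_weight_def ennreal_mult'[symmetric] intro!: ennreal_leI)
  qed
  also have "\<dots> \<le> ennreal (8 * (1 + Q)) * (\<integral>\<^sup>+w. ?g w \<partial>P)"
  proof (rule noise_weight_integral[OF ge_k0[OF k] g'])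
    fix w assume "?g w \<noteq> 0"
    then show "q (x k w) \<le> Q" by (cases "w \<in> A k") (auto intro: q_le[OF k])
  qed
  also have "(\<integral>\<^sup>+w. ?g w \<partial>P) = ennreal (\<integral>w. indicat_real (A k) w * g w \<partial>P)"
    using g0 by (intro nn_integral_eq_integral int) auto
  finally show ?thesis using const by (simp add: ennreal_mult')
qed

text \<open>\<open>d k\<close> is kept rather than replaced by its bound \<delta>, since the
  weighted and tail sums rest on the estimates for \<open>d\<close>.\<close>

lemma E_first_moment:
  assumes k: "k \<ge> k0"
  shows "stopped_mean k (\<lambda>w. norm (E k w)) \<le> ennreal (8 * (1 + Q) * C\<^sub>1 * (d k + \<alpha> k))"
proof -
  let ?I = "indicat_real (A k)"
  note ik = integrable_stopped[OF k]
  have eq: "(\<lambda>w. ?I w * (C\<^sub>1 * (D k w + \<alpha> k))) = (\<lambda>w. C\<^sub>1 * (?I w * D k w) + C\<^sub>1 * \<alpha> k * ?I w)"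
    by (auto simp: algebra_simps)
  have int: "integrable P (\<lambda>w. ?I w * (C\<^sub>1 * (D k w + \<alpha> k)))" unfolding eq using ik by auto
  have le: "stopped_mean k (\<lambda>w. norm (E k w))
      \<le> ennreal (8 * (1 + Q) * (\<integral>w. ?I w * (C\<^sub>1 * (D k w + \<alpha> k)) \<partial>P))"
  proof (rule stopped_integral_le[OF k _ _ int E_le_weight(1)[OF k]])
    show "(\<lambda>w. C\<^sub>1 * (D k w + \<alpha> k)) \<in> borel_measurable (F k)" using D_meas[OF ge_k0[OF k]] by measurable
    show "0 \<le> C\<^sub>1 * (D k w + \<alpha> k)" for w using const D_nonneg \<alpha>_bounds(1)[OF ge_k0[OF k]] by (simp add: add_nonneg_nonneg)
  qed
  have "(\<integral>w. ?I w * (C\<^sub>1 * (D k w + \<alpha> k)) \<partial>P) = C\<^sub>1 * d k + C\<^sub>1 * \<alpha> k * (\<integral>w. ?I w \<partial>P)"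
    unfolding eq d_def using ik by (subst Bochner_Integration.integral_add) auto
  also have "\<dots> \<le> C\<^sub>1 * d k + C\<^sub>1 * \<alpha> k * 1"
    using integral_indicator_le[OF k] const \<alpha>_bounds(1)[OF ge_k0[OF k]] by (intro add_left_mono mult_left_mono) auto
  finally have "8 * (1 + Q) * (\<integral>w. ?I w * (C\<^sub>1 * (D k w + \<alpha> k)) \<partial>P) \<le> 8 * (1 + Q) * (C\<^sub>1 * d k + C\<^sub>1 * \<alpha> k * 1)"
    using const by (intro mult_left_mono) auto
  also have "\<dots> = 8 * (1 + Q) * C\<^sub>1 * (d k + \<alpha> k)" by (simp add: algebra_simps)
  finally show ?thesis by (intro order_trans[OF le] ennreal_leI)
qed

text \<open>(D + \<alpha>)^2 \<le> 2 (D^2 + \<alpha>^2), and both parts are O(\<alpha>): the mean of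
  D^2 by the decay of \<open>a\<close> and the lower bound on the steps, the other because steps are
  at most \<open>c\<^sub>2\<close>.\<close>

lemma E_second_moment:
  "\<exists>K>0. \<forall>k\<ge>k0. stopped_mean k (\<lambda>w. (norm (E k w))\<^sup>2) \<le> ennreal (K * \<alpha> k)"
proof -
  obtain K where K: "K > 0" "\<And>k. k \<ge> k0 \<Longrightarrow> a k \<le> K * real k powr (-\<gamma>)"
    using moments.second_moment_decay by blast
  define K' where "K' = 8 * (1 + Q) * (2 * C\<^sub>1\<^sup>2 * (K / c\<^sub>1 + c\<^sub>2)) + 1"
  have K': "K' > 0" using const K by (auto simp: K'_def intro!: add_nonneg_pos mult_nonneg_nonneg)
  have "stopped_mean k (\<lambda>w. (norm (E k w))\<^sup>2) \<le> ennreal (K' * \<alpha> k)" if k: "k \<ge> k0" for k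
  proof -
    let ?I = "indicat_real (A k)"
    note ik = integrable_stopped[OF k] and \<alpha>k = \<alpha>_bounds[OF ge_k0[OF k]]
    let ?g = "\<lambda>w. 2 * C\<^sub>1\<^sup>2 * ((D k w)\<^sup>2 + (\<alpha> k)\<^sup>2)"
    have eq: "(\<lambda>w. ?I w * ?g w) = (\<lambda>w. 2 * C\<^sub>1\<^sup>2 * (?I w * (D k w)\<^sup>2) + 2 * C\<^sub>1\<^sup>2 * (\<alpha> k)\<^sup>2 * ?I w)"
      by (auto simp: algebra_simps)
    have int: "integrable P (\<lambda>w. ?I w * ?g w)" unfolding eq using ik by auto
    have "stopped_mean k (\<lambda>w. (norm (E k w))\<^sup>2) \<le> ennreal (8 * (1 + Q) * (\<integral>w. ?I w * ?g w \<partial>P))"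
    proof (rule stopped_integral_le[OF k _ _ int])
      show "?g \<in> borel_measurable (F k)" using D_meas[OF ge_k0[OF k]] by measurable
      fix w
      show "0 \<le> ?g w" by simp
      assume w: "w \<in> A k"
      have "(D k w + \<alpha> k)\<^sup>2 \<le> 2 * ((D k w)\<^sup>2 + (\<alpha> k)\<^sup>2)"
        using sum_squares_bound[of "D k w" "\<alpha> k"] by (simp add: power2_sum)
      then have "C\<^sub>1\<^sup>2 * (D k w + \<alpha> k)\<^sup>2 \<le> C\<^sub>1\<^sup>2 * (2 * ((D k w)\<^sup>2 + (\<alpha> k)\<^sup>2))" by (intro mult_left_mono) auto
      then have "C\<^sub>1\<^sup>2 * (D k w + \<alpha> k)\<^sup>2 \<le> ?g w" by (simp only: mult_ac)
      then have "C\<^sub>1\<^sup>2 * (D k w + \<alpha> k)\<^sup>2 * (1 + norm (\<nu> k w)) ^ 4 \<le> ?g w * (1 + norm (\<nu> k w)) ^ 4"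
        by (intro mult_right_mono) auto
      then show "(norm (E k w))\<^sup>2 \<le> ?g w * (1 + norm (\<nu> k w)) ^ 4"
        using E_le_weight(2)[OF k w] by linarith
    qed
    also have "(\<integral>w. ?I w * ?g w \<partial>P) = 2 * C\<^sub>1\<^sup>2 * a k + 2 * C\<^sub>1\<^sup>2 * (\<alpha> k)\<^sup>2 * (\<integral>w. ?I w \<partial>P)"
      unfolding eq a_def using ik by (subst Bochner_Integration.integral_add) auto
    finally have 1: "stopped_mean k (\<lambda>w. (norm (E k w))\<^sup>2)
        \<le> ennreal (8 * (1 + Q) * (2 * C\<^sub>1\<^sup>2 * a k + 2 * C\<^sub>1\<^sup>2 * (\<alpha> k)\<^sup>2 * (\<integral>w. ?I w \<partial>P)))" .
    have "a k \<le> K / c\<^sub>1 * \<alpha> k"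
    proof -
      have "K / c\<^sub>1 * (c\<^sub>1 * real k powr (-\<gamma>)) \<le> K / c\<^sub>1 * \<alpha> k"
        using step[OF ge_k0[OF k]] K(1) const by (intro mult_left_mono) auto
      then show ?thesis using K(2)[OF k] const by simp
    qed
    moreover have "(\<alpha> k)\<^sup>2 * (\<integral>w. ?I w \<partial>P) \<le> c\<^sub>2 * \<alpha> k"
    proof -
      have "(\<alpha> k)\<^sup>2 * (\<integral>w. ?I w \<partial>P) \<le> (\<alpha> k)\<^sup>2 * 1" using integral_indicator_le[OF k] by (intro mult_left_mono) auto
      also have "\<dots> \<le> c\<^sub>2 * \<alpha> k" using \<alpha>k by (simp add: power2_eq_square mult_right_mono)
      finally show ?thesis .
    qed
    ultimately have "a k + (\<alpha> k)\<^sup>2 * (\<integral>w. ?I w \<partial>P) \<le> (K / c\<^sub>1 + c\<^sub>2) * \<alpha> k" by (simp add: distrib_right)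
    then have "2 * C\<^sub>1\<^sup>2 * (a k + (\<alpha> k)\<^sup>2 * (\<integral>w. ?I w \<partial>P)) \<le> 2 * C\<^sub>1\<^sup>2 * ((K / c\<^sub>1 + c\<^sub>2) * \<alpha> k)"
      by (intro mult_left_mono) auto
    then have "8 * (1 + Q) * (2 * C\<^sub>1\<^sup>2 * (a k + (\<alpha> k)\<^sup>2 * (\<integral>w. ?I w \<partial>P))) \<le> 8 * (1 + Q) * (2 * C\<^sub>1\<^sup>2 * ((K / c\<^sub>1 + c\<^sub>2) * \<alpha> k))"
      by (rule mult_left_mono) (use const in auto)
    also have "\<dots> \<le> K' * \<alpha> k" using \<alpha>k by (simp add: K'_def algebra_simps)
    finally have "8 * (1 + Q) * (2 * C\<^sub>1\<^sup>2 * a k + 2 * C\<^sub>1\<^sup>2 * (\<alpha> k)\<^sup>2 * (\<integral>w. ?I w \<partial>P)) \<le> K' * \<alpha> k"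
      by (simp only: distrib_left mult.assoc)
    then show ?thesis by (intro order_trans[OF 1] ennreal_leI)
  qed
  then show ?thesis using K' by blast
qed


lemma \<alpha>_weight_summable:
  "summable (\<lambda>i. weight (k0 + i) * \<alpha> (k0 + i))"
proof -
  have "summable (\<lambda>i. c\<^sub>2 * (1 / (real (k0 + i) * (ln (real (k0 + i) + 1))\<^sup>2)))"
    unfolding add.commute[of k0]
    by (intro summable_mult summable_ignore_initial_segment[OF summable_inverse_ln_squared])
  then show ?thesis
  proof (rule summable_comparison_test'[where N = 0])
    fix i
    let ?k = "k0 + i"
    have k: "?k \<ge> 1" using k0 by simp
    have "real ?k powr (\<gamma> - 1) * \<alpha> ?k \<le> real ?k powr (\<gamma> - 1) * (c\<^sub>2 * real ?k powr (-\<gamma>))"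
      using step[OF k] by (intro mult_left_mono) auto
    also have "\<dots> = c\<^sub>2 * (real ?k powr (\<gamma> - 1) * real ?k powr (-\<gamma>))" by simp
    also have "real ?k powr (\<gamma> - 1) * real ?k powr (-\<gamma>) = 1 / real ?k"
      using k by (simp only: powr_add[symmetric]) (simp add: powr_minus divide_inverse)
    finally have "real ?k powr (\<gamma> - 1) * \<alpha> ?k / (ln (real ?k + 1))\<^sup>2 \<le> c\<^sub>2 * (1 / real ?k) / (ln (real ?k + 1))\<^sup>2"
      by (intro divide_right_mono) auto
    then show "norm (weight ?k * \<alpha> ?k) \<le> c\<^sub>2 * (1 / (real ?k * (ln (real ?k + 1))\<^sup>2))"
      using \<alpha>_bounds[OF k] by (simp add: abs_mult)
  qed
qed

text \<open>A random variable and its conditional expectation have the same mean over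
  \<open>A k\<close>, so estimating the maximum by the sum costs only a factor 2. A finite expected
  tail then makes the tail finite almost surely.\<close>

lemma weighted_sum_finite:
  fixes g :: "nat \<Rightarrow> 'w \<Rightarrow> ennreal"
  assumes meas: "\<And>k. k \<ge> 1 \<Longrightarrow> g k \<in> borel_measurable P"
    and g: "\<And>k w. k \<ge> 1 \<Longrightarrow> w \<in> space P \<Longrightarrow> g k w < \<infinity>"
    and gc: "\<And>k. k \<ge> 1 \<Longrightarrow> AE w in P. cond k (g k) w < \<infinity>"
    and e0: "\<And>k. e k \<ge> 0"
    and e: "\<And>k. k \<ge> k0 \<Longrightarrow> (\<integral>\<^sup>+w. g k w * indicator (A k) w \<partial>P) \<le> ennreal (e k)"
    and sum: "summable (\<lambda>i. weight (k0 + i) * e (k0 + i))"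
  shows "AE w in P. (\<Sum>i. let k = Suc i in
            ennreal (weight k) *
            max (g k w * indicator (A k) w) (cond k (g k) w * indicator (A k) w)) < \<infinity>"
proof -
  define wt where "wt k = weight k" for k :: nat
  have wt0: "wt k \<ge> 0" for k by (simp add: wt_def)
  define f where "f k w = ennreal (wt k) * max (g k w * indicator (A k) w) (cond k (g k) w * indicator (A k) w)"
    for k w
  have f_meas: "f k \<in> borel_measurable P" if k: "k \<ge> 1" for k
  proof -
    note [measurable] = meas[OF k] F_sets_P[OF k A_sets[OF k]]
    show ?thesis unfolding f_def by measurable
  qed
  have f_fin: "AE w in P. f k w < \<infinity>" if k: "k \<ge> 1" for k
    using gc[OF k] AE_space
  proof eventually_elim
    case (elim w)
    have "max (g k w * indicator (A k) w) (cond k (g k) w * indicator (A k) w) < \<infinity>"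
      using elim(1) g[OF k elim(2)] by (auto simp: indicator_def)
    then show ?case by (simp add: f_def ennreal_mult_less_top)
  qed
  have f_int: "(\<integral>\<^sup>+w. f k w \<partial>P) \<le> ennreal (2 * (wt k * e k))" if k: "k \<ge> k0" for k
  proof -
    interpret S: sigma_finite_subalgebra P "F k" by (rule sigma_finite_F[OF ge_k0[OF k]])
    let ?I = "indicator (A k) :: 'w \<Rightarrow> ennreal"
    have I: "?I \<in> borel_measurable (F k)" using A_sets[OF ge_k0[OF k]] by measurable
    note [measurable] = meas[OF ge_k0[OF k]] F_imp_P[OF ge_k0[OF k] I]
    have "(\<integral>\<^sup>+w. f k w \<partial>P) \<le> (\<integral>\<^sup>+w. ennreal (wt k) * (?I w * g k w + ?I w * cond k (g k) w) \<partial>P)"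
      unfolding f_def by (intro nn_integral_mono mult_left_mono) (auto simp: indicator_def)
    also have "\<dots> = ennreal (wt k) * ((\<integral>\<^sup>+w. ?I w * g k w \<partial>P) + (\<integral>\<^sup>+w. ?I w * cond k (g k) w \<partial>P))"
      by (subst nn_integral_cmult, measurable) (subst nn_integral_add, measurable)
    also have "(\<integral>\<^sup>+w. ?I w * cond k (g k) w \<partial>P) = (\<integral>\<^sup>+w. ?I w * g k w \<partial>P)"
      by (rule S.nn_cond_exp_intg[OF I]) measurable
    also have "(\<integral>\<^sup>+w. ?I w * g k w \<partial>P) = (\<integral>\<^sup>+w. g k w * ?I w \<partial>P)" by (simp add: mult.commute)
    also have "ennreal (wt k) * ((\<integral>\<^sup>+w. g k w * ?I w \<partial>P) + (\<integral>\<^sup>+w. g k w * ?I w \<partial>P))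
        \<le> ennreal (wt k) * (ennreal (e k) + ennreal (e k))"
      by (intro mult_left_mono add_mono e k) auto
    also have "\<dots> = ennreal (2 * (wt k * e k))"
      using e0 wt0 by (simp add: ennreal_plus[symmetric] ennreal_mult'[symmetric] del: ennreal_plus)
    finally show ?thesis .
  qed
  have "AE w in P. (\<Sum>i. f (Suc i) w) < \<infinity>"
  \<comment> \<open>Terms are indexed by \<open>Suc i\<close>, so dropping k0 - 1 of them starts the
    sum at \<open>k0\<close>.\<close>
  proof (rule AE_suminf_finite[where n = "k0 - 1"])
    have idx: "Suc (i + (k0 - 1)) = k0 + i" for i using k0 by simp
    have "summable (\<lambda>i. 2 * (wt (k0 + i) * e (k0 + i)))" using sum unfolding wt_def by (rule summable_mult)
    then have "(\<Sum>i. ennreal (2 * (wt (k0 + i) * e (k0 + i)))) < \<infinity>"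
      using wt0 e0 by (subst suminf_ennreal2) auto
    moreover have "(\<Sum>i. \<integral>\<^sup>+w. f (Suc (i + (k0 - 1))) w \<partial>P) \<le> (\<Sum>i. ennreal (2 * (wt (k0 + i) * e (k0 + i))))"
      unfolding idx by (intro suminf_le f_int) auto
    ultimately show "(\<Sum>i. \<integral>\<^sup>+w. f (Suc (i + (k0 - 1))) w \<partial>P) < \<infinity>" by (rule le_less_trans[rotated])
  qed (use f_meas f_fin in simp_all)
  then show ?thesis unfolding f_def wt_def Let_def .
qed

lemma E_weighted_sums_finite:
  "AE w in P. (\<Sum>i. let k = Suc i in
      ennreal (weight k) *
      max (ennreal (norm (E k w)) * indicator (A k) w)
          (cond k (\<lambda>w. ennreal (norm (E k w))) w * indicator (A k) w)) < \<infinity>" (is ?first)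
  "AE w in P. (\<Sum>i. let k = Suc i in
      ennreal (weight k) *
      max (ennreal ((norm (E k w))\<^sup>2) * indicator (A k) w)
          (cond k (\<lambda>w. ennreal ((norm (E k w))\<^sup>2)) w * indicator (A k) w)) < \<infinity>" (is ?second)
proof -
  have growth: "ennreal (norm (E k w)) \<le> ennreal \<bar>c k\<bar> * noise_weight k w"
    "ennreal ((norm (E k w))\<^sup>2) \<le> ennreal ((c k)\<^sup>2) * noise_weight k w"
    if k: "k \<ge> 1" and w: "w \<in> space P" for k w
  proof -
    let ?n = "1 + norm (\<nu> k w)"
    have n: "?n ^ 1 \<le> ?n ^ 4" "?n\<^sup>2 \<le> ?n ^ 4" by (intro power_increasing; simp)+
    have "norm (E k w) \<le> \<bar>c k\<bar> * ?n"
      using E_growth[OF k w] mult_right_mono[OF abs_ge_self[of "c k"], of ?n] by simp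
    also have "\<dots> \<le> \<bar>c k\<bar> * ?n ^ 4" using n(1) by (intro mult_left_mono) auto
    finally show "ennreal (norm (E k w)) \<le> ennreal \<bar>c k\<bar> * noise_weight k w"
      unfolding noise_weight_def by (simp add: ennreal_mult'[symmetric])
    have "(norm (E k w))\<^sup>2 \<le> (c k * ?n)\<^sup>2" using E_growth[OF k w] by (intro power_mono) auto
    also have "\<dots> \<le> (c k)\<^sup>2 * ?n ^ 4" unfolding power_mult_distrib by (intro mult_left_mono n) auto
    finally show "ennreal ((norm (E k w))\<^sup>2) \<le> ennreal ((c k)\<^sup>2) * noise_weight k w"
      unfolding noise_weight_def by (simp add: ennreal_mult'[symmetric])
  qed
  have m1: "(\<lambda>w. ennreal (norm (E k w))) \<in> borel_measurable P"
    and m2: "(\<lambda>w. ennreal ((norm (E k w))\<^sup>2)) \<in> borel_measurable P" if "k \<ge> 1" for k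
    using E_meas[OF that] by measurable
  show ?first
  \<comment> \<open>The absolute value makes the bound nonnegative at every index, also at 0, where
    nothing is known about \<alpha>.\<close>
  proof (rule weighted_sum_finite[where e = "\<lambda>k. \<bar>8 * (1 + Q) * C\<^sub>1 * (d k + \<alpha> k)\<bar>", OF m1])
    fix k
    assume "k \<ge> k0"
    then show "stopped_mean k (\<lambda>w. norm (E k w)) \<le> ennreal \<bar>8 * (1 + Q) * C\<^sub>1 * (d k + \<alpha> k)\<bar>"
      by (intro order_trans[OF E_first_moment] ennreal_leI abs_ge_self)
  next
    have "summable (\<lambda>i. 8 * (1 + Q) * C\<^sub>1 * (weight (k0 + i) * d (k0 + i) + weight (k0 + i) * \<alpha> (k0 + i)))"
      by (intro summable_mult summable_add moments.weighted_first_moment_summable \<alpha>_weight_summable)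
    moreover have "8 * (1 + Q) * C\<^sub>1 * (weight (k0 + i) * d (k0 + i) + weight (k0 + i) * \<alpha> (k0 + i)) =
       weight (k0 + i) * \<bar>8 * (1 + Q) * C\<^sub>1 * (d (k0 + i) + \<alpha> (k0 + i))\<bar>" for i
    proof -
      have "0 \<le> 8 * (1 + Q) * C\<^sub>1 * (d (k0 + i) + \<alpha> (k0 + i))"
        using const moments.nonneg(2) \<alpha>_bounds(1)[of "k0 + i"] k0 by (intro mult_nonneg_nonneg add_nonneg_nonneg) auto
      then show ?thesis by (simp only: abs_of_nonneg distrib_left mult_ac)
    qed
    ultimately show "summable (\<lambda>i. weight (k0 + i) *
        \<bar>8 * (1 + Q) * C\<^sub>1 * (d (k0 + i) + \<alpha> (k0 + i))\<bar>)" by (simp only:)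
  qed (auto intro: noise_weight_cond_exp_finite[OF _ m1 growth(1), simplified])
  obtain K where K: "K > 0" "\<And>k. k \<ge> k0 \<Longrightarrow>
      stopped_mean k (\<lambda>w. (norm (E k w))\<^sup>2) \<le> ennreal (K * \<alpha> k)"
    using E_second_moment by blast
  show ?second
  proof (rule weighted_sum_finite[where e = "\<lambda>k. \<bar>K * \<alpha> k\<bar>", OF m2])
    fix k
    assume "k \<ge> k0"
    then show "stopped_mean k (\<lambda>w. (norm (E k w))\<^sup>2) \<le> ennreal \<bar>K * \<alpha> k\<bar>"
      by (intro order_trans[OF K(2)] ennreal_leI abs_ge_self)
  next
    have "summable (\<lambda>i. K * (weight (k0 + i) * \<alpha> (k0 + i)))"
      by (intro summable_mult \<alpha>_weight_summable)
    moreover have "K * (weight (k0 + i) * \<alpha> (k0 + i)) =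
       weight (k0 + i) * \<bar>K * \<alpha> (k0 + i)\<bar>" for i
      using K(1) \<alpha>_bounds(1)[of "k0 + i"] k0 by (simp add: abs_mult)
    ultimately show "summable (\<lambda>i. weight (k0 + i) * \<bar>K * \<alpha> (k0 + i)\<bar>)"
      by (simp only:)
  qed (auto intro: noise_weight_cond_exp_finite[OF _ m2 growth(2), simplified])
qed

lemma E_expectation_finite:
  assumes k: "k \<ge> 1"
  shows "(\<integral>\<^sup>+w. ennreal (norm (E k w)) \<partial>P) < \<infinity>"
proof -
  have "(\<integral>\<^sup>+w. ennreal (norm (E k w)) \<partial>P) \<le> (\<integral>\<^sup>+w. ennreal (norm (c k * (1 + norm (\<nu> k w)))) \<partial>P)"
    using E_growth[OF k] by (intro nn_integral_mono ennreal_leI) (auto intro: order_trans abs_ge_self)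
  also have "\<dots> < \<infinity>"
  proof -
    have "integrable P (\<lambda>w. c k * (1 + norm (\<nu> k w)))" using noise_integrable[OF k] by auto
    then show ?thesis by (simp only: integrable_iff_bounded)
  qed
  finally show ?thesis .
qed

text \<open>From \<open>k0\<close> on this is the tail bound for \<open>d\<close> plus a multiple of
  the squared steps. The finitely many earlier terms have finite mean and are absorbed into the
  constant.\<close>

lemma E_tail:
  "\<exists>K>0. \<forall>k\<ge>1. (\<Sum>i. ennreal (\<alpha> (k + i)) * stopped_mean (k + i) (\<lambda>w. norm (E (k + i) w)))
      \<le> ennreal K * (\<Sum>i. ennreal ((\<alpha> (k + i))\<^sup>2))"
  (is "\<exists>K>0. \<forall>k\<ge>1. ?lhs k \<le> ennreal K * ?rhs k")
proof -
  define e where "e k = stopped_mean k (\<lambda>w. norm (E k w))" for k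
  \<comment> \<open>Setting \<open>d\<close> to 0 before \<open>k0\<close> extends the tail
    inequality to all starting indices: the left side gains nothing, the right side only
    grows.\<close>
  define d' where "d' k = (if k0 \<le> k then d k else 0)" for k
  obtain K where "0 < K \<and> (\<forall>k\<ge>k0.
      (\<Sum>i. ennreal (\<alpha> (k + i) * d (k + i))) \<le> ennreal K * ?rhs k)"
    by (rule exE[OF moments.first_moment_tail])
  note K = conjunct1[OF this] conjunct2[OF this, rule_format]
  have K0: "(\<Sum>i. ennreal (\<alpha> (k + i) * d' (k + i))) \<le> ennreal K * ?rhs k"
    if k: "k \<ge> k0" for k
  proof -
    have "d' (k + i) = d (k + i)" for i using k by (simp add: d'_def)
    then show ?thesis using K(2)[OF k] by (simp only:)
  qed
  have K': "(\<Sum>i. ennreal (\<alpha> (k + i) * d' (k + i))) \<le> ennreal K * ?rhs k" for k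
  proof (cases "k \<ge> k0")
    case True
    then show ?thesis by (rule K0)
  next
    case False
    define n where "n = k0 - k"
    have n: "k + (i + n) = k0 + i" for i using False by (simp add: n_def)
    have shift: "(\<Sum>i. f (k + i)) = (\<Sum>i. f (k0 + i)) + (\<Sum>i<n. f (k + i))" for f :: "nat \<Rightarrow> ennreal"
      using suminf_offset[of "\<lambda>i. f (k + i)" n] unfolding n by simp
    have "(\<Sum>i. ennreal (\<alpha> (k + i) * d' (k + i)))
        = (\<Sum>i. ennreal (\<alpha> (k0 + i) * d' (k0 + i))) + (\<Sum>i<n. ennreal (\<alpha> (k + i) * d' (k + i)))"
      by (rule shift)
    also have "(\<Sum>i<n. ennreal (\<alpha> (k + i) * d' (k + i))) = 0"
      by (intro sum.neutral) (auto simp: d'_def n_def)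
    also have "(\<Sum>i. ennreal (\<alpha> (k0 + i) * d' (k0 + i))) + 0 \<le> ennreal K * ?rhs k0"
      unfolding add_0_right by (rule K0[OF order_refl])
    also have "\<dots> \<le> ennreal K * ?rhs k"
      unfolding shift[of "\<lambda>j. ennreal ((\<alpha> j)\<^sup>2)"] by (intro mult_left_mono) auto
    finally show ?thesis .
  qed
  define R where "R = 8 * (1 + Q) * C\<^sub>1"
  \<comment> \<open>For each j before \<open>k0\<close>, e j \<le> S \<alpha> j, so its contribution
    \<alpha> j e j is at most S times the squared step.\<close>
  define S where "S = (\<Sum>j\<in>{1..k0}. enn2real (e j) / \<alpha> j)"
  have R: "R \<ge> 0" using const by (simp add: R_def)
  have S: "S \<ge> 0" unfolding S_def using \<alpha>_bounds(1) by (intro sum_nonneg divide_nonneg_pos) auto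
  have e_le: "e k \<le> ennreal (R * d' k + (R + S) * \<alpha> k)" if k: "k \<ge> 1" for k
  proof (cases "k \<ge> k0")
    case True
    have "e k \<le> ennreal (R * (d k + \<alpha> k))" unfolding e_def R_def by (rule E_first_moment[OF True])
    also have "R * (d k + \<alpha> k) \<le> R * d' k + (R + S) * \<alpha> k"
      using True S \<alpha>_bounds(1)[OF k] by (simp add: d'_def algebra_simps)
    finally show ?thesis by (simp add: ennreal_leI)
  next
    case False
    have "e k \<le> (\<integral>\<^sup>+w. ennreal (norm (E k w)) \<partial>P)" unfolding e_def by (intro nn_integral_mono) (auto simp: indicator_def)
    also have "\<dots> < \<infinity>" by (rule E_expectation_finite[OF k])
    finally have "e k = ennreal (enn2real (e k))" by (simp add: less_top)
    moreover have "enn2real (e k) / \<alpha> k \<le> S"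
      unfolding S_def using False k \<alpha>_bounds(1)
      by (intro member_le_sum) (auto intro!: divide_nonneg_pos)
    then have "enn2real (e k) \<le> S * \<alpha> k" using \<alpha>_bounds(1)[OF k] by (simp add: field_simps)
    then have "enn2real (e k) \<le> R * d' k + (R + S) * \<alpha> k"
      using False R \<alpha>_bounds(1)[OF k] by (simp add: d'_def algebra_simps add_increasing)
    ultimately show ?thesis by (metis ennreal_leI)
  qed
  show ?thesis
  proof (intro exI[of _ "R * K + (R + S) + 1"] conjI allI impI)
    show "R * K + (R + S) + 1 > 0" using R S K by (simp add: add_nonneg_pos)
    fix k :: nat assume k: "k \<ge> 1"
    have "(\<Sum>i. ennreal (\<alpha> (k + i)) * e (k + i))
        \<le> (\<Sum>i. ennreal R * ennreal (\<alpha> (k + i) * d' (k + i)) + ennreal (R + S) * ennreal ((\<alpha> (k + i))\<^sup>2))"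
    proof (intro suminf_le allI)
      fix i
      have ki: "k + i \<ge> 1" using k by simp
      have d'0: "d' (k + i) \<ge> 0" using moments.nonneg(2) by (simp add: d'_def)
      note a0 = less_imp_le[OF \<alpha>_bounds(1)[OF ki]]
      have "ennreal (\<alpha> (k + i)) * e (k + i) \<le> ennreal (\<alpha> (k + i)) * ennreal (R * d' (k + i) + (R + S) * \<alpha> (k + i))"
        by (intro mult_left_mono e_le[OF ki]) auto
      also have "\<dots> = ennreal (R * (\<alpha> (k + i) * d' (k + i)) + (R + S) * (\<alpha> (k + i))\<^sup>2)"
        using a0 by (simp add: ennreal_mult'[symmetric] algebra_simps power2_eq_square)
      also have "\<dots> = ennreal R * ennreal (\<alpha> (k + i) * d' (k + i)) + ennreal (R + S) * ennreal ((\<alpha> (k + i))\<^sup>2)"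
        using R S a0 d'0 by (simp only: ennreal_mult'[symmetric] ennreal_plus[symmetric]
            mult_nonneg_nonneg add_nonneg_nonneg zero_le_power2)
      finally show "ennreal (\<alpha> (k + i)) * e (k + i)
        \<le> ennreal R * ennreal (\<alpha> (k + i) * d' (k + i)) + ennreal (R + S) * ennreal ((\<alpha> (k + i))\<^sup>2)" .
    qed auto
    also have "\<dots> = ennreal R * (\<Sum>i. ennreal (\<alpha> (k + i) * d' (k + i))) + ennreal (R + S) * ?rhs k"
      by (simp add: suminf_add[symmetric])
    also have "\<dots> \<le> ennreal R * (ennreal K * ?rhs k) + ennreal (R + S) * ?rhs k"
      by (intro add_mono mult_left_mono K') auto
    also have "\<dots> = ennreal (R * K + (R + S)) * ?rhs k"
      using R K S by (simp add: ennreal_plus ennreal_mult' distrib_right mult.assoc)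
    also have "\<dots> \<le> ennreal (R * K + (R + S) + 1) * ?rhs k" by (intro mult_right_mono ennreal_leI) auto
    finally show "?lhs k \<le> ennreal (R * K + (R + S) + 1) * ?rhs k" unfolding e_def .
  qed
qed

end

section \<open>The shadow sequence\<close>

text \<open>Moves the projection from the noise to a basis vector, where it becomes a bounded factor
  known at time k.\<close>

lemma closest_point_subspace_self_adjoint:
  fixes S :: "'a::euclidean_space set"
  assumes S: "subspace S"
  shows "closest_point S u \<bullet> w = u \<bullet> closest_point S w"
proof -
  have "(u - closest_point S u) \<bullet> closest_point S w = 0"
    by (rule closest_point_subspace_orth[OF S closest_point_subspace_in[OF S]])
  moreover have "(w - closest_point S w) \<bullet> closest_point S u = 0"
    by (rule closest_point_subspace_orth[OF S closest_point_subspace_in[OF S]])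
  ultimately show ?thesis by (simp add: inner_diff_left) (metis inner_commute)
qed

text \<open>Assumption A on a single ball, with the o-term of (A3) replaced by a linear function of
  slope \<epsilon>. The bounds on \<rho> are those under which nearest points expand to second
  order.\<close>

locale active_patch = manifold_patch M xbar r L for M :: "'a::euclidean_space set" and xbar r L +
  fixes f :: "'a \<Rightarrow> ereal" and G :: "real \<Rightarrow> 'a \<Rightarrow> 'a \<Rightarrow> 'a" and \<rho> \<mu> C \<epsilon> B :: real
  assumes \<rho>: "0 < \<rho>" "4 * \<rho> \<le> r" "10 * L * \<rho> \<le> 1" and C: "C > 0"
    and cov_grad_cont: "continuous_on (M \<inter> cball xbar r) (cov_grad f M)"
    and cov_grad_tangent: "y \<in> M \<inter> cball xbar r \<Longrightarrow> cov_grad f M y \<in> tangent_space M y"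
    and cov_grad_bounded: "y \<in> M \<inter> cball xbar r \<Longrightarrow> norm (cov_grad f M y) \<le> B"
    and A1: "x \<in> cball xbar \<rho> \<inter> edom f \<Longrightarrow> a > 0 \<Longrightarrow> norm (G a x v) \<le> C * (1 + norm v)"
    and A2: "x \<in> cball xbar \<rho> \<inter> edom f \<Longrightarrow> a > 0 \<Longrightarrow>
        norm (tangent_proj M (closest_point M x) (G a x v - cov_grad f M (closest_point M x) - v))
             \<le> C * (1 + norm v)\<^sup>2 * (infdist x M + a)"
    and A3: "x \<in> cball xbar \<rho> \<inter> edom f \<Longrightarrow> a > 0 \<Longrightarrow>
        (G a x v - v) \<bullet> (x - closest_point M x)
             \<ge> \<mu> * infdist x M - (1 + norm v)\<^sup>2 * (\<epsilon> * infdist x M + C * a)"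
begin

lemma \<rho>2: "2 * \<rho> \<le> r"
  using \<rho> by simp

definition retract :: "real \<Rightarrow> 'a \<Rightarrow> 'a" where
  "retract \<delta> x = (if x \<in> cball xbar (2 * \<delta>) then closest_point M x else xbar)"

lemma retract_in:
  assumes \<delta>: "0 < \<delta>" "2 * \<delta> \<le> \<rho>"
  shows "retract \<delta> x \<in> M \<inter> cball xbar (4 * \<delta>)"
proof (cases "x \<in> cball xbar (2 * \<delta>)")
  case True
  then have x: "x \<in> cball xbar \<rho>" using \<delta> by auto
  from closest_point_M(1,3)[OF x \<rho>2] True show ?thesis by (auto simp: retract_def)
qed (use xbar \<delta> in \<open>auto simp: retract_def\<close>)

lemma retract_in_patch:
  assumes "0 < \<delta>" "2 * \<delta> \<le> \<rho>"
  shows "retract \<delta> x \<in> M \<inter> cball xbar r"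
  using retract_in[OF assms, of x] assms \<rho> by auto

text \<open>The new distance is at most the distance to the old nearest point. Expanding that square
  leaves the inner product bounded by (A3) and the squared step bounded by (A1).\<close>

lemma distance_descent:
  assumes x: "x \<in> cball xbar \<rho> \<inter> edom f" and a: "a > 0"
  shows "(infdist (x - a *\<^sub>R G a x v) M)\<^sup>2 \<le> (infdist x M)\<^sup>2
     - 2 * a * (\<mu> * infdist x M - (1 + norm v)\<^sup>2 * (\<epsilon> * infdist x M + C * a) + v \<bullet> (x - closest_point M x))
     + a\<^sup>2 * (C * (1 + norm v))\<^sup>2"
proof -
  let ?p = "closest_point M x" and ?g = "G a x v"
  from x have x': "x \<in> cball xbar \<rho>" by auto
  note cp = closest_point_M[OF x' \<rho>2]
  have "(infdist (x - a *\<^sub>R ?g) M)\<^sup>2 \<le> (norm ((x - ?p) - a *\<^sub>R ?g))\<^sup>2"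
    using infdist_le[OF cp(1), of "x - a *\<^sub>R ?g"]
    by (intro power_mono) (auto simp: infdist_nonneg dist_norm algebra_simps)
  also have "\<dots> = (norm (x - ?p))\<^sup>2 - 2 * a * (?g \<bullet> (x - ?p)) + a\<^sup>2 * (norm ?g)\<^sup>2"
    unfolding power2_norm_eq_inner
    by (simp add: inner_diff_left inner_diff_right inner_commute power2_eq_square algebra_simps)
  also have "norm (x - ?p) = infdist x M" using cp(2) by (simp add: dist_norm)
  finally have 1: "(infdist (x - a *\<^sub>R ?g) M)\<^sup>2 \<le>
      (infdist x M)\<^sup>2 - 2 * a * (?g \<bullet> (x - ?p)) + a\<^sup>2 * (norm ?g)\<^sup>2" .
  have 2: "a\<^sup>2 * (norm ?g)\<^sup>2 \<le> a\<^sup>2 * (C * (1 + norm v))\<^sup>2"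
    using A1[OF x a] by (intro mult_left_mono power_mono) auto
  have "2 * a * (\<mu> * infdist x M
      - (1 + norm v)\<^sup>2 * (\<epsilon> * infdist x M + C * a) + v \<bullet> (x - ?p)) \<le> 2 * a * (?g \<bullet> (x - ?p))"
    using A3[OF x a, of v] a by (intro mult_left_mono) (auto simp: inner_diff_left)
  with 1 2 show ?thesis by linarith
qed

text \<open>The shadow recursion solved for its error term. The recursion thus holds at every
  outcome, before and after the exit time, and all content lies in the bounds.\<close>

definition shadow_error :: "real \<Rightarrow> real \<Rightarrow> 'a \<Rightarrow> 'a \<Rightarrow> 'a \<Rightarrow> 'a" where
  "shadow_error \<delta> a x x' v = (retract \<delta> x' - retract \<delta> x) /\<^sub>R a
     + cov_grad f M (retract \<delta> x) + tangent_proj M (retract \<delta> x) v"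

text \<open>If the next point stays in the ball of radius 2 \<delta>, the expansion of nearest
  points bounds the second-order part and (A2) the tangential rest. Otherwise the shadow jumps to
  \<open>xbar\<close>, and a displacement of fixed size divided by \<open>a\<close> has to be shown
  to be of order \<open>a\<close>.\<close>

lemma shadow_error_bound:
  assumes \<delta>: "0 < \<delta>" "2 * \<delta> \<le> \<rho>" and x: "x \<in> cball xbar \<delta> \<inter> edom f" and a: "a > 0"
  shows "norm (shadow_error \<delta> a x (x - a *\<^sub>R G a x v) v)
    \<le> (6 * L * C\<^sup>2 + 6 * L * C + C + (2 * C\<^sup>2 + (B + 1) * C) / \<delta>) * (1 + norm v)\<^sup>2 * (infdist x M + a)"
proof -
  let ?x' = "x - a *\<^sub>R G a x v" and ?p = "closest_point M x"
  let ?n = "1 + norm v" and ?D = "infdist x M"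
  define s where "s = norm (?x' - x)"
  have x\<rho>: "x \<in> cball xbar \<rho> \<inter> edom f" and x2: "x \<in> cball xbar (2 * \<delta>)" using x \<delta> by auto
  then have x\<rho>': "x \<in> cball xbar \<rho>" by simp
  have rx: "retract \<delta> x = ?p" using x2 by (simp add: retract_def)
  note pin = retract_in_patch[OF \<delta>, of x, unfolded rx]
  note sub = subspace_tangent[OF pin]
  note lin = linear_closest_point_subspace[OF sub]
  have D0: "?D \<ge> 0" by (rule infdist_nonneg)
  have B0: "B \<ge> 0" using cov_grad_bounded[OF pin] by (meson norm_ge_zero order_trans)
  have n: "1 \<le> ?n" "?n \<le> ?n\<^sup>2" using self_le_power[of ?n 2] by auto
  have s: "s \<le> a * (C * ?n)" using A1[OF x\<rho> a, of v] a by (simp add: s_def)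
  have s0: "s \<ge> 0" by (simp add: s_def)
  have c1: "6 * L * C\<^sup>2 + 6 * L * C + C \<ge> 0" and c2: "(2 * C\<^sup>2 + (B + 1) * C) / \<delta> \<ge> 0"
    using L_nonneg C B0 \<delta> by auto
  have nDa: "0 \<le> ?n\<^sup>2 * (?D + a)" using D0 a by simp
  show ?thesis
  proof (cases "?x' \<in> cball xbar (2 * \<delta>)")
    case True
    then have x'\<rho>: "?x' \<in> cball xbar \<rho>" using \<delta> by auto
    have rx': "retract \<delta> ?x' = closest_point M ?x'" using True by (simp add: retract_def)
    define R where "R = closest_point M ?x' - ?p - tangent_proj M ?p (?x' - x)"
    have "norm R \<le> 6 * L * (s\<^sup>2 + ?D * s)"
      unfolding R_def s_def by (rule closest_point_expansion(2)[OF x\<rho>' x'\<rho> \<rho>(2,3)])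
    also have "\<dots> \<le> 6 * L * ((a * (C * ?n))\<^sup>2 + ?D * (a * (C * ?n)))"
      using L_nonneg s s0 D0 by (intro mult_left_mono add_mono power_mono) auto
    finally have "norm R / a \<le> 6 * L * ((a * (C * ?n))\<^sup>2 + ?D * (a * (C * ?n))) / a"
      using a by (intro divide_right_mono) auto
    also have "\<dots> = 6 * L * C\<^sup>2 * (?n\<^sup>2 * a) + 6 * L * C * (?n * ?D)"
      using a by (simp add: power2_eq_square field_simps)
    also have "\<dots> \<le> 6 * L * C\<^sup>2 * (?n\<^sup>2 * (?D + a)) + 6 * L * C * (?n\<^sup>2 * (?D + a))"
      using L_nonneg C D0 a n by (intro add_mono mult_left_mono mult_mono) auto
    finally have R: "norm (R /\<^sub>R a) \<le> (6 * L * C\<^sup>2 + 6 * L * C) * (?n\<^sup>2 * (?D + a))"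
      using a by (simp add: distrib_right divide_inverse mult.commute)
    \<comment> \<open>The gradient is already tangent, so it may be moved under the projection to
      match (A2).\<close>
    have cg: "tangent_proj M ?p (cov_grad f M ?p) = cov_grad f M ?p"
      by (rule closest_point_self[OF cov_grad_tangent[OF pin]])
    have "tangent_proj M ?p (?x' - x) = - (a *\<^sub>R tangent_proj M ?p (G a x v))"
      by (simp add: linear_neg[OF lin] linear_scale[OF lin])
    then have "R = (closest_point M ?x' - ?p) + a *\<^sub>R tangent_proj M ?p (G a x v)"
      by (simp only: R_def diff_minus_eq_add)
    then have "(closest_point M ?x' - ?p) /\<^sub>R a = R /\<^sub>R a - tangent_proj M ?p (G a x v)"
      using a by (simp add: scaleR_add_right)
    then have "shadow_error \<delta> a x ?x' v = R /\<^sub>R a - tangent_proj M ?p (G a x v - cov_grad f M ?p - v)"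
      unfolding shadow_error_def rx rx' by (simp add: linear_diff[OF lin] cg)
    then have "norm (shadow_error \<delta> a x ?x' v) \<le> norm (R /\<^sub>R a) + norm (tangent_proj M ?p (G a x v - cov_grad f M ?p - v))"
      by (simp only: norm_triangle_ineq4)
    also have "\<dots> \<le> (6 * L * C\<^sup>2 + 6 * L * C) * (?n\<^sup>2 * (?D + a)) + C * ?n\<^sup>2 * (?D + a)"
      by (rule add_mono[OF R A2[OF x\<rho> a]])
    also have "\<dots> = (6 * L * C\<^sup>2 + 6 * L * C + C) * (?n\<^sup>2 * (?D + a))" by (simp add: algebra_simps)
    also have "\<dots> \<le> (6 * L * C\<^sup>2 + 6 * L * C + C + (2 * C\<^sup>2 + (B + 1) * C) / \<delta>) * (?n\<^sup>2 * (?D + a))"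
      using c2 by (intro mult_right_mono nDa) auto
    finally show ?thesis by (simp only: mult.assoc)
  next
    case False
    then have rx': "retract \<delta> ?x' = xbar" by (simp add: retract_def)
    have "2 * \<delta> < dist xbar ?x'" using False by simp
    also have "\<dots> \<le> dist xbar x + s" unfolding s_def by (metis dist_norm dist_commute dist_triangle)
    finally have "\<delta> < s" using x by simp
    \<comment> \<open>\<open>t\<close> is the bound on the step length divided by \<delta>, hence at
      least 1 after a jump. A factor t^2 turns the displacement term 2 \<delta> / a into one of
      order (1 + |v|)^2 a; a single factor \<open>t\<close> does so for the gradient and noise
      terms.\<close>
    define t where "t = a * (C * ?n) / \<delta>"
    have t: "1 \<le> t" using s \<open>\<delta> < s\<close> \<delta> by (simp add: t_def)
    have "norm (xbar - ?p) \<le> 2 * \<delta>"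
      using closest_point_M(3)[OF x\<rho>' \<rho>2] x by (simp add: dist_norm)
    also have "\<dots> \<le> 2 * \<delta> * t\<^sup>2" using t \<delta> by simp
    finally have "norm (xbar - ?p) / a \<le> 2 * \<delta> * t\<^sup>2 / a" using a by (intro divide_right_mono) auto
    also have "\<dots> = 2 * C\<^sup>2 / \<delta> * (?n\<^sup>2 * a)" using a \<delta> by (simp add: t_def power2_eq_square field_simps)
    finally have 1: "norm ((xbar - ?p) /\<^sub>R a) \<le> 2 * C\<^sup>2 / \<delta> * (?n\<^sup>2 * a)"
      using a by (simp add: divide_inverse mult.commute)
    have "norm (cov_grad f M ?p) + norm (tangent_proj M ?p v) \<le> B + norm v"
      by (intro add_mono cov_grad_bounded[OF pin] norm_closest_point_subspace[OF sub])
    also have "\<dots> \<le> (B + 1) * ?n" using B0 by (simp add: algebra_simps)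
    also have "\<dots> \<le> (B + 1) * ?n * t" using t B0 by (simp add: mult_left_mono[of 1 t "(B + 1) * ?n", simplified])
    also have "\<dots> = (B + 1) * C / \<delta> * (?n\<^sup>2 * a)" by (simp add: t_def power2_eq_square mult_ac)
    finally have 2: "norm (cov_grad f M ?p) + norm (tangent_proj M ?p v) \<le> (B + 1) * C / \<delta> * (?n\<^sup>2 * a)" .
    have "norm (shadow_error \<delta> a x ?x' v) \<le> norm ((xbar - ?p) /\<^sub>R a) + norm (cov_grad f M ?p) + norm (tangent_proj M ?p v)"
      unfolding shadow_error_def rx rx' by (intro norm_triangle_mono norm_triangle_ineq order_refl)
    also have "\<dots> \<le> 2 * C\<^sup>2 / \<delta> * (?n\<^sup>2 * a) + (B + 1) * C / \<delta> * (?n\<^sup>2 * a)" using 1 2 by linarith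
    also have "\<dots> = (2 * C\<^sup>2 + (B + 1) * C) / \<delta> * (?n\<^sup>2 * a)" by (simp add: add_divide_distrib distrib_right)
    also have "\<dots> \<le> (6 * L * C\<^sup>2 + 6 * L * C + C + (2 * C\<^sup>2 + (B + 1) * C) / \<delta>) * (?n\<^sup>2 * (?D + a))"
      using c1 c2 D0 a by (intro mult_mono mult_left_mono) auto
    finally show ?thesis by (simp only: mult.assoc)
  qed
qed

text \<open>A crude bound at all outcomes, without stopping. Its constant deteriorates as
  \<open>a\<close> decreases, so it serves only to show that individual terms are finite.\<close>

lemma shadow_error_growth:
  assumes \<delta>: "0 < \<delta>" "2 * \<delta> \<le> \<rho>" and a: "a > 0"
  shows "norm (shadow_error \<delta> a x x' v) \<le> (8 * \<delta> / a + B + 1) * (1 + norm v)"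
proof -
  note y = retract_in_patch[OF \<delta>, of x]
  have B0: "B \<ge> 0" using cov_grad_bounded[OF y] by (meson norm_ge_zero order_trans)
  have "norm (retract \<delta> x' - retract \<delta> x) \<le> dist xbar (retract \<delta> x') + dist xbar (retract \<delta> x)"
    by (metis dist_commute dist_norm dist_triangle)
  also have "\<dots> \<le> 8 * \<delta>" using retract_in[OF \<delta>, of x] retract_in[OF \<delta>, of x'] by simp
  finally have "norm ((retract \<delta> x' - retract \<delta> x) /\<^sub>R a) \<le> 8 * \<delta> / a"
    using a by (simp add: divide_simps)
  moreover have "norm (shadow_error \<delta> a x x' v) \<le> norm ((retract \<delta> x' - retract \<delta> x) /\<^sub>R a)
      + norm (cov_grad f M (retract \<delta> x)) + norm (tangent_proj M (retract \<delta> x) v)"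
    unfolding shadow_error_def by (intro norm_triangle_mono norm_triangle_ineq order_refl)
  moreover have "norm (cov_grad f M (retract \<delta> x)) \<le> B" by (rule cov_grad_bounded[OF y])
  moreover have "norm (tangent_proj M (retract \<delta> x) v) \<le> norm v"
    by (rule norm_closest_point_subspace[OF subspace_tangent[OF y]])
  ultimately have "norm (shadow_error \<delta> a x x' v) \<le> (8 * \<delta> / a + B) * 1 + 1 * norm v" by simp
  also have "\<dots> \<le> (8 * \<delta> / a + B + 1) * (1 + norm v)"
  proof -
    define c where "c = 8 * \<delta> / a + B"
    have "0 \<le> c * norm v" using \<delta> a B0 by (simp add: c_def)
    then show ?thesis unfolding c_def[symmetric] by (simp add: algebra_simps)
  qed
  finally show ?thesis .
qed

text \<open>Where \<open>retract\<close> uses it, the nearest-point map is 2-Lipschitz and hence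
  continuous, although defined by choice; elsewhere \<open>retract\<close> is constant.\<close>

lemma retract_measurable:
  assumes \<delta>: "0 < \<delta>" "2 * \<delta> \<le> \<rho>"
  shows "retract \<delta> \<in> borel_measurable borel"
proof -
  let ?S = "cball xbar (2 * \<delta>)"
  have "2-lipschitz_on ?S (closest_point M)"
  proof (rule lipschitz_onI)
    fix x x' assume "x \<in> ?S" "x' \<in> ?S"
    then have "x \<in> cball xbar \<rho>" "x' \<in> cball xbar \<rho>" using \<delta> by auto
    from closest_point_expansion(1)[OF this(2,1) \<rho>(2,3)]
    show "dist (closest_point M x) (closest_point M x') \<le> 2 * dist x x'" by (simp add: dist_norm)
  qed simp
  then have "continuous_on ?S (closest_point M)" by (rule lipschitz_on_continuous_on)
  then have m: "(\<lambda>x. indicator ?S x *\<^sub>R closest_point M x) \<in> borel_measurable borel"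
    by (intro borel_measurable_continuous_on_indicator) auto
  have eq: "retract \<delta> = (\<lambda>x. indicator ?S x *\<^sub>R closest_point M x + (1 - indicat_real ?S x) *\<^sub>R xbar)"
    by (auto simp: retract_def fun_eq_iff indicator_def)
  have "indicat_real ?S \<in> borel_measurable borel" by (intro borel_measurable_indicator borel_closed) auto
  then show ?thesis unfolding eq
    by (intro borel_measurable_add m borel_measurable_scaleR borel_measurable_diff borel_measurable_const)
qed

text \<open>Nothing is known about \<open>g\<close> off the patch. Multiplying by the indicator of
  the compact patch gives a Borel function with the same values along \<open>Y\<close>.\<close>

lemma patch_measurable:
  assumes c: "continuous_on (M \<inter> cball xbar r) g" and Y: "Y \<in> borel_measurable N"
    and in_patch: "\<And>w. w \<in> space N \<Longrightarrow> Y w \<in> M \<inter> cball xbar r"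
  shows "(\<lambda>w. g (Y w) :: 'a) \<in> borel_measurable N"
proof -
  let ?S = "M \<inter> cball xbar r"
  have "?S \<in> sets borel" using compact_patch by (intro borel_closed compact_imp_closed)
  then have "(\<lambda>y. indicator ?S y *\<^sub>R g y) \<in> borel_measurable borel"
    using c by (intro borel_measurable_continuous_on_indicator)
  from measurable_compose[OF Y this] show ?thesis
    by (subst measurable_cong[where g = "\<lambda>w. indicator ?S (Y w) *\<^sub>R g (Y w)"]) (use in_patch in auto)
qed

lemma tangent_proj_measurable:
  assumes Y: "Y \<in> borel_measurable N" and v: "v \<in> borel_measurable N"
    and in_patch: "\<And>w. w \<in> space N \<Longrightarrow> Y w \<in> M \<inter> cball xbar r"
  shows "(\<lambda>w. tangent_proj M (Y w) (v w)) \<in> borel_measurable N"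
proof -
  have eq: "tangent_proj M (Y w) (v w) = (\<Sum>b\<in>Basis. (v w \<bullet> b) *\<^sub>R tangent_proj M (Y w) b)"
    if "w \<in> space N" for w
  proof -
    note lin = linear_closest_point_subspace[OF subspace_tangent[OF in_patch[OF that]]]
    have "tangent_proj M (Y w) (v w) = tangent_proj M (Y w) (\<Sum>b\<in>Basis. (v w \<bullet> b) *\<^sub>R b)"
      by (simp add: euclidean_representation)
    then show ?thesis by (simp only: linear_sum[OF lin] linear_scale[OF lin])
  qed
  note [measurable] = patch_measurable[OF continuous_on_tangent_proj Y in_patch] v
  show ?thesis by (subst measurable_cong[OF eq]) measurable
qed

lemma shadow_error_measurable:
  assumes \<delta>: "0 < \<delta>" "2 * \<delta> \<le> \<rho>"
    and X: "X \<in> borel_measurable N" "X' \<in> borel_measurable N" and v: "v \<in> borel_measurable N"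
  shows "(\<lambda>w. shadow_error \<delta> a (X w) (X' w) (v w)) \<in> borel_measurable N"
proof -
  note Y = measurable_compose[OF X(1) retract_measurable[OF \<delta>]] measurable_compose[OF X(2) retract_measurable[OF \<delta>]]
  note [measurable] = Y patch_measurable[OF cov_grad_cont Y(1) retract_in_patch[OF \<delta>]]
    tangent_proj_measurable[OF Y(1) v retract_in_patch[OF \<delta>]]
  show ?thesis unfolding shadow_error_def by measurable
qed

end

text \<open>By self-adjointness, coordinate \<open>b\<close> of the projected noise is the inner
  product of the noise with the projection of \<open>b\<close>, which is known at time k and has
  norm at most 1.\<close>

lemma (in adapted_noise) tangent_noise:
  assumes patch: "manifold_patch M xbar r L" and k: "k \<ge> 1"
    and Y: "Y \<in> borel_measurable (F k)" and in_patch: "\<And>w. w \<in> space P \<Longrightarrow> Y w \<in> M \<inter> cball xbar r"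
    and proj: "\<And>b. (\<lambda>w. tangent_proj M (Y w) b) \<in> borel_measurable (F k)"
    and proj_noise: "(\<lambda>w. tangent_proj M (Y w) (\<nu> k w)) \<in> borel_measurable P"
  shows "integrable P (\<lambda>w. tangent_proj M (Y w) (\<nu> k w))"
    and "AE w in P. vec_cond_exp P (F k) (\<lambda>w. tangent_proj M (Y w) (\<nu> k w)) w = 0"
proof -
  interpret manifold_patch M xbar r L by (rule patch)
  interpret S: sigma_finite_subalgebra P "F k" by (rule sigma_finite_F[OF k])
  note sub = subspace_tangent[OF in_patch]
  show int: "integrable P (\<lambda>w. tangent_proj M (Y w) (\<nu> k w))"
    by (rule Bochner_Integration.integrable_bound[OF noise_integrable[OF k] proj_noise])
       (use norm_closest_point_subspace(1)[OF sub] in auto)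
  have "AE w in P. \<forall>b\<in>Basis. real_cond_exp P (F k) (\<lambda>w. tangent_proj M (Y w) (\<nu> k w) \<bullet> b) w = 0"
  proof (rule AE_finite_allI)
    fix b :: 'a assume b: "b \<in> Basis"
    have bd: "norm (tangent_proj M (Y w) b) \<le> 1" if "w \<in> space P" for w
      using norm_closest_point_subspace(1)[OF sub[OF that], of b] b by simp
    have "AE w in P. real_cond_exp P (F k) (\<lambda>w. tangent_proj M (Y w) (\<nu> k w) \<bullet> b) w
        = real_cond_exp P (F k) (\<lambda>w. \<nu> k w \<bullet> tangent_proj M (Y w) b) w"
    proof (rule S.real_cond_exp_cong)
      show "AE w in P. tangent_proj M (Y w) (\<nu> k w) \<bullet> b = \<nu> k w \<bullet> tangent_proj M (Y w) b"
        by (rule AE_I2) (rule closest_point_subspace_self_adjoint[OF sub])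
      show "(\<lambda>w. tangent_proj M (Y w) (\<nu> k w) \<bullet> b) \<in> borel_measurable P" using proj_noise by measurable
      show "(\<lambda>w. \<nu> k w \<bullet> tangent_proj M (Y w) b) \<in> borel_measurable P"
        using noise_measurable[OF k] F_imp_P[OF k proj] by measurable
    qed
    moreover have "AE w in P. real_cond_exp P (F k) (\<lambda>w. \<nu> k w \<bullet> tangent_proj M (Y w) b) w = 0"
      by (rule noise_orthogonal(2)[OF k proj]) (rule bd)
    ultimately show "AE w in P. real_cond_exp P (F k) (\<lambda>w. tangent_proj M (Y w) (\<nu> k w) \<bullet> b) w = 0"
      by eventually_elim simp
  qed simp
  then show "AE w in P. vec_cond_exp P (F k) (\<lambda>w. tangent_proj M (Y w) (\<nu> k w)) w = 0"
    by eventually_elim (simp add: vec_cond_exp_def)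
qed

section \<open>The exit time and the history filtration\<close>

lemma less_exit_time_iff:
  "enat k < exit_time x xbar k0 \<delta> w \<longleftrightarrow> (\<forall>j\<in>{k0..k}. x j w \<in> cball xbar \<delta>)"
proof -
  let ?S = "{j. k0 \<le> j \<and> x j w \<notin> cball xbar \<delta>}"
  have "\<not> enat k < b \<longleftrightarrow> b < enat (Suc k)" for b by (cases b) auto
  then have "\<not> enat k < Inf (enat ` ?S) \<longleftrightarrow> Inf (enat ` ?S) < enat (Suc k)" .
  also have "\<dots> \<longleftrightarrow> (\<exists>j\<in>?S. j \<le> k)" unfolding Inf_less_iff by (auto simp: less_Suc_eq_le)
  finally show ?thesis unfolding exit_time_def by auto
qed

lemma space_history: "space (history P x \<nu> k) = space P"
  by (simp add: history_def space_measure_of_conv)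

lemma sets_history: "sets (history P x \<nu> k) = sigma_sets (space P)
     ({x j -` S \<inter> space P | j S. 1 \<le> j \<and> j \<le> k \<and> S \<in> sets borel} \<union>
      {\<nu> j -` S \<inter> space P | j S. 1 \<le> j \<and> j < k \<and> S \<in> sets borel})"
  unfolding history_def by (rule sets_measure_of) auto

lemma iterate_history_measurable:
  "1 \<le> j \<Longrightarrow> j \<le> k \<Longrightarrow> x j \<in> borel_measurable (history P x \<nu> k)"
  by (intro measurableI) (auto simp: sets_history space_history intro!: sigma_sets.Basic)

lemma subalgebra_history:
  assumes "\<And>j. 1 \<le> j \<Longrightarrow> x j \<in> borel_measurable P" "\<And>j. 1 \<le> j \<Longrightarrow> \<nu> j \<in> borel_measurable P"
  shows "subalgebra P (history P x \<nu> k)"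
  unfolding subalgebra_def space_history sets_history
  using assms by (auto intro!: sets.sigma_sets_subset measurable_sets)

locale shadowed_process = active_patch M xbar r L f G \<rho> \<mu> C \<epsilon> B + adapted_noise P F x \<nu> q
  for M :: "'a::euclidean_space set" and xbar r L f G \<rho> \<mu> C \<epsilon> B
    and P :: "'w measure" and F and x \<nu> :: "nat \<Rightarrow> 'w \<Rightarrow> 'a" and q +
  fixes \<alpha> :: "nat \<Rightarrow> real" and c\<^sub>1 c\<^sub>2 \<gamma> \<delta> Q :: real and k0 :: nat
  assumes x_adapted: "1 \<le> j \<Longrightarrow> j \<le> k \<Longrightarrow> x j \<in> borel_measurable (F k)"
    and x_step: "k \<ge> 1 \<Longrightarrow> w \<in> space P \<Longrightarrow> x (k + 1) w = x k w - \<alpha> k *\<^sub>R G (\<alpha> k) (x k w) (\<nu> k w)"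
    and x_dom: "k \<ge> 1 \<Longrightarrow> w \<in> space P \<Longrightarrow> x k w \<in> edom f"
    and c_const: "c\<^sub>1 > 0" "c\<^sub>2 > 0" "1/2 < \<gamma>" "\<gamma> \<le> 1" "\<mu> > 0" "\<epsilon> \<ge> 0" "Q \<ge> 0"
    and \<alpha>_step: "k \<ge> 1 \<Longrightarrow> c\<^sub>1 * real k powr (-\<gamma>) \<le> \<alpha> k \<and> \<alpha> k \<le> c\<^sub>2 * real k powr (-\<gamma>)"
    and \<delta>: "0 < \<delta>" "2 * \<delta> \<le> \<rho>" and \<delta>_step: "2 * \<delta> \<le> \<mu> * c\<^sub>1"
    and Q: "z \<in> cball xbar \<delta> \<Longrightarrow> q z \<le> Q" and \<epsilon>_Q: "8 * (1 + Q) * (2 * \<epsilon>) \<le> \<mu>"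
    and k0_pos: "k0 \<ge> 1"
begin

text \<open>The event that the exit time exceeds k, as a finite intersection whose measurability at
  time k is visible. Before \<open>k0\<close> it is the whole space.\<close>

definition "A k = {w \<in> space P. \<forall>j\<in>{k0..k}. x j w \<in> cball xbar \<delta>}"
definition "y k w = retract \<delta> (x k w)"
definition "E k w = shadow_error \<delta> (\<alpha> k) (x k w) (x (k + 1) w) (\<nu> k w)"
definition "C\<^sub>1 = 6 * L * C\<^sup>2 + 6 * L * C + C + (2 * C\<^sup>2 + (B + 1) * C) / \<delta>"

lemma \<alpha>_pos: "k \<ge> 1 \<Longrightarrow> \<alpha> k > 0"
  using \<alpha>_step[of k] step_size_pos[OF c_const(1)] by blast

lemma A_iff: "w \<in> A k \<longleftrightarrow> w \<in> space P \<and> enat k < exit_time x xbar k0 \<delta> w"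
  by (auto simp: A_def less_exit_time_iff)

lemma A_in_dom: "k \<ge> k0 \<Longrightarrow> w \<in> A k \<Longrightarrow> x k w \<in> cball xbar \<delta> \<inter> edom f"
  using x_dom[of k w] k0_pos by (auto simp: A_def)

lemma y_measurable: "1 \<le> j \<Longrightarrow> j \<le> k \<Longrightarrow> y j \<in> borel_measurable (F k)"
  unfolding y_def by (rule measurable_compose[OF x_adapted retract_measurable[OF \<delta>]])

lemma y_in_patch: "y k w \<in> M \<inter> cball xbar r"
  unfolding y_def by (rule retract_in_patch[OF \<delta>])

lemma E_measurable: "k \<ge> 1 \<Longrightarrow> E k \<in> borel_measurable (F (k + 1))"
  unfolding E_def using mds
  by (intro shadow_error_measurable[OF \<delta>] x_adapted) (auto simp: martingale_difference_def)

lemma y_recursion: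
  assumes k: "k \<ge> 1"
  shows "y (k + 1) w = y k w - \<alpha> k *\<^sub>R cov_grad f M (y k w) - \<alpha> k *\<^sub>R tangent_proj M (y k w) (\<nu> k w)
     + \<alpha> k *\<^sub>R E k w"
  using \<alpha>_pos[OF k] by (simp add: y_def E_def shadow_error_def scaleR_add_right)

lemma tangent_noise_y:
  assumes k: "k \<ge> 1"
  shows "integrable P (\<lambda>w. tangent_proj M (y k w) (\<nu> k w))"
    and "AE w in P. vec_cond_exp P (F k) (\<lambda>w. tangent_proj M (y k w) (\<nu> k w)) w = 0"
proof -
  have Y: "y k \<in> borel_measurable (F k)" using y_measurable k by auto
  have proj: "(\<lambda>w. tangent_proj M (y k w) b) \<in> borel_measurable (F k)" for b
    by (rule tangent_proj_measurable[OF Y]) (use y_in_patch in auto)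
  have "(\<lambda>w. tangent_proj M (y k w) (\<nu> k w)) \<in> borel_measurable P"
    by (rule tangent_proj_measurable[OF F_imp_P[OF k Y] noise_measurable[OF k]]) (use y_in_patch in auto)
  from tangent_noise[OF manifold_patch_axioms k Y y_in_patch proj this]
  show "integrable P (\<lambda>w. tangent_proj M (y k w) (\<nu> k w))"
    "AE w in P. vec_cond_exp P (F k) (\<lambda>w. tangent_proj M (y k w) (\<nu> k w)) w = 0" by auto
qed

text \<open>The residual is written with \<open>y\<close>, which is measurable on the whole space;
  on \<open>A k\<close> it is the nearest point itself.\<close>

sublocale stopped: stopped_process P F x \<nu> q A "\<lambda>k w. infdist (x k w) M" "\<lambda>k w. x k w - y k w" E \<alpha>
  c\<^sub>1 c\<^sub>2 \<gamma> \<mu> \<epsilon> \<delta> Q C C\<^sub>1 "\<lambda>k. 8 * \<delta> / \<alpha> k + B + 1" k0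
proof
  have "0 \<le> B" using cov_grad_bounded[OF y_in_patch[of 0]] by (meson norm_ge_zero order_trans)
  then show "0 \<le> C\<^sub>1" using L_nonneg C \<delta> by (simp add: C\<^sub>1_def)
  have A_sets: "A k \<in> sets (F k)" if k: "k \<ge> 1" for k
  proof -
    have "{w \<in> space (F k). \<forall>j\<in>{k0..k}. x j w \<in> cball xbar \<delta>} \<in> sets (F k)"
    proof (rule sets.sets_Collect_finite_All)
      fix j assume "j \<in> {k0..k}"
      then have "x j \<in> borel_measurable (F k)" using k0_pos by (intro x_adapted) auto
      from measurable_sets[OF this, of "cball xbar \<delta>"]
      show "{w \<in> space (F k). x j w \<in> cball xbar \<delta>} \<in> sets (F k)"
        by (simp add: vimage_def Int_def conj_commute del: mem_cball)
    qed simp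
    then show ?thesis by (simp add: A_def space_F[OF k])
  qed
  then show "A k \<in> sets (F k)" if "k \<ge> 1" for k using that .
  have xk: "x k \<in> borel_measurable (F k)" if "k \<ge> 1" for k using that by (intro x_adapted) auto
  then show "(\<lambda>w. infdist (x k w) M) \<in> borel_measurable (F k)" if "k \<ge> 1" for k
    using that by (intro measurable_compose[OF xk] borel_measurable_continuous_onI continuous_intros)
  show "(\<lambda>w. indicat_real (A k) w *\<^sub>R (x k w - y k w)) \<in> borel_measurable (F k)" if "k \<ge> 1" for k
    using A_sets[OF that] xk[OF that] y_measurable[OF that order_refl] by measurable
  have yk: "y k w = closest_point M (x k w)" if "k \<ge> k0" "w \<in> A k" for k w
    using A_in_dom[OF that] \<delta> by (auto simp: y_def retract_def)
  have in\<rho>: "x k w \<in> cball xbar \<rho> \<inter> edom f" if "k \<ge> k0" "w \<in> A k" for k w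
    using A_in_dom[OF that] \<delta> by auto
  show le: "infdist (x k w) M \<le> \<delta>" if "k \<ge> k0" "w \<in> A k" for k w
    using infdist_le[OF xbar, of "x k w"] A_in_dom[OF that] by (auto simp: dist_commute)
  show "norm (x k w - y k w) \<le> \<delta>" if "k \<ge> k0" "w \<in> A k" for k w
    using le[OF that] closest_point_M(2)[of "x k w", OF _ \<rho>2] in\<rho>[OF that] by (simp add: yk[OF that] dist_norm)
  have space: "w \<in> space P" if "w \<in> A k" for k w using that by (auto simp: A_def)
  show "(infdist (x (k + 1) w) M)\<^sup>2 \<le> (infdist (x k w) M)\<^sup>2
         - 2 * \<alpha> k * (\<mu> * infdist (x k w) M - (1 + norm (\<nu> k w))\<^sup>2 * (\<epsilon> * infdist (x k w) M + C * \<alpha> k) + \<nu> k w \<bullet> (x k w - y k w))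
         + (\<alpha> k)\<^sup>2 * (C * (1 + norm (\<nu> k w)))\<^sup>2" if k: "k \<ge> k0" "w \<in> A k" for k w
  proof -
    have "k \<ge> 1" using k k0_pos by simp
    then show ?thesis unfolding x_step[OF \<open>k \<ge> 1\<close> space[OF k(2)]] yk[OF k]
      by (intro distance_descent in\<rho>[OF k] \<alpha>_pos)
  qed
  show "E k \<in> borel_measurable P" if "k \<ge> 1" for k
    using F_imp_P[of "k + 1"] E_measurable[OF that] by simp
  show "norm (E k w) \<le> C\<^sub>1 * (1 + norm (\<nu> k w))\<^sup>2 * (infdist (x k w) M + \<alpha> k)"
    if k: "k \<ge> k0" "w \<in> A k" for k w
  proof -
    have "k \<ge> 1" using k k0_pos by simp
    then show ?thesis unfolding E_def C\<^sub>1_def x_step[OF \<open>k \<ge> 1\<close> space[OF k(2)]]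
      by (intro shadow_error_bound[OF \<delta>] A_in_dom[OF k] \<alpha>_pos)
  qed
  show "norm (E k w) \<le> (8 * \<delta> / \<alpha> k + B + 1) * (1 + norm (\<nu> k w))" if "k \<ge> 1" for k w
    unfolding E_def by (intro shadow_error_growth[OF \<delta>] \<alpha>_pos that)
  show "A (k + 1) \<subseteq> A k" for k by (auto simp: A_def)
  show "q (x k w) \<le> Q" if "k \<ge> k0" "w \<in> A k" for k w using A_in_dom[OF that] by (intro Q) auto
qed (use c_const \<alpha>_step k0_pos \<epsilon>_Q \<delta> \<delta>_step C in \<open>auto simp: infdist_nonneg\<close>)

text \<open>An outcome that never leaves the ball lies in every \<open>A (k + i)\<close>, so the
  indicator may be taken inside the sum and weakened termwise; sum and integral are then
  exchanged.\<close>

lemma tail_expectation: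
  "\<exists>K>0. \<forall>k\<ge>1. (\<integral>\<^sup>+w. indicator {w. exit_time x xbar k0 \<delta> w = \<infinity>} w
                  * (\<Sum>i. ennreal (\<alpha> (k + i) * norm (E (k + i) w))) \<partial>P)
           \<le> ennreal K * (\<Sum>i. ennreal ((\<alpha> (k + i))\<^sup>2))"
  (is "\<exists>K>0. \<forall>k\<ge>1. ?lhs k \<le> ennreal K * ?rhs k")
proof -
  obtain K where "0 < K \<and> (\<forall>k\<ge>1. (\<Sum>i. ennreal (\<alpha> (k + i)) *
      stopped.stopped_mean (k + i) (\<lambda>w. norm (E (k + i) w))) \<le> ennreal K * ?rhs k)"
    by (rule exE[OF stopped.E_tail])
  note K = conjunct1[OF this] conjunct2[OF this, rule_format]
  show ?thesis
  proof (intro exI[of _ K] conjI allI impI K(1))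
    fix k :: nat assume k: "k \<ge> 1"
    have [measurable]: "E (k + i) \<in> borel_measurable P" "A (k + i) \<in> sets P" for i
      using k stopped.E_meas[of "k + i"] F_sets_P[OF _ stopped.A_sets, of "k + i"] by auto
    have "?lhs k
        \<le> (\<integral>\<^sup>+w. (\<Sum>i. ennreal (\<alpha> (k + i)) * (ennreal (norm (E (k + i) w)) * indicator (A (k + i)) w)) \<partial>P)"
    proof (rule nn_integral_mono)
      fix w assume w: "w \<in> space P"
      show "indicator {w. exit_time x xbar k0 \<delta> w = \<infinity>} w * (\<Sum>i. ennreal (\<alpha> (k + i) * norm (E (k + i) w)))
          \<le> (\<Sum>i. ennreal (\<alpha> (k + i)) * (ennreal (norm (E (k + i) w)) * indicator (A (k + i)) w))"
      proof (cases "exit_time x xbar k0 \<delta> w = \<infinity>")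
        case True
        then have "w \<in> A (k + i)" for i using w by (simp add: A_iff)
        with True show ?thesis using less_imp_le[OF \<alpha>_pos] k
          by (auto intro!: suminf_le simp: ennreal_mult')
      qed simp
    qed
    also have "\<dots> = (\<Sum>i. ennreal (\<alpha> (k + i)) *
        stopped.stopped_mean (k + i) (\<lambda>w. norm (E (k + i) w)))"
      by (subst nn_integral_suminf, measurable) (subst nn_integral_cmult, measurable)
    also have "\<dots> \<le> ennreal K * ?rhs k" by (rule K(2)[OF k])
    finally show "?lhs k \<le> ennreal K * ?rhs k" .
  qed
qed

end

text \<open>Shrinking the ball turns the o-term into \<epsilon> dist for any prescribed \<epsilon>,
  without touching the constant of Assumption A.\<close>

lemma active_patch_exists:
  assumes A: "assumption_A f G xbar M \<mu>" and \<epsilon>: "\<epsilon> > 0"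
  obtains r L \<rho> C B where "active_patch M xbar r L f G \<rho> \<mu> C \<epsilon> B" "\<rho> \<le> 1"
proof -
  have xM: "xbar \<in> M" and man: "Ck_manifold 3 M" and C2: "C2_on_manifold f M"
    using A by (auto simp: assumption_A_def)
  obtain C U h where C: "C > 0" and U: "xbar \<in> interior U"
    and "\<forall>\<nu>. \<forall>\<alpha>>0. \<forall>x\<in>U \<inter> edom f. norm (G \<alpha> x \<nu>) \<le> C * (1 + norm \<nu>)"
    and "\<forall>\<nu>. \<forall>\<alpha>>0. \<forall>x\<in>U \<inter> edom f.
           norm (tangent_proj M (closest_point M x) (G \<alpha> x \<nu> - cov_grad f M (closest_point M x) - \<nu>))
             \<le> C * (1 + norm \<nu>)\<^sup>2 * (infdist x M + \<alpha>)"
    and h: "((\<lambda>t. h t / t) \<longlongrightarrow> 0) (at_right 0)"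
    and A3: "\<forall>\<^sub>F x in nhds xbar. x \<in> U \<inter> edom f \<longrightarrow> (\<forall>\<nu>. \<forall>\<alpha>>0.
                 (G \<alpha> x \<nu> - \<nu>) \<bullet> (x - closest_point M x)
                   \<ge> \<mu> * infdist x M - (1 + norm \<nu>)\<^sup>2 * (h (infdist x M) + C * \<alpha>))"
    using A unfolding assumption_A_def by (elim conjE exE) (rule that)
  note A1 = this(3)[rule_format] and A2 = this(4)[rule_format]
  obtain U' W F where "local_defining_map 3 M xbar U' W F"
    using man xM by (auto simp: Ck_manifold_def)
  then have "local_defining_map 2 M xbar U' W F"
    using Ck_on_mono[of 2 3 U' F] by (auto simp: local_defining_map_def simp del: Ck_on.simps)
  from manifold_patch_exists[OF this xM] obtain r\<^sub>0 L where patch: "manifold_patch M xbar r\<^sub>0 L" .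
  obtain V fh where ext: "C2_extension f M xbar V fh" using C2 xM by (auto simp: C2_on_manifold_def)
  then obtain r\<^sub>1 where r\<^sub>1: "r\<^sub>1 > 0" "cball xbar r\<^sub>1 \<subseteq> V"
    by (meson C2_extension_def open_contains_cball)
  define r where "r = min r\<^sub>0 r\<^sub>1"
  have r: "r > 0" "cball xbar r \<subseteq> V" using manifold_patch.r_pos[OF patch] r\<^sub>1 by (auto simp: r_def)
  interpret manifold_patch M xbar r L
    using patch r by (intro manifold_patch.smaller[OF patch]) (auto simp: r_def)
  have "compact (cov_grad f M ` (M \<inter> cball xbar r))"
    by (rule compact_continuous_image[OF continuous_on_cov_grad[OF ext r(2)] compact_patch])
  then obtain B where B: "\<And>y. y \<in> M \<inter> cball xbar r \<Longrightarrow> norm (cov_grad f M y) \<le> B"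
    by (metis bounded_iff compact_imp_bounded imageI)
  obtain e\<^sub>1 where e\<^sub>1: "e\<^sub>1 > 0" "cball xbar e\<^sub>1 \<subseteq> U"
    by (metis U mem_interior_cball)
  obtain e\<^sub>2 where e\<^sub>2: "e\<^sub>2 > 0" "\<And>x \<nu> \<alpha>. dist x xbar \<le> e\<^sub>2 \<Longrightarrow> x \<in> U \<inter> edom f \<Longrightarrow> \<alpha> > 0 \<Longrightarrow>
      (G \<alpha> x \<nu> - \<nu>) \<bullet> (x - closest_point M x)
         \<ge> \<mu> * infdist x M - (1 + norm \<nu>)\<^sup>2 * (h (infdist x M) + C * \<alpha>)"
    using A3 unfolding eventually_nhds_metric_le by auto
  have "\<forall>\<^sub>F t in at_right 0. h t / t < \<epsilon>" using order_tendstoD(2)[OF h \<epsilon>] .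
  then obtain \<eta> where \<eta>: "\<eta> > 0" "\<And>t. 0 < t \<Longrightarrow> t < \<eta> \<Longrightarrow> h t / t < \<epsilon>"
    by (auto simp: eventually_at_right_field)
  \<comment> \<open>In order: the unit ball on which \<open>q\<close> will be bounded, the two
    conditions of the nearest-point expansion, the set of (A1) and (A2), the neighbourhood of (A3),
    and distances below \<eta>, where the slope \<epsilon> is valid.\<close>
  define \<rho> where "\<rho> = Min {1, r / 4, 1 / (10 * L + 1), e\<^sub>1, e\<^sub>2, \<eta> / 2}"
  have \<rho>: "\<rho> \<le> 1" "\<rho> \<le> r / 4" "\<rho> \<le> 1 / (10 * L + 1)" "\<rho> \<le> e\<^sub>1" "\<rho> \<le> e\<^sub>2" "\<rho> \<le> \<eta> / 2"
    unfolding \<rho>_def by (auto intro!: Min_le)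
  have \<rho>_pos: "\<rho> > 0"
    unfolding \<rho>_def using r e\<^sub>1 e\<^sub>2 \<eta> L_nonneg by (subst Min_gr_iff) auto
  show thesis
  proof (rule that[OF _ \<rho>(1)], unfold_locales)
    show "0 < \<rho>" "4 * \<rho> \<le> r" using \<rho> \<rho>_pos by auto
    have "(10 * L + 1) * \<rho> \<le> (10 * L + 1) * (1 / (10 * L + 1))"
      using \<rho>(3) L_nonneg by (intro mult_left_mono) auto
    also have "\<dots> = 1" using L_nonneg by simp
    finally show "10 * L * \<rho> \<le> 1" using \<rho>_pos by (simp add: algebra_simps)
    show "continuous_on (M \<inter> cball xbar r) (cov_grad f M)" by (rule continuous_on_cov_grad[OF ext r(2)])
    show "cov_grad f M y \<in> tangent_space M y" if "y \<in> M \<inter> cball xbar r" for y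
      by (rule cov_grad_in_tangent_space[OF ext r(2) that])
    fix x a v assume x: "x \<in> cball xbar \<rho> \<inter> edom f" and a: "(a::real) > 0"
    have xU: "x \<in> U \<inter> edom f" using x \<rho>(4) e\<^sub>1 by auto
    show "norm (G a x v) \<le> C * (1 + norm v)" by (rule A1[OF a xU])
    show "norm (tangent_proj M (closest_point M x) (G a x v - cov_grad f M (closest_point M x) - v))
             \<le> C * (1 + norm v)\<^sup>2 * (infdist x M + a)" by (rule A2[OF a xU])
    have x2: "2 * \<rho> \<le> r" "x \<in> cball xbar \<rho>" using \<rho> \<rho>_pos x by auto
    note cp = closest_point_M(1,2)[OF x2(2,1)]
    show "(G a x v - v) \<bullet> (x - closest_point M x)
             \<ge> \<mu> * infdist x M - (1 + norm v)\<^sup>2 * (\<epsilon> * infdist x M + C * a)"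
    \<comment> \<open>The right-hand limit of h t / t says nothing about h 0. At distance zero,
      however, \<open>x\<close> is its own nearest point, so the left side is 0 and the lower bound
      is at most 0.\<close>
    proof (cases "infdist x M = 0")
      case True
      then show ?thesis using cp(2) C a by simp
    next
      case False
      then have D: "infdist x M > 0" using infdist_nonneg[of x M] by linarith
      have "infdist x M \<le> \<rho>" using infdist_le[OF xM, of x] x by (simp add: dist_commute)
      then have "infdist x M < \<eta>" using \<rho>(6) \<eta>(1) by simp
      then have "h (infdist x M) \<le> \<epsilon> * infdist x M" using \<eta>(2)[OF D] D by (simp add: field_simps)
      then have "(1 + norm v)\<^sup>2 * (h (infdist x M) + C * a) \<le> (1 + norm v)\<^sup>2 * (\<epsilon> * infdist x M + C * a)"
        by (intro mult_left_mono) auto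
      moreover have "dist x xbar \<le> e\<^sub>2" using x \<rho>(5) by (simp add: dist_commute)
      ultimately show ?thesis using e\<^sub>2(2)[OF _ xU a, of v] by linarith
    qed
  qed (use C B in auto)
qed

context shadowed_process
begin

abbreviation before :: "nat \<Rightarrow> 'w set" where
  "before k \<equiv> {w. exit_time x xbar k0 \<delta> w > enat k}"

lemma indicator_exit_time:
  "w \<in> space P \<Longrightarrow> indicator (before k) w = indicator (A k) w"
  by (simp add: A_iff indicator_def)

text \<open>Estimates (a), (b) and (c) under one constant, with the events expressed by the exit
  time.\<close>

definition error_estimates :: "real \<Rightarrow> bool" where
  "error_estimates K \<longleftrightarrow> (\<forall>k\<ge>k0.
        (\<forall>w\<in>space P.
           norm (E k w) * indicator (before k) w
             \<le> K * (1 + norm (\<nu> k w))\<^sup>2 * (infdist (x k w) M + \<alpha> k)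
                 * indicator (before k) w) \<and>
        (AE w in P.
           max (stopped.cond k (\<lambda>w. ennreal (norm (E k w))) w
                  * indicator (before k) w)
               (stopped.cond k (\<lambda>w. ennreal ((norm (E k w))\<^sup>2)) w
                  * indicator (before k) w)
             \<le> ennreal K) \<and>
        (\<integral>\<^sup>+w. ennreal ((norm (E k w))\<^sup>2) * indicator (before k) w \<partial>P)
          \<le> ennreal (K * \<alpha> k)) \<and>
      (AE w in P.
         (\<Sum>i. let k = Suc i in
            ennreal (stopped.weight k) *
            max (ennreal (norm (E k w)) * indicator (before k) w)
                (stopped.cond k (\<lambda>w. ennreal (norm (E k w))) w
                   * indicator (before k) w)) < \<infinity>) \<and>
      (AE w in P.
         (\<Sum>i. let k = Suc i in
            ennreal (stopped.weight k) *
            max (ennreal ((norm (E k w))\<^sup>2) * indicator (before k) w)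
                (stopped.cond k (\<lambda>w. ennreal ((norm (E k w))\<^sup>2)) w
                   * indicator (before k) w)) < \<infinity>) \<and>
      (\<forall>k\<ge>1.
         (\<integral>\<^sup>+w. indicator {w. exit_time x xbar k0 \<delta> w = \<infinity>} w
                  * (\<Sum>i. ennreal (\<alpha> (k + i) * norm (E (k + i) w))) \<partial>P)
           \<le> ennreal K * (\<Sum>i. ennreal ((\<alpha> (k + i))\<^sup>2)))"

lemma error_estimates: "\<exists>K>0. error_estimates K"
proof -
  obtain K\<^sub>1 where "0 < K\<^sub>1 \<and> (\<forall>k\<ge>k0. AE w in P.
     max (stopped.cond k (\<lambda>w. ennreal (norm (E k w))) w * indicator (A k) w)
         (stopped.cond k (\<lambda>w. ennreal ((norm (E k w))\<^sup>2)) w * indicator (A k) w) \<le> ennreal K\<^sub>1)"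
    by (rule exE[OF stopped.E_cond_exp_bounded])
  note K\<^sub>1 = conjunct1[OF this] conjunct2[OF this, rule_format]
  obtain K\<^sub>2 where "0 < K\<^sub>2 \<and> (\<forall>k\<ge>k0.
      stopped.stopped_mean k (\<lambda>w. (norm (E k w))\<^sup>2) \<le> ennreal (K\<^sub>2 * \<alpha> k))"
    by (rule exE[OF stopped.E_second_moment])
  note K\<^sub>2 = conjunct1[OF this] conjunct2[OF this, rule_format]
  obtain K\<^sub>3 where "0 < K\<^sub>3 \<and> (\<forall>k\<ge>1. (\<integral>\<^sup>+w. indicator {w. exit_time x xbar k0 \<delta> w = \<infinity>} w
                  * (\<Sum>i. ennreal (\<alpha> (k + i) * norm (E (k + i) w))) \<partial>P)
           \<le> ennreal K\<^sub>3 * (\<Sum>i. ennreal ((\<alpha> (k + i))\<^sup>2)))"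
    by (rule exE[OF tail_expectation])
  note K\<^sub>3 = conjunct1[OF this] conjunct2[OF this, rule_format]
  define K where "K = Max {K\<^sub>1, K\<^sub>2, K\<^sub>3, C\<^sub>1}"
  have K: "K\<^sub>1 \<le> K" "K\<^sub>2 \<le> K" "K\<^sub>3 \<le> K" "C\<^sub>1 \<le> K" unfolding K_def by (auto intro!: Max_ge)
  have "error_estimates K"
    unfolding error_estimates_def
  proof (intro conjI allI impI ballI, goal_cases)
    case (1 k w)
    then have k1: "k \<ge> 1" using k0_pos by simp
    show ?case
    proof (cases "w \<in> A k")
      case True
      note stopped.E_bound[OF 1(1) True]
      also have "C\<^sub>1 * (1 + norm (\<nu> k w))\<^sup>2 * (infdist (x k w) M + \<alpha> k) \<le> K * (1 + norm (\<nu> k w))\<^sup>2 * (infdist (x k w) M + \<alpha> k)"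
        using K(4) \<alpha>_pos[OF k1] infdist_nonneg[of "x k w" M] by (intro mult_right_mono) auto
      finally show ?thesis using True unfolding indicator_exit_time[OF 1(2)] by simp
    qed (unfold indicator_exit_time[OF 1(2)], simp)
  next
    case (2 k)
    from K\<^sub>1(2)[OF 2] AE_space show ?case
    proof eventually_elim
      case (elim w)
      from order_trans[OF elim(1) ennreal_leI[OF K(1)]] show ?case
        unfolding indicator_exit_time[OF elim(2)] .
    qed
  next
    case (3 k)
    then have k1: "k \<ge> 1" using k0_pos by simp
    have "(\<integral>\<^sup>+w. ennreal ((norm (E k w))\<^sup>2) * indicator (before k) w \<partial>P)
       = stopped.stopped_mean k (\<lambda>w. (norm (E k w))\<^sup>2)"
      by (rule nn_integral_cong) (simp only: indicator_exit_time)
    also note K\<^sub>2(2)[OF 3]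
    also have "ennreal (K\<^sub>2 * \<alpha> k) \<le> ennreal (K * \<alpha> k)"
      using K(2) \<alpha>_pos[OF k1] by (intro ennreal_leI mult_right_mono) auto
    finally show ?case .
  next
    case 4
    from stopped.E_weighted_sums_finite(1) AE_space show ?case
      by eventually_elim (simp only: indicator_exit_time)
  next
    case 5
    from stopped.E_weighted_sums_finite(2) AE_space show ?case
      by eventually_elim (simp only: indicator_exit_time)
  next
    case (6 k)
    show ?case
      by (rule order_trans[OF K\<^sub>3(2)[OF 6]]) (intro mult_right_mono ennreal_leI K(3), simp)
  qed
  moreover have "K > 0" using K K\<^sub>1 by simp
  ultimately show ?thesis by blast
qed

lemma y_eq_shadow: "y = shadow x xbar M \<delta>"
  by (intro ext) (simp only: y_def retract_def shadow_def)

end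

section \<open>Choice of constants and conclusion\<close>

theorem proposition5p2:
  fixes f :: "'a::euclidean_space \<Rightarrow> ereal"
    and G :: "real \<Rightarrow> 'a \<Rightarrow> 'a \<Rightarrow> 'a"
    and P :: "'w measure"
    and x \<nu> :: "nat \<Rightarrow> 'w \<Rightarrow> 'a"
    and \<alpha> :: "nat \<Rightarrow> real"
    and c\<^sub>1 c\<^sub>2 \<gamma> \<mu> :: real
    and q :: "'a \<Rightarrow> real"
    and xbar :: 'a
    and M :: "'a set"
  defines "F \<equiv> history P x \<nu>"
    and "\<tau> \<equiv> exit_time x xbar"
    and "y \<equiv> shadow x xbar M"
  assumes P: "prob_space P"
    and f_range: "\<And>z. f z \<noteq> -\<infinity>"
    and f_closed: "closed_fun f"
    and x_rv: "\<And>k. k \<ge> 1 \<Longrightarrow> x k \<in> borel_measurable P"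
    and \<nu>_rv: "\<And>k. k \<ge> 1 \<Longrightarrow> \<nu> k \<in> borel_measurable P"
    and x_step: "\<And>k \<omega>. k \<ge> 1 \<Longrightarrow> \<omega> \<in> space P \<Longrightarrow>
                   x (k + 1) \<omega> = x k \<omega> - \<alpha> k *\<^sub>R G (\<alpha> k) (x k \<omega>) (\<nu> k \<omega>)"
    and E1: "(\<lambda>(a, z, v). G a z v)
               \<in> borel_measurable (restrict_space borel ({0<..} \<times> edom f \<times> UNIV))"
    and E2_const: "c\<^sub>1 > 0" "c\<^sub>2 > 0" "1/2 < \<gamma>" "\<gamma> \<le> 1"
    and E2: "\<And>k. k \<ge> 1 \<Longrightarrow>
               c\<^sub>1 * real k powr (-\<gamma>) \<le> \<alpha> k \<and> \<alpha> k \<le> c\<^sub>2 * real k powr (-\<gamma>)"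
    and E3_mds: "martingale_difference P F \<nu>"
    and E3_q: "\<And>z. q z \<ge> 0" "\<And>S. bounded S \<Longrightarrow> bounded (q ` S)"
    and E3_moment: "\<And>k. k \<ge> 1 \<Longrightarrow>
          AE \<omega> in P. nn_cond_exp P (F k) (\<lambda>\<omega>. ennreal (norm (\<nu> k \<omega>) ^ 4)) \<omega>
                       < ennreal (q (x k \<omega>))"
    and E4: "\<And>k \<omega>. k \<ge> 1 \<Longrightarrow> \<omega> \<in> space P \<Longrightarrow> x k \<omega> \<in> edom f"
    and A: "assumption_A f G xbar M \<mu>"
  shows "\<forall>\<^sub>F \<delta> in at_right 0. \<forall>k0\<ge>1. \<exists>C>0. \<exists>E :: nat \<Rightarrow> 'w \<Rightarrow> 'a.
    (\<forall>k\<ge>1. E k \<in> borel_measurable (F (k + 1))) \<and>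

    (\<forall>k\<ge>1. \<forall>\<omega>\<in>space P. y \<delta> k \<omega> \<in> cball xbar (4 * \<delta>) \<inter> M) \<and>
    (\<forall>k\<ge>1. \<forall>\<omega>\<in>space P.
       y \<delta> (k + 1) \<omega> = y \<delta> k \<omega> - \<alpha> k *\<^sub>R cov_grad f M (y \<delta> k \<omega>)
                       - \<alpha> k *\<^sub>R tangent_proj M (y \<delta> k \<omega>) (\<nu> k \<omega>) + \<alpha> k *\<^sub>R E k \<omega>) \<and>
    (\<forall>k\<ge>1. integrable P (\<lambda>\<omega>. tangent_proj M (y \<delta> k \<omega>) (\<nu> k \<omega>)) \<and>
       (AE \<omega> in P. vec_cond_exp P (F k) (\<lambda>\<omega>. tangent_proj M (y \<delta> k \<omega>) (\<nu> k \<omega>)) \<omega> = 0)) \<and>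

    ((\<gamma> = 1 \<longrightarrow> c\<^sub>1 \<ge> 32 / \<mu>) \<longrightarrow>
      (\<forall>k\<ge>k0.
        (\<forall>\<omega>\<in>space P.
           norm (E k \<omega>) * indicator {\<omega>. \<tau> k0 \<delta> \<omega> > enat k} \<omega>
             \<le> C * (1 + norm (\<nu> k \<omega>))\<^sup>2 * (infdist (x k \<omega>) M + \<alpha> k)
                 * indicator {\<omega>. \<tau> k0 \<delta> \<omega> > enat k} \<omega>) \<and>
        (AE \<omega> in P.
           max (nn_cond_exp P (F k) (\<lambda>\<omega>. ennreal (norm (E k \<omega>))) \<omega>
                  * indicator {\<omega>. \<tau> k0 \<delta> \<omega> > enat k} \<omega>)
               (nn_cond_exp P (F k) (\<lambda>\<omega>. ennreal ((norm (E k \<omega>))\<^sup>2)) \<omega>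
                  * indicator {\<omega>. \<tau> k0 \<delta> \<omega> > enat k} \<omega>)
             \<le> ennreal C) \<and>
        (\<integral>\<^sup>+\<omega>. ennreal ((norm (E k \<omega>))\<^sup>2) * indicator {\<omega>. \<tau> k0 \<delta> \<omega> > enat k} \<omega> \<partial>P)
          \<le> ennreal (C * \<alpha> k)) \<and>

      (AE \<omega> in P.
         (\<Sum>i. let k = Suc i in
            ennreal (real k powr (\<gamma> - 1) / (ln (real k + 1))\<^sup>2) *
            max (ennreal (norm (E k \<omega>)) * indicator {\<omega>. \<tau> k0 \<delta> \<omega> > enat k} \<omega>)
                (nn_cond_exp P (F k) (\<lambda>\<omega>. ennreal (norm (E k \<omega>))) \<omega>
                   * indicator {\<omega>. \<tau> k0 \<delta> \<omega> > enat k} \<omega>)) < \<infinity>) \<and>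
      (AE \<omega> in P.
         (\<Sum>i. let k = Suc i in
            ennreal (real k powr (\<gamma> - 1) / (ln (real k + 1))\<^sup>2) *
            max (ennreal ((norm (E k \<omega>))\<^sup>2) * indicator {\<omega>. \<tau> k0 \<delta> \<omega> > enat k} \<omega>)
                (nn_cond_exp P (F k) (\<lambda>\<omega>. ennreal ((norm (E k \<omega>))\<^sup>2)) \<omega>
                   * indicator {\<omega>. \<tau> k0 \<delta> \<omega> > enat k} \<omega>)) < \<infinity>) \<and>

      (\<forall>k\<ge>1.
         (\<integral>\<^sup>+\<omega>. indicator {\<omega>. \<tau> k0 \<delta> \<omega> = \<infinity>} \<omega>
                  * (\<Sum>i. ennreal (\<alpha> (k + i) * norm (E (k + i) \<omega>))) \<partial>P)
           \<le> ennreal C * (\<Sum>i. ennreal ((\<alpha> (k + i))\<^sup>2))))"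
proof -
  let "\<forall>\<^sub>F \<delta> in at_right 0. \<forall>k0\<ge>1. ?goal \<delta> k0" = ?thesis
  have \<mu>: "\<mu> > 0" using A by (simp add: assumption_A_def)
  have "bounded (q ` cball xbar 1)" by (rule E3_q(2)) simp
  then obtain Q where Q: "\<And>z. z \<in> cball xbar 1 \<Longrightarrow> q z \<le> Q"
    unfolding bounded_iff by (metis abs_le_D1 imageI real_norm_def)
  have Q0: "Q \<ge> 0" using Q[of xbar] E3_q(1)[of xbar] by simp
  \<comment> \<open>Solves 8 (1 + Q) 2 \<epsilon> = \<mu>, the balance required in the moment
    recursion.\<close>
  define \<epsilon> where "\<epsilon> = \<mu> / (16 * (1 + Q))"
  have \<epsilon>: "\<epsilon> > 0" "8 * (1 + Q) * (2 * \<epsilon>) \<le> \<mu>" using \<mu> Q0 by (auto simp: \<epsilon>_def field_simps)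
  obtain r L \<rho> C B where patch: "active_patch M xbar r L f G \<rho> \<mu> C \<epsilon> B" and \<rho>1: "\<rho> \<le> 1"
    using active_patch_exists[OF A \<epsilon>(1)] .
  interpret active_patch M xbar r L f G \<rho> \<mu> C \<epsilon> B by (rule patch)
  interpret prob_space P by (rule P)
  interpret adapted_noise P F x \<nu> q
  proof
    show "subalgebra P (F k)" for k unfolding F_def by (rule subalgebra_history) (use x_rv \<nu>_rv in auto)
  qed (use E3_mds E3_q E3_moment in auto)
  show ?thesis
    unfolding eventually_at_right_field
  \<comment> \<open>The first entry keeps the ball of radius 2 \<delta> inside the one of radius
    \<rho>, the second gives the contraction factor 2. Neither depends on \<open>k0\<close>, so one
    threshold serves all starting times.\<close>
  proof (rule exI[of _ "min (\<rho> / 2) (\<mu> * c\<^sub>1 / 2)"], intro conjI allI impI)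
    show "min (\<rho> / 2) (\<mu> * c\<^sub>1 / 2) > 0" using \<rho>(1) \<mu> E2_const by simp
    fix \<delta> and k0 :: nat assume \<delta>0: "0 < \<delta>" and \<delta>: "\<delta> < min (\<rho> / 2) (\<mu> * c\<^sub>1 / 2)" and k0: "1 \<le> k0"
    interpret S: shadowed_process M xbar r L f G \<rho> \<mu> C \<epsilon> B P F x \<nu> q \<alpha> c\<^sub>1 c\<^sub>2 \<gamma> \<delta> Q k0
    proof
      show "x j \<in> borel_measurable (F k)" if "1 \<le> j" "j \<le> k" for j k
        unfolding F_def by (rule iterate_history_measurable[OF that])
      show "q z \<le> Q" if "z \<in> cball xbar \<delta>" for z using that \<delta> \<rho>1 by (intro Q) auto
    qed (use x_step E4 E2_const E2 \<mu> \<epsilon> Q0 \<delta>0 \<delta> k0 in auto)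
    have y: "y \<delta> = S.y" unfolding y_def S.y_eq_shadow ..
    obtain K where K: "K > 0" "S.error_estimates K" using S.error_estimates by blast
    show "?goal \<delta> k0"
    proof (intro exI[of _ K] exI[of _ S.E] conjI)
      show "0 < K" by (rule K)
      show "\<forall>k\<ge>1. S.E k \<in> borel_measurable (F (k + 1))" using S.E_measurable by blast
      show "\<forall>k\<ge>1. \<forall>\<omega>\<in>space P. y \<delta> k \<omega> \<in> cball xbar (4 * \<delta>) \<inter> M"
        unfolding y S.y_def using retract_in[OF S.\<delta>] by blast
      show "\<forall>k\<ge>1. \<forall>\<omega>\<in>space P. y \<delta> (k + 1) \<omega> = y \<delta> k \<omega> - \<alpha> k *\<^sub>R cov_grad f M (y \<delta> k \<omega>)
             - \<alpha> k *\<^sub>R tangent_proj M (y \<delta> k \<omega>) (\<nu> k \<omega>) + \<alpha> k *\<^sub>R S.E k \<omega>"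
        unfolding y using S.y_recursion by blast
      show "\<forall>k\<ge>1. integrable P (\<lambda>\<omega>. tangent_proj M (y \<delta> k \<omega>) (\<nu> k \<omega>)) \<and>
         (AE \<omega> in P. vec_cond_exp P (F k) (\<lambda>\<omega>. tangent_proj M (y \<delta> k \<omega>) (\<nu> k \<omega>)) \<omega> = 0)"
        unfolding y using S.tangent_noise_y by blast
    qed (rule impI, rule K(2)[unfolded S.error_estimates_def, folded \<tau>_def])
  qed
qed

end
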